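(* Let $A$ be an $n\times n$ matrix drawn from the GOE, and let $\mathcal{L}_A$ be its Laplacian matrix, with largest eigenvalue $\lambda_1(\mathcal{L}_A)$. Let $$a_n := \sqrt{2\log n},\qquad b_n := \sqrt{2\log n}-\frac{\log\log n+\log(4\pi)-2}{2\sqrt{2\log n}}.$$ Then the centered and rescaled largest eigenvalue $a_n\left(\lambda_1(\mathcal{L}_A)-b_n\right)$ converges in distribution as $n\to\infty$ to the standard Gumbel distribution.
   Context: An $n\times n$ real symmetric random matrix $A$ is drawn from the Gaussian Orthogonal Ensemble (GOE) if its entries $A_{ij}$, $1\le i\le j\le n$, are independent Gaussian random variables, $A_{ij}$ having mean zero and variance $\frac{1+\delta_{ij}}{n}$ ($\delta_{ij}$ the Kronecker delta). For a real symmetric $n\times n$ matrix $A$, its Laplacian matrix is $\mathcal{L}_A := D_A-A$, where $D_A$ is the diagonal matrix with $(D_A)_{ii}=\sum_{j=1}^n A_{ij}$. For an $n\times n$ real symmetric matrix $M$, $\lambda_n(M)\le\cdots\le\lambda_1(M)$ denote its ordered eigenvalues. The standard Gumbel distribution has cumulative distribution function $F(x)=\exp(-e^{-x})$, $x\in\mathbb{R}$. *)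

theory Defs
  imports "HOL-Probability.Probability" "Jordan_Normal_Form.Spectral_Radius"
begin

text \<open>Rows and columns are indexed from 0. Only the entries on and above the diagonal are
  required to be independent; the others are determined by symmetry. The last argument of
  \<^const>\<open>normal_density\<close> is the standard deviation.\<close>

definition GOE :: "'w measure \<Rightarrow> nat \<Rightarrow> ('w \<Rightarrow> real mat) \<Rightarrow> bool" where
  "GOE M n A \<longleftrightarrow>
     prob_space M \<and>
     (\<forall>\<omega>\<in>space M. A \<omega> \<in> carrier_mat n n \<and> transpose_mat (A \<omega>) = A \<omega>) \<and>
     prob_space.indep_vars M (\<lambda>_. borel) (\<lambda>(i, j) \<omega>. A \<omega> $$ (i, j)) {(i, j). i \<le> j \<and> j < n} \<and>
     (\<forall>i j. i \<le> j \<and> j < n \<longrightarrow>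
        distributed M lborel (\<lambda>\<omega>. A \<omega> $$ (i, j))
          (normal_density 0 (sqrt ((1 + of_bool (i = j)) / real n))))"

definition laplacian :: "real mat \<Rightarrow> real mat" where
  "laplacian A = mat_diag (dim_row A) (\<lambda>i. \<Sum>j<dim_col A. A $$ (i, j)) - A"

text \<open>Meaningful for real symmetric matrices of positive dimension, whose spectrum is
  finite, nonempty and real; the maximum over an empty spectrum is unspecified.\<close>

definition largest_eigenvalue :: "real mat \<Rightarrow> real" where
  "largest_eigenvalue A = Max (spectrum A)"

definition gumbel :: "real measure" where
  "gumbel = interval_measure (\<lambda>x. exp (- exp (- x)))"

lemma
  shows real_distribution_gumbel: "real_distribution gumbel"
    and cdf_gumbel: "cdf gumbel = (\<lambda>x. exp (- exp (- x)))"
proof -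
  have mono: "exp (- exp (- x)) \<le> exp (- exp (- y))" if "x \<le> y" for x y :: real
    using that by simp
  have cont: "continuous (at_right a) (\<lambda>x::real. exp (- exp (- x)))" for a
    by (intro continuous_intros)
  have bot: "((\<lambda>x::real. exp (- exp (- x))) \<longlongrightarrow> 0) at_bot"
    by (intro filterlim_compose[OF exp_at_bot] filterlim_compose[OF filterlim_uminus_at_bot_at_top]
        filterlim_compose[OF exp_at_top] filterlim_uminus_at_top_at_bot)
  have "((\<lambda>x::real. exp (- x)) \<longlongrightarrow> 0) at_top"
    by (intro filterlim_compose[OF exp_at_bot] filterlim_uminus_at_bot_at_top)
  from tendsto_exp[OF tendsto_minus[OF this]]
  have top: "((\<lambda>x::real. exp (- exp (- x))) \<longlongrightarrow> 1) at_top"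
    by simp
  show "real_distribution gumbel"
    unfolding gumbel_def by (rule real_distribution_interval_measure[OF mono cont bot top])
  show "cdf gumbel = (\<lambda>x. exp (- exp (- x)))"
    unfolding gumbel_def by (rule cdf_interval_measure[OF mono cont bot])
qed

definition scaling_a :: "nat \<Rightarrow> real" where
  "scaling_a n = sqrt (2 * ln (real n))"

definition centering_b :: "nat \<Rightarrow> real" where
  "centering_b n = sqrt (2 * ln (real n)) -
     (ln (ln (real n)) + ln (4 * pi) - 2) / (2 * sqrt (2 * ln (real n)))"

end

theory Submission
  imports Defs "HOL-Real_Asymp.Real_Asymp"
begin

text \<open>
  Write the Laplacian as \<open>D - W\<close>, where \<open>W\<close> is the off-diagonal part of \<open>A\<close> and \<open>D\<close> the diagonal of its
  row sums; the diagonal of \<open>A\<close> cancels. With \<open>a = sqrt (2 ln n)\<close>, the largest row sum \<open>d\<close> is close to \<open>a\<close>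
  and the largest eigenvalue is \<open>d + (1 + o(1)) / a\<close>, which accounts for the 2 in the centering.

  Only the small set \<open>S\<close> of indices whose row sum exceeds a threshold of smaller order than \<open>a\<close> matters.
  With high probability, \<open>W\<close> has bounded norm, its block on any index set as small as \<open>S\<close> has norm
  \<open>O(1 / ln n)\<close>, its columns in any such set act almost isometrically into the complement, and all its
  rows have norm close to 1. The first three facts bound the Rayleigh quotient from above by
  \<open>d + (1 + o(1)) / a\<close>; the trial vector \<open>e\<^sub>i - W e\<^sub>i / d\<close> gives the matching lower bound. Uniformity over
  sparse vectors comes from a union bound over lattice points of a ball.

  The row sums are weakly dependent Gaussians. Any \<open>k\<close> of them become independent after removing the
  \<open>k \<times> k\<close> block they share, which is negligible, so the factorial moments of the number of
  exceedances converge to those of a Poisson variable, and the Bonferroni inequalities give the Gumbel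
  law for the maximum.
\<close>

subsection \<open>Quadratic forms and the largest eigenvalue\<close>

text \<open>Second order perturbation theory predicts the correction: a diagonal entry
  \<open>d\<close>, coupled through \<open>W\<close> to a bulk of row sums of smaller order, moves
  up by the squared norm of its row divided by \<open>d\<close>, that is by about
  \<open>1 / a\<close>. The Gumbel scale is itself \<open>1 / a\<close>, so every error must be of
  smaller order; a norm bound of constant order is useless on the block of large rows. Off
  \<open>S\<close> such a bound suffices, because it enters only a denominator of the form
  \<open>d + k - t - 30\<close>, where it is negligible against \<open>a\<close>. The obstacle is
  that the row sums are functions of \<open>W\<close>: the set \<open>S\<close> is random and
  correlated with the very entries to be estimated. Instead of conditioning on \<open>S\<close>, the
  estimates are proved for all sparse vectors at once, at the price of an entropy of order
  \<open>s * ln n\<close>. The spectrum enters only through inequalities between quadratic forms, so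
  no eigenvector has to be chosen measurably.\<close>

definition bilin :: "nat \<Rightarrow> (nat \<Rightarrow> nat \<Rightarrow> real) \<Rightarrow> (nat \<Rightarrow> real) \<Rightarrow> (nat \<Rightarrow> real) \<Rightarrow> real" where
  "bilin n W x y = (\<Sum>i<n. \<Sum>j<n. x i * W i j * y j)"

definition sqn :: "nat \<Rightarrow> (nat \<Rightarrow> real) \<Rightarrow> real" where
  "sqn n x = (\<Sum>i<n. (x i)\<^sup>2)"

lemma sqn_nonneg [simp]: "0 \<le> sqn n x"
  by (simp add: sqn_def sum_nonneg)

lemma bilin_add_left: "bilin n W (\<lambda>i. x i + y i) z = bilin n W x z + bilin n W y z"
  by (simp add: bilin_def algebra_simps sum.distrib)

lemma bilin_add_right: "bilin n W z (\<lambda>i. x i + y i) = bilin n W z x + bilin n W z y"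
  by (simp add: bilin_def algebra_simps sum.distrib)

lemma bilin_scale_left: "bilin n W (\<lambda>i. c * x i) z = c * bilin n W x z"
  by (simp add: bilin_def algebra_simps sum_distrib_left)

lemma bilin_scale_right: "bilin n W z (\<lambda>i. c * x i) = c * bilin n W z x"
  by (simp add: bilin_def algebra_simps sum_distrib_left)

lemma bilin_left: "bilin n W x y = (\<Sum>i<n. x i * (\<Sum>j<n. W i j * y j))"
  by (simp add: bilin_def sum_distrib_left mult.assoc)

lemma bilin_sym:
  assumes "\<And>i j. i < n \<Longrightarrow> j < n \<Longrightarrow> W i j = W j i"
  shows "bilin n W x y = bilin n W y x"
proof -
  have "bilin n W x y = (\<Sum>j<n. \<Sum>i<n. x i * W i j * y j)"
    unfolding bilin_def by (rule sum.swap)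
  also have "\<dots> = bilin n W y x"
    unfolding bilin_def by (intro sum.cong refl) (use assms in \<open>auto simp: mult_ac\<close>)
  finally show ?thesis .
qed

lemma bilin_scale: "bilin n W (\<lambda>i. c * x i) (\<lambda>i. c * x i) = c\<^sup>2 * bilin n W x x"
  by (simp add: bilin_scale_left bilin_scale_right power2_eq_square)

lemma sqn_scale: "sqn n (\<lambda>i. c * x i) = c\<^sup>2 * sqn n x"
  by (simp add: sqn_def power_mult_distrib sum_distrib_left)

lemma sqn_eq_0: "sqn n x = 0 \<longleftrightarrow> (\<forall>i<n. x i = 0)"
  by (auto simp: sqn_def sum_nonneg_eq_0_iff)

text \<open>Compactness of the unit sphere. Vectors are functions on all of \<open>nat\<close>, so
  the sphere is placed in a product of intervals in the coordinates below \<open>n\<close> and of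
  \<open>{0}\<close> beyond, which is compact by Tychonoff. Homogeneity extends the bound to all
  vectors.\<close>

lemma max_rayleigh_exists:
  assumes n: "n \<ge> 1"
  shows "\<exists>v. sqn n v = 1 \<and> (\<forall>x. bilin n W x x \<le> bilin n W v v * sqn n x)"
proof -
  define K where "K = {v. (\<forall>i. v i \<in> (if i < n then {-1..1} else {0})) \<and> sqn n v = 1}"
  have "compactin (product_topology (\<lambda>i. euclidean) UNIV)
      (PiE UNIV (\<lambda>i. (if i < n then {-1..1} else {0}) :: real set))"
    by (subst compactin_PiE) auto
  then have c: "compact (PiE UNIV (\<lambda>i. (if i < n then {-1..1} else {0}) :: real set))"
    by (simp add: euclidean_product_topology)
  have cont: "continuous_on UNIV (\<lambda>v. sqn n v)" "continuous_on UNIV (\<lambda>v. bilin n W v v)"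
    unfolding sqn_def bilin_def
    by (intro continuous_intros continuous_on_product_coordinates)+
  have "closed ((\<lambda>v. sqn n v) -` {1})"
    using cont(1) by (simp add: continuous_on_closed_vimage)
  from compact_Int_closed[OF c this]
  have "compact K"
    by (rule back_subst[where P=compact]) (auto simp: K_def PiE_def Pi_def)
  moreover have "(\<lambda>i. if i = 0 then 1 else 0) \<in> K"
    using n by (auto simp: K_def sqn_def if_distrib[of "\<lambda>x. x^2"] cong: if_cong)
  then have "K \<noteq> {}" by blast
  ultimately obtain v where v: "v \<in> K" "\<And>w. w \<in> K \<Longrightarrow> bilin n W w w \<le> bilin n W v v"
    using continuous_attains_sup[of K "\<lambda>v. bilin n W v v"] continuous_on_subset[OF cont(2)]
    by (metis subset_UNIV)
  have "bilin n W x x \<le> bilin n W v v * sqn n x" for x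
  proof (cases "sqn n x = 0")
    case True
    then have "bilin n W x x = 0" by (simp add: sqn_eq_0 bilin_def)
    then show ?thesis by (simp add: True)
  next
    case False
    define c where "c = 1 / sqrt (sqn n x)"
    have pos: "sqn n x > 0" using False by (simp add: less_le)
    have c2: "c\<^sup>2 = 1 / sqn n x" using pos by (simp add: c_def power_divide)
    define w where "w i = (if i < n then c * x i else 0)" for i
    have w1: "sqn n w = 1"
    proof -
      have "sqn n w = sqn n (\<lambda>i. c * x i)" by (simp add: sqn_def w_def)
      also have "\<dots> = 1" using pos by (simp only: sqn_scale c2) simp
      finally show ?thesis .
    qed
    have "\<bar>w i\<bar> \<le> 1" if "i < n" for i
    proof -
      have "(w i)\<^sup>2 \<le> sqn n w"
        unfolding sqn_def by (rule member_le_sum) (use that in auto)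
      then show ?thesis using w1 by (simp add: abs_square_le_1)
    qed
    then have "w \<in> K" using w1 by (auto simp: K_def w_def abs_le_iff)
    then have "bilin n W w w \<le> bilin n W v v" by (rule v)
    moreover have "bilin n W w w = bilin n W (\<lambda>i. c * x i) (\<lambda>i. c * x i)"
      by (simp add: bilin_def w_def)
    ultimately show ?thesis using pos by (simp add: bilin_scale c2 field_simps)
  qed
  then show ?thesis using v(1) by (auto simp: K_def)
qed

text \<open>First order stationarity. Moving \<open>v\<close> along its own residual
  \<open>w\<close> changes the gap in the Rayleigh inequality by a quadratic in \<open>t\<close>
  whose linear coefficient is twice \<open>sqn n w\<close>; as the quadratic is never positive, the
  residual vanishes.\<close>

lemma max_rayleigh_eigen:
  assumes sym: "\<And>i j. i < n \<Longrightarrow> j < n \<Longrightarrow> W i j = W j i"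
    and v: "sqn n v = 1" and max: "\<And>x. bilin n W x x \<le> bilin n W v v * sqn n x"
    and i: "i < n"
  shows "(\<Sum>j<n. W i j * v j) = bilin n W v v * v i"
proof -
  define l where "l = bilin n W v v"
  define w where "w i = (\<Sum>j<n. W i j * v j) - l * v i" for i
  have sq: "sqn n (\<lambda>i. v i + t * w i) = 1 + 2 * t * (\<Sum>i<n. v i * w i) + t\<^sup>2 * sqn n w" for t
    using v by (simp add: sqn_def power2_sum power_mult_distrib sum.distrib sum_distrib_left algebra_simps)
  have bl: "bilin n W (\<lambda>i. v i + t * w i) (\<lambda>i. v i + t * w i)
      = l + 2 * t * bilin n W w v + t\<^sup>2 * bilin n W w w" for t
    using bilin_sym[OF sym, where x=v and y=w]
    by (simp add: bilin_add_left bilin_add_right bilin_scale_left bilin_scale_right l_def power2_eq_square algebra_simps)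
  have ww: "bilin n W w v - l * (\<Sum>i<n. v i * w i) = sqn n w"
  proof -
    have "bilin n W w v - l * (\<Sum>i<n. v i * w i) = (\<Sum>i<n. w i * ((\<Sum>j<n. W i j * v j) - l * v i))"
      unfolding bilin_left sum_distrib_left sum_subtractf[symmetric]
      by (intro sum.cong refl) (simp add: algebra_simps sum_distrib_left)
    also have "\<dots> = sqn n w"
      by (simp add: w_def[symmetric] sqn_def power2_eq_square)
    finally show ?thesis .
  qed
  define B where "B = bilin n W w w - l * sqn n w"
  have ineq: "2 * t * sqn n w + t\<^sup>2 * B \<le> 0" for t
  proof -
    have "bilin n W w v = sqn n w + l * (\<Sum>i<n. v i * w i)" using ww by simp
    then show ?thesis
      using max[of "\<lambda>i. v i + t * w i", folded l_def]
      unfolding sq bl B_def by (simp add: algebra_simps)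
  qed
  have "sqn n w = 0"
  proof (rule ccontr)
    assume "sqn n w \<noteq> 0"
    then have p: "sqn n w > 0" by (simp add: less_le)
    \<comment> \<open>Small enough for the linear term to dominate the quadratic one, whatever the
      sign of \<open>B\<close>.\<close>
    define t where "t = sqn n w / (\<bar>B\<bar> + 1)"
    have t: "t > 0" using p by (simp add: t_def)
    have "t * \<bar>B\<bar> \<le> sqn n w"
      using p by (simp add: t_def field_simps)
    then have "t * B \<ge> - sqn n w" using t
      by (smt (verit, best) mult_le_cancel_left_pos mult_minus_right)
    then have "2 * sqn n w + t * B > 0" using p by linarith
    then have "t * (2 * sqn n w + t * B) > 0" using t by simp
    then show False using ineq[of t] by (simp add: power2_eq_square algebra_simps)
  qed
  then have "w i = 0" using i by (simp add: sqn_eq_0)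
  then show ?thesis by (simp add: w_def l_def)
qed

lemma eigenvalue_function:
  assumes A: "A \<in> carrier_mat n n"
  shows "eigenvalue A l \<longleftrightarrow>
    (\<exists>v. sqn n v > 0 \<and> (\<forall>i<n. (\<Sum>j<n. A $$ (i,j) * v j) = l * v i))"
proof
  assume "eigenvalue A l"
  then obtain v where v: "v \<in> carrier_vec n" "v \<noteq> 0\<^sub>v n" "A *\<^sub>v v = l \<cdot>\<^sub>v v"
    using A by (auto simp: eigenvalue_def eigenvector_def)
  have "(\<Sum>j<n. A $$ (i,j) * v $ j) = l * v $ i" if i: "i < n" for i
  proof -
    have "(A *\<^sub>v v) $ i = (\<Sum>j<n. A $$ (i,j) * v $ j)"
      using A v(1) i by (simp add: scalar_prod_def atLeast0LessThan)
    then show ?thesis using v i by simp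
  qed
  moreover have "sqn n (\<lambda>i. v $ i) > 0"
  proof -
    have "sqn n (\<lambda>i. v $ i) \<noteq> 0"
      using v(1,2) by (metis carrier_vecD eq_vecI index_zero_vec sqn_eq_0)
    then show ?thesis by (simp add: less_le)
  qed
  ultimately show "\<exists>v. sqn n v > 0 \<and> (\<forall>i<n. (\<Sum>j<n. A $$ (i,j) * v j) = l * v i)" by blast
next
  assume "\<exists>v. sqn n v > 0 \<and> (\<forall>i<n. (\<Sum>j<n. A $$ (i,j) * v j) = l * v i)"
  then obtain v where v: "sqn n v > 0" "\<And>i. i<n \<Longrightarrow> (\<Sum>j<n. A $$ (i,j) * v j) = l * v i" by blast
  have "A *\<^sub>v vec n v = l \<cdot>\<^sub>v vec n v"
    using A v(2) by (intro eq_vecI) (auto simp: scalar_prod_def atLeast0LessThan)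
  moreover have "vec n v \<noteq> 0\<^sub>v n"
  proof
    assume "vec n v = 0\<^sub>v n"
    then have "\<forall>i<n. v i = 0" by (metis index_vec index_zero_vec(1))
    then show False using v(1) sqn_eq_0[of n v] by simp
  qed
  ultimately show "eigenvalue A l"
    using A unfolding eigenvalue_def eigenvector_def by (intro exI[of _ "vec n v"]) auto
qed

text \<open>The maximal Rayleigh quotient is an eigenvalue and dominates all others. In this form an
  upper bound on the eigenvalue is a family of conditions linear in the matrix entries, which
  probability estimates can handle.\<close>

lemma largest_eigenvalue_rayleigh:
  assumes A: "A \<in> carrier_mat n n" and sym: "\<And>i j. i < n \<Longrightarrow> j < n \<Longrightarrow> A $$ (i,j) = A $$ (j,i)"
    and n: "n \<ge> 1"
  shows "largest_eigenvalue A \<le> c \<longleftrightarrow> (\<forall>x. bilin n (\<lambda>i j. A $$ (i,j)) x x \<le> c * sqn n x)"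
proof -
  let ?W = "\<lambda>i j. A $$ (i,j)"
  obtain v where v: "sqn n v = 1" "\<And>x. bilin n ?W x x \<le> bilin n ?W v v * sqn n x"
    using max_rayleigh_exists[OF n, of ?W] by blast
  define l where "l = bilin n ?W v v"
  have "eigenvalue A l"
    unfolding eigenvalue_function[OF A] l_def
    using max_rayleigh_eigen[OF sym v] v(1) by (intro exI[of _ v]) auto
  moreover have "m \<le> l" if ev: "eigenvalue A m" for m
  proof -
    obtain w where w: "sqn n w > 0" "\<And>i. i<n \<Longrightarrow> (\<Sum>j<n. A $$ (i,j) * w j) = m * w i"
      using ev unfolding eigenvalue_function[OF A] by blast
    have "bilin n ?W w w = m * sqn n w"
    proof -
      have "bilin n ?W w w = (\<Sum>i<n. w i * (m * w i))"
        unfolding bilin_left by (intro sum.cong refl) (metis w(2) lessThan_iff)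
      then show ?thesis
        by (simp add: sqn_def sum_distrib_left power2_eq_square mult_ac)
    qed
    then have "m * sqn n w \<le> l * sqn n w" using v(2)[of w] by (simp add: l_def)
    then show ?thesis using w(1) by simp
  qed
  moreover have "finite (spectrum A)" using card_finite_spectrum[OF A] by simp
  ultimately have "largest_eigenvalue A = l"
    unfolding largest_eigenvalue_def by (intro Max_eqI) (auto simp: spectrum_def)
  moreover have "l \<le> c \<longleftrightarrow> (\<forall>x. bilin n ?W x x \<le> c * sqn n x)"
  proof
    assume "l \<le> c"
    then show "\<forall>x. bilin n ?W x x \<le> c * sqn n x"
      using v(2) unfolding l_def by (meson mult_right_mono order_trans sqn_nonneg)
  next
    assume "\<forall>x. bilin n ?W x x \<le> c * sqn n x"
    then show "l \<le> c" using v(1) unfolding l_def by (metis mult.right_neutral)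
  qed
  ultimately show ?thesis by simp
qed

text \<open>A quadratic inequality is homogeneous, so testing it on integer vectors suffices.\<close>

lemma quadratic_le_iff_int:
  "(\<forall>x. bilin n W x x \<le> c * sqn n x) \<longleftrightarrow>
   (\<forall>z \<in> PiE {..<n} (\<lambda>_. UNIV :: int set). bilin n W (\<lambda>i. of_int (z i)) (\<lambda>i. of_int (z i)) \<le> c * sqn n (\<lambda>i. of_int (z i)))"
  (is "?L \<longleftrightarrow> ?R")
proof
  assume R: ?R
  show ?L
  proof
    fix x :: "nat \<Rightarrow> real"
    define y where "y k i = of_int \<lfloor>real (Suc k) * x i\<rfloor> / real (Suc k)" for k i
    have lim: "(\<lambda>k. y k i) \<longlonglongrightarrow> x i" for i
    proof (rule tendsto_sandwich)
      show "\<forall>\<^sub>F k in sequentially. x i - 1 / real (Suc k) \<le> y k i"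
      proof (intro always_eventually allI)
        fix k
        have "real (Suc k) * x i - 1 \<le> of_int \<lfloor>real (Suc k) * x i\<rfloor>" by linarith
        then have "(real (Suc k) * x i - 1) / real (Suc k) \<le> y k i"
          unfolding y_def by (rule divide_right_mono) simp
        then show "x i - 1 / real (Suc k) \<le> y k i"
          by (simp add: diff_divide_distrib)
      qed
      show "\<forall>\<^sub>F k in sequentially. y k i \<le> x i"
      proof (intro always_eventually allI)
        fix k
        have "of_int \<lfloor>real (Suc k) * x i\<rfloor> \<le> real (Suc k) * x i" by linarith
        then have "y k i \<le> real (Suc k) * x i / real (Suc k)"
          unfolding y_def by (rule divide_right_mono) simp
        then show "y k i \<le> x i" by simp
      qed
      have "(\<lambda>k. x i - 1 / real (Suc k)) \<longlonglongrightarrow> x i - 0"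
        by (intro tendsto_diff tendsto_const LIMSEQ_Suc[OF lim_1_over_n])
      then show "(\<lambda>k. x i - 1 / real (Suc k)) \<longlonglongrightarrow> x i" by simp
    qed simp
    have le: "bilin n W (y k) (y k) \<le> c * sqn n (y k)" for k
    proof -
      define z where "z = (\<lambda>i\<in>{..<n}. \<lfloor>real (Suc k) * x i\<rfloor>)"
      define w where "w i = (1 / real (Suc k)) * of_int (z i)" for i
      have "z \<in> PiE {..<n} (\<lambda>_. UNIV)" by (auto simp: z_def)
      then have "bilin n W (\<lambda>i. of_int (z i)) (\<lambda>i. of_int (z i)) \<le> c * sqn n (\<lambda>i. of_int (z i))"
        using R by blast
      then have "(1 / real (Suc k))\<^sup>2 * bilin n W (\<lambda>i. of_int (z i)) (\<lambda>i. of_int (z i))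
          \<le> (1 / real (Suc k))\<^sup>2 * (c * sqn n (\<lambda>i. of_int (z i)))"
        by (rule mult_left_mono) simp
      then have "bilin n W w w \<le> c * sqn n w"
        unfolding w_def bilin_scale sqn_scale by (simp add: mult_ac)
      moreover have "w i = y k i" if "i < n" for i
        using that by (simp add: w_def y_def z_def)
      then have "bilin n W w w = bilin n W (y k) (y k)" "sqn n w = sqn n (y k)"
        by (simp_all add: bilin_def sqn_def)
      ultimately show ?thesis by simp
    qed
    show "bilin n W x x \<le> c * sqn n x"
    proof (rule LIMSEQ_le)
      show "(\<lambda>k. bilin n W (y k) (y k)) \<longlonglongrightarrow> bilin n W x x"
        unfolding bilin_def by (intro tendsto_intros lim)
      show "(\<lambda>k. c * sqn n (y k)) \<longlonglongrightarrow> c * sqn n x"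
        unfolding sqn_def by (intro tendsto_intros lim)
      show "\<exists>N. \<forall>k\<ge>N. bilin n W (y k) (y k) \<le> c * sqn n (y k)" using le by blast
    qed
  qed
qed blast

subsection \<open>Suprema over lattice points\<close>

abbreviation rv :: "(nat \<Rightarrow> int) \<Rightarrow> nat \<Rightarrow> real" where
  "rv z \<equiv> \<lambda>i. of_int (z i)"

text \<open>The points are extensional functions, \<open>undefined\<close> outside
  \<open>{..<n}\<close>; otherwise the values there would make the set infinite.\<close>

definition int_ball :: "nat \<Rightarrow> real \<Rightarrow> (nat \<Rightarrow> int) set" where
  "int_ball n m = {z \<in> PiE {..<n} (\<lambda>_. UNIV). sqn n (rv z) \<le> m}"

definition supp :: "nat \<Rightarrow> (nat \<Rightarrow> real) \<Rightarrow> nat set" where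
  "supp n x = {i. i < n \<and> x i \<noteq> 0}"

lemma int_ball_subset: "int_ball n m \<subseteq> PiE {..<n} (\<lambda>_. {- int (nat \<lceil>m\<rceil>)..int (nat \<lceil>m\<rceil>)})"
proof
  fix z assume z: "z \<in> int_ball n m"
  have "\<bar>z i\<bar> \<le> int (nat \<lceil>m\<rceil>)" if i: "i < n" for i
  proof -
    \<comment> \<open>For integers the square dominates the absolute value. The resulting box is far
      too large, but it only has to be finite.\<close>
    have "\<bar>z i\<bar> \<le> (z i)\<^sup>2"
      using self_le_power[of "\<bar>z i\<bar>" 2] by (cases "z i = 0") auto
    then have "real_of_int \<bar>z i\<bar> \<le> (of_int (z i))\<^sup>2"
      by (metis of_int_le_iff of_int_power)
    also have "\<dots> \<le> sqn n (rv z)"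
      unfolding sqn_def by (rule member_le_sum) (use i in auto)
    also have "\<dots> \<le> m" using z by (simp add: int_ball_def)
    finally show ?thesis by linarith
  qed
  then show "z \<in> PiE {..<n} (\<lambda>_. {- int (nat \<lceil>m\<rceil>)..int (nat \<lceil>m\<rceil>)})"
    using z by (auto simp: int_ball_def PiE_def Pi_def abs_le_iff minus_le_iff)
qed

lemma finite_int_ball: "finite (int_ball n m)"
  by (rule finite_subset[OF int_ball_subset]) (auto intro: finite_PiE)

text \<open>A truncated theta series. Squares of integers dominate their absolute values, so the two
  tails are geometric with ratio \<open>exp (- b) \<le> 1/2\<close> and together cost at most four
  times that ratio.\<close>

lemma sum_exp_sq_le:
  fixes b :: real
  assumes b: "b \<ge> 1"
  shows "(\<Sum>k\<in>{- int N..int N}. exp (- b * (of_int k)\<^sup>2)) \<le> 1 + 4 * exp (- b)"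
proof -
  define q where "q = exp (- b)"
  have "exp (- b) \<le> exp (- 1)" using b by simp
  also have "exp (- 1) \<le> (1/2 :: real)"
    using exp_ge_add_one_self[of 1] by (simp add: exp_minus field_simps)
  finally have q: "0 < q" "q \<le> 1/2" by (simp_all add: q_def)
  \<comment> \<open>The factor \<open>1 - q ^ N\<close> strengthens the claim so that the induction
    closes: the room left at stage \<open>N\<close> pays for the next two terms.\<close>
  have "(\<Sum>k\<in>{- int N..int N}. exp (- b * (of_int k)\<^sup>2)) \<le> 1 + 4 * q * (1 - q ^ N)"
  proof (induction N)
    case (Suc N)
    have "{- int (Suc N)..int (Suc N)} = insert (- int (Suc N)) (insert (int (Suc N)) {- int N..int N})"
      by auto
    then have "(\<Sum>k\<in>{- int (Suc N)..int (Suc N)}. exp (- b * (of_int k)\<^sup>2))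
        = 2 * exp (- b * (real (Suc N))\<^sup>2) + (\<Sum>k\<in>{- int N..int N}. exp (- b * (of_int k)\<^sup>2))"
      by (simp add: power2_commute[of "-1"])
    also have "exp (- b * (real (Suc N))\<^sup>2) \<le> exp (- b * real (Suc N))"
      using b by (auto simp: power2_eq_square)
    also have "exp (- b * real (Suc N)) = q * q ^ N"
      by (simp add: q_def exp_add[symmetric] exp_of_nat_mult[symmetric] algebra_simps)
    also note Suc.IH
    finally have "(\<Sum>k\<in>{- int (Suc N)..int (Suc N)}. exp (- b * (of_int k)\<^sup>2))
        \<le> 2 * (q * q ^ N) + (1 + 4 * q * (1 - q ^ N))" by simp
    also have "\<dots> \<le> 1 + 4 * q * (1 - q ^ Suc N)"
    proof -
      have "(q * q ^ N) * (4 * q) \<le> (q * q ^ N) * 2" using q by (intro mult_left_mono) auto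
      then show ?thesis by (simp add: algebra_simps)
    qed
    finally show ?case .
  qed simp
  also have "\<dots> \<le> 1 + 4 * q" using q by (simp add: mult_le_cancel_left1)
  finally show ?thesis by (simp add: q_def)
qed

text \<open>Each lattice point of the ball has weight at least 1 under the product weight
  \<open>exp (b (m - |z|\<^sup>2))\<close>.\<close>

lemma card_int_ball:
  fixes b :: real
  assumes b: "b \<ge> 1"
  shows "real (card (int_ball n m)) \<le> exp (b * m) * (1 + 4 * exp (- b)) ^ n"
proof -
  define N where "N = nat \<lceil>m\<rceil>"
  have "real (card (int_ball n m)) = (\<Sum>z\<in>int_ball n m. 1)" by simp
  also have "\<dots> \<le> (\<Sum>z\<in>int_ball n m. exp (b * (m - sqn n (rv z))))"
    using b by (intro sum_mono) (auto simp: int_ball_def)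
  also have "\<dots> \<le> (\<Sum>z\<in>PiE {..<n} (\<lambda>_. {- int N..int N}). exp (b * (m - sqn n (rv z))))"
    using int_ball_subset[of n m] by (intro sum_mono2) (auto intro: finite_PiE simp: N_def)
  also have "\<dots> = (\<Sum>z\<in>PiE {..<n} (\<lambda>_. {- int N..int N}). exp (b * m) * (\<Prod>i<n. exp (- b * (rv z i)\<^sup>2)))"
    by (intro sum.cong refl)
      (simp add: exp_sum[symmetric] exp_add[symmetric] sqn_def sum_distrib_left sum_negf algebra_simps)
  also have "\<dots> = exp (b * m) * (\<Prod>i<n. \<Sum>k\<in>{- int N..int N}. exp (- b * (of_int k)\<^sup>2))"
    by (subst prod_sum_PiE) (auto simp: sum_distrib_left)
  also have "\<dots> \<le> exp (b * m) * (\<Prod>i<n. 1 + 4 * exp (- b))"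
    by (intro mult_left_mono prod_mono conjI sum_exp_sq_le b) (auto intro: sum_nonneg)
  finally show ?thesis by simp
qed

lemma sqrt_sqn: "sqrt (sqn n x) = L2_set x {..<n}"
  by (simp add: sqn_def L2_set_def)

text \<open>Rounding up where \<open>g\<close> is nonnegative and down elsewhere increases the linear form \<open>g\<close>,
  so maxima over the unit ball are controlled by lattice points without any approximation error.\<close>

lemma lattice_rounding:
  assumes h: "h > 0"
  shows "\<exists>z \<in> PiE {..<n} (\<lambda>_. UNIV). supp n (rv z) \<subseteq> supp n x \<and>
    (\<Sum>i<n. g i * x i) \<le> (\<Sum>i<n. g i * (h * rv z i)) \<and>
    h * sqrt (sqn n (rv z)) \<le> sqrt (sqn n x) + h * sqrt (card (supp n x))"
proof -
  define z where "z = (\<lambda>i\<in>{..<n}. if g i \<ge> 0 then \<lceil>x i / h\<rceil> else \<lfloor>x i / h\<rfloor>)"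
  define e where "e i = h * rv z i - x i" for i
  have "supp n (rv z) \<subseteq> supp n x"
    by (auto simp: supp_def z_def)
  moreover have "g i * x i \<le> g i * (h * rv z i)" if "i < n" for i
  proof (cases "g i \<ge> 0")
    case True
    have "x i / h \<le> of_int \<lceil>x i / h\<rceil>" by linarith
    then have "x i \<le> h * of_int \<lceil>x i / h\<rceil>" by (simp only: pos_divide_le_eq[OF h] mult.commute)
    then have "x i \<le> h * rv z i" using True that by (simp add: z_def)
    then show ?thesis using True by (rule mult_left_mono)
  next
    case False
    have "of_int \<lfloor>x i / h\<rfloor> \<le> x i / h" by linarith
    then have "h * of_int \<lfloor>x i / h\<rfloor> \<le> x i" by (simp only: pos_le_divide_eq[OF h] mult.commute)
    then have "h * rv z i \<le> x i" using False that by (simp add: z_def)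
    then show ?thesis using False by (simp add: mult_left_mono_neg)
  qed
  then have "(\<Sum>i<n. g i * x i) \<le> (\<Sum>i<n. g i * (h * rv z i))" by (intro sum_mono) auto
  moreover have "h * sqrt (sqn n (rv z)) \<le> sqrt (sqn n x) + h * sqrt (card (supp n x))"
  proof -
    have eh: "(e i)\<^sup>2 \<le> (if x i \<noteq> 0 then h\<^sup>2 else 0)" if i: "i < n" for i
    proof (cases "x i = 0")
      case False
      have "\<bar>rv z i - x i / h\<bar> \<le> 1" using i by (simp add: z_def) linarith
      then have "\<bar>h * (rv z i - x i / h)\<bar> \<le> h" using h by (simp add: abs_mult)
      moreover have "h * (rv z i - x i / h) = e i" using h by (simp add: e_def field_simps)
      ultimately have "\<bar>e i\<bar> \<le> h" by simp
      then show ?thesis using False h abs_le_square_iff[of "e i" h] by simp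
    qed (use i in \<open>simp add: e_def z_def\<close>)
    have "h * sqrt (sqn n (rv z)) = L2_set (\<lambda>i. h * rv z i) {..<n}"
      using h by (simp add: sqrt_sqn L2_set_right_distrib)
    also have "\<dots> = L2_set (\<lambda>i. x i + e i) {..<n}" by (simp add: e_def)
    also have "\<dots> \<le> L2_set x {..<n} + L2_set e {..<n}" by (rule L2_set_triangle_ineq)
    also have "L2_set e {..<n} \<le> sqrt (h\<^sup>2 * card (supp n x))"
    proof -
      have "(\<Sum>i<n. (e i)\<^sup>2) \<le> (\<Sum>i<n. if x i \<noteq> 0 then h\<^sup>2 else 0)"
        by (intro sum_mono eh) auto
      also have "\<dots> = (\<Sum>i\<in>supp n x. h\<^sup>2)"
        by (subst sum.inter_filter[symmetric]) (auto simp: supp_def intro!: sum.cong)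
      also have "\<dots> = h\<^sup>2 * card (supp n x)" by simp
      finally show ?thesis by (simp add: L2_set_def)
    qed
    also have "sqrt (h\<^sup>2 * card (supp n x)) = h * sqrt (card (supp n x))"
      using h by (simp add: real_sqrt_mult)
    finally show ?thesis by (simp add: sqrt_sqn)
  qed
  moreover have "z \<in> PiE {..<n} (\<lambda>_. UNIV)" by (auto simp: z_def)
  ultimately show ?thesis by blast
qed

text \<open>\<open>P\<close> is a scale-invariant constraint; below it is sparsity, which survives
  scaling because supports do not grow.\<close>

lemma bilin_normalize:
  assumes unit: "\<And>x y. sqn n x = 1 \<Longrightarrow> sqn n y = 1 \<Longrightarrow> P x \<Longrightarrow> P y \<Longrightarrow> bilin n W x y \<le> K"
    and P: "\<And>x c. P x \<Longrightarrow> P (\<lambda>i. c * x i)" and xy: "P x" "P y"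
  shows "bilin n W x y \<le> K * sqrt (sqn n x) * sqrt (sqn n y)"
proof (cases "sqn n x = 0 \<or> sqn n y = 0")
  case True
  then have "bilin n W x y = 0" by (auto simp: bilin_def sqn_eq_0)
  then show ?thesis using True by auto
next
  case False
  then have p: "sqn n x > 0" "sqn n y > 0" by (simp_all add: less_le)
  have "bilin n W (\<lambda>i. (1 / sqrt (sqn n x)) * x i) (\<lambda>i. (1 / sqrt (sqn n y)) * y i) \<le> K"
    using p by (intro unit P xy) (simp_all only: sqn_scale power_divide, simp_all)
  then show ?thesis
    using p by (simp only: bilin_scale_left bilin_scale_right) (simp add: field_simps)
qed

text \<open>With mesh \<open>1 / sqrt s\<close>, rounding a unit vector with at most
  \<open>s\<close> nonzero coordinates moves it by at most 1, so its lattice point has squared norm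
  at most \<open>4 * s\<close>. The form is linear in each argument, hence rounding one argument at
  a time, the other held fixed, never decreases it.\<close>

lemma bilin_sparse_bound:
  assumes grid: "\<And>w z. w \<in> int_ball n (4 * real s) \<Longrightarrow> z \<in> int_ball n (4 * real s) \<Longrightarrow>
      bilin n W (rv w) (rv z) \<le> t * real s"
    and s: "s > 0" and x: "card (supp n x) \<le> s" and y: "card (supp n y) \<le> s"
  shows "bilin n W x y \<le> t * sqrt (sqn n x) * sqrt (sqn n y)"
proof -
  define h where "h = 1 / sqrt (real s)"
  have h: "h > 0" "h\<^sup>2 = 1 / real s" using s by (simp_all add: h_def power_divide)
  have *: "\<exists>z \<in> int_ball n (4 * real s). (\<Sum>i<n. g i * x i) \<le> (\<Sum>i<n. g i * (h * rv z i))"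
    if x: "sqn n x = 1" "card (supp n x) \<le> s" for x g
  proof -
    obtain z where z: "z \<in> PiE {..<n} (\<lambda>_. UNIV)"
      "(\<Sum>i<n. g i * x i) \<le> (\<Sum>i<n. g i * (h * rv z i))"
      "h * sqrt (sqn n (rv z)) \<le> sqrt (sqn n x) + h * sqrt (card (supp n x))"
      using lattice_rounding[OF h(1)] by blast
    have "h * sqrt (card (supp n x)) \<le> 1"
      using x(2) s by (simp add: h_def)
    then have "h * sqrt (sqn n (rv z)) \<le> 2" using z(3) x by simp
    then have "(h * sqrt (sqn n (rv z)))\<^sup>2 \<le> 2\<^sup>2" using h by (intro power_mono) auto
    then have "sqn n (rv z) \<le> 4 * real s" using s by (simp add: power_mult_distrib h field_simps)
    then show ?thesis using z by (auto simp: int_ball_def)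
  qed
  have unit: "bilin n W x y \<le> t" if x: "sqn n x = 1" "card (supp n x) \<le> s"
    and y: "sqn n y = 1" "card (supp n y) \<le> s" for x y
  proof -
    obtain w where w: "w \<in> int_ball n (4 * real s)"
      "(\<Sum>i<n. (\<Sum>j<n. W i j * y j) * x i) \<le> (\<Sum>i<n. (\<Sum>j<n. W i j * y j) * (h * rv w i))"
      using *[OF x, of "\<lambda>i. \<Sum>j<n. W i j * y j"] by blast
    have "bilin n W x y \<le> bilin n W (\<lambda>i. h * rv w i) y"
      using w(2) by (simp add: bilin_left mult.commute)
    also have "\<dots> = (\<Sum>j<n. (\<Sum>i<n. h * rv w i * W i j) * y j)"
      unfolding bilin_def by (subst sum.swap) (simp add: sum_distrib_right)
    finally have xw: "bilin n W x y \<le> (\<Sum>j<n. (\<Sum>i<n. h * rv w i * W i j) * y j)" .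
    obtain z where z: "z \<in> int_ball n (4 * real s)"
      "(\<Sum>j<n. (\<Sum>i<n. h * rv w i * W i j) * y j) \<le> (\<Sum>j<n. (\<Sum>i<n. h * rv w i * W i j) * (h * rv z j))"
      using *[OF y, of "\<lambda>j. \<Sum>i<n. h * rv w i * W i j"] by blast
    note xw
    also note z(2)
    also have "(\<Sum>j<n. (\<Sum>i<n. h * rv w i * W i j) * (h * rv z j)) = bilin n W (\<lambda>i. h * rv w i) (\<lambda>i. h * rv z i)"
      unfolding bilin_def by (subst sum.swap) (simp add: sum_distrib_right)
    also have "\<dots> = h\<^sup>2 * bilin n W (rv w) (rv z)"
      by (simp only: bilin_scale_left bilin_scale_right power2_eq_square mult.assoc)
    also have "\<dots> \<le> h\<^sup>2 * (t * real s)" using grid[OF w(1) z(1)] by (rule mult_left_mono) simp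
    also have "\<dots> = t" using s by (simp add: h)
    finally show ?thesis .
  qed
  show ?thesis
  proof (rule bilin_normalize[where P="\<lambda>x. card (supp n x) \<le> s"])
    fix x and c :: real assume a: "card (supp n x) \<le> s"
    have "supp n (\<lambda>i. c * x i) \<subseteq> supp n x" by (auto simp: supp_def)
    then have "card (supp n (\<lambda>i. c * x i)) \<le> card (supp n x)"
      by (rule card_mono[rotated]) (simp add: supp_def)
    then show "card (supp n (\<lambda>i. c * x i)) \<le> s" using a by simp
  qed (use unit x y in auto)
qed

text \<open>The rows in \<open>S\<close> are left out because they share entries with each other by
  symmetry. For \<open>x\<close> supported in \<open>S\<close>, the remaining coordinates of
  \<open>W x\<close> use pairwise disjoint sets of entries and are therefore independent.\<close>

definition off_sqn :: "nat \<Rightarrow> (nat \<Rightarrow> nat \<Rightarrow> real) \<Rightarrow> nat set \<Rightarrow> (nat \<Rightarrow> real) \<Rightarrow> real" where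
  "off_sqn n W S x = (\<Sum>i\<in>{..<n} - S. (\<Sum>j<n. W i j * x j)\<^sup>2)"

lemma off_sqn_scale: "off_sqn n W S (\<lambda>i. c * x i) = c\<^sup>2 * off_sqn n W S x"
proof -
  have "(\<Sum>j<n. W i j * (c * x j))\<^sup>2 = c\<^sup>2 * (\<Sum>j<n. W i j * x j)\<^sup>2" for i
    by (simp add: power_mult_distrib[symmetric] sum_distrib_left mult_ac)
  then show ?thesis by (simp add: off_sqn_def sum_distrib_left)
qed

lemma off_sqn_antimono: "S \<subseteq> T \<Longrightarrow> off_sqn n W T x \<le> off_sqn n W S x"
  unfolding off_sqn_def by (intro sum_mono2) auto

text \<open>A convex function does not decrease when the argument is rounded along its gradient, so
  the lattice again controls the supremum, now with relative mesh \<open>e\<close> and the loss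
  \<open>(1 + e)\<^sup>2\<close>. The hypothesis excludes only the support of the lattice point, not
  \<open>S\<close> itself; by monotonicity this covers every \<open>S\<close> containing the
  support, so no union over sets is taken.\<close>

lemma off_sqn_sparse_bound:
  assumes grid: "\<And>z. z \<in> int_ball n (real s * (1 + 1 / e)\<^sup>2) \<Longrightarrow>
      off_sqn n W (supp n (rv z)) (rv z) \<le> q * sqn n (rv z)"
    and s: "s > 0" and e: "e > 0" and q: "q \<ge> 0"
    and S: "S \<subseteq> {..<n}" "card S \<le> s" and x: "supp n x \<subseteq> S"
  shows "off_sqn n W S x \<le> q * (1 + e)\<^sup>2 * sqn n x"
proof -
  define h where "h = e / sqrt (real s)"
  have h: "h > 0" "h\<^sup>2 = e\<^sup>2 / real s" using s e by (simp_all add: h_def power_divide)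
  have fS: "finite S" using S(1) finite_subset by blast
  have unit: "off_sqn n W S x \<le> q * (1 + e)\<^sup>2" if x: "supp n x \<subseteq> S" "sqn n x = 1" for x
  proof -
    \<comment> \<open>Half the gradient of \<open>off_sqn n W S\<close> at \<open>x\<close>.\<close>
    define g where "g j = (\<Sum>i\<in>{..<n} - S. W i j * (\<Sum>k<n. W i k * x k))" for j
    obtain z where z: "z \<in> PiE {..<n} (\<lambda>_. UNIV)" "supp n (rv z) \<subseteq> supp n x"
      "(\<Sum>i<n. g i * x i) \<le> (\<Sum>i<n. g i * (h * rv z i))"
      "h * sqrt (sqn n (rv z)) \<le> sqrt (sqn n x) + h * sqrt (card (supp n x))"
      using lattice_rounding[OF h(1)] by blast
    have "card (supp n x) \<le> s" using card_mono[OF fS x(1)] S(2) by simp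
    then have "h * sqrt (card (supp n x)) \<le> e"
      using s e by (simp add: h_def field_simps)
    then have "h * sqrt (sqn n (rv z)) \<le> 1 + e" using z(4) x by simp
    then have "(h * sqrt (sqn n (rv z)))\<^sup>2 \<le> (1 + e)\<^sup>2" using h by (intro power_mono) auto
    then have hz: "h\<^sup>2 * sqn n (rv z) \<le> (1 + e)\<^sup>2" by (simp add: power_mult_distrib)
    have "(1 + 1 / e) = (1 + e) / e" using e by (simp add: field_simps)
    then have "sqn n (rv z) \<le> real s * (1 + 1 / e)\<^sup>2"
      using hz e s by (simp add: h power_divide field_simps)
    then have zb: "z \<in> int_ball n (real s * (1 + 1 / e)\<^sup>2)" using z(1) by (simp add: int_ball_def)
    define w where "w i = h * rv z i" for i
    have sw: "(\<Sum>i\<in>{..<n} - S. (\<Sum>k<n. W i k * x k) * (\<Sum>j<n. W i j * y j)) = (\<Sum>j<n. g j * y j)" for y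
    proof -
      have "(\<Sum>i\<in>{..<n} - S. (\<Sum>k<n. W i k * x k) * (\<Sum>j<n. W i j * y j))
          = (\<Sum>i\<in>{..<n} - S. \<Sum>j<n. W i j * (\<Sum>k<n. W i k * x k) * y j)"
        by (intro sum.cong refl) (simp add: sum_distrib_left mult_ac)
      also have "\<dots> = (\<Sum>j<n. \<Sum>i\<in>{..<n} - S. W i j * (\<Sum>k<n. W i k * x k) * y j)"
        by (rule sum.swap)
      finally show ?thesis by (simp add: g_def sum_distrib_right)
    qed
    have "off_sqn n W S x = 2 * (\<Sum>j<n. g j * x j) - off_sqn n W S x"
      unfolding sw[symmetric] by (simp add: off_sqn_def power2_eq_square)
    also have "\<dots> \<le> 2 * (\<Sum>j<n. g j * w j) - off_sqn n W S x"
      using z(3) by (simp add: w_def)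
    also have "\<dots> \<le> off_sqn n W S w"
    proof -
      have sq: "2 * (a * b) \<le> a\<^sup>2 + b\<^sup>2" for a b :: real
        using sum_squares_bound[of a b] by simp
      have "2 * (\<Sum>i\<in>{..<n} - S. (\<Sum>k<n. W i k * x k) * (\<Sum>j<n. W i j * w j))
        \<le> (\<Sum>i\<in>{..<n} - S. (\<Sum>k<n. W i k * x k)\<^sup>2 + (\<Sum>j<n. W i j * w j)\<^sup>2)"
        by (subst sum_distrib_left) (intro sum_mono sq)
      then show ?thesis by (simp add: sw off_sqn_def sum.distrib)
    qed
    also have "off_sqn n W S w = h\<^sup>2 * off_sqn n W S (rv z)"
      unfolding w_def by (rule off_sqn_scale)
    also have "\<dots> \<le> h\<^sup>2 * (q * sqn n (rv z))"
      using grid[OF zb] off_sqn_antimono[OF subset_trans[OF z(2) x(1)], of n W "rv z"]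
      by (intro mult_left_mono) auto
    also have "\<dots> = q * (h\<^sup>2 * sqn n (rv z))" by simp
    also have "\<dots> \<le> q * (1 + e)\<^sup>2" using hz q by (rule mult_left_mono)
    finally show ?thesis .
  qed
  show ?thesis
  proof (cases "sqn n x = 0")
    case True
    then have "off_sqn n W S x = 0" by (simp add: off_sqn_def sqn_eq_0)
    then show ?thesis using True by simp
  next
    case False
    then have p: "sqn n x > 0" by (simp add: less_le)
    have "off_sqn n W S (\<lambda>i. (1 / sqrt (sqn n x)) * x i) \<le> q * (1 + e)\<^sup>2"
    proof (rule unit)
      show "supp n (\<lambda>i. (1 / sqrt (sqn n x)) * x i) \<subseteq> S" using x by (auto simp: supp_def)
      show "sqn n (\<lambda>i. (1 / sqrt (sqn n x)) * x i) = 1"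
        using p by (simp only: sqn_scale power_divide) simp
    qed
    then show ?thesis using p by (simp only: off_sqn_scale power_divide) (simp add: field_simps)
  qed
qed

subsection \<open>Rayleigh quotients of a diagonal matrix minus a symmetric matrix\<close>

lemma sqn_split: "sqn n v = sqn n (\<lambda>i. if i \<in> S then v i else 0) + sqn n (\<lambda>i. if i \<in> S then 0 else v i)"
  unfolding sqn_def sum.distrib[symmetric] by (intro sum.cong refl) auto

text \<open>The coupling between the coordinates in \<open>S\<close> and the others costs at most \<open>Q / D\<close>, by
  AM-GM with the weight \<open>D\<close> for which the remaining coordinates contribute no more than \<open>d + k\<close>.\<close>

lemma rayleigh_upper:
  assumes sym: "\<And>i j. i < n \<Longrightarrow> j < n \<Longrightarrow> W i j = W j i"
    and nrm: "\<And>x y. bilin n W x y \<le> C * sqrt (sqn n x) * sqrt (sqn n y)"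
    and blk: "\<And>x y. supp n x \<subseteq> S \<Longrightarrow> supp n y \<subseteq> S \<Longrightarrow> bilin n W x y \<le> k * sqrt (sqn n x) * sqrt (sqn n y)"
    and off: "\<And>x. supp n x \<subseteq> S \<Longrightarrow> off_sqn n W S x \<le> Q * sqn n x"
    and R: "\<And>i. i < n \<Longrightarrow> R i \<le> d" and RS: "\<And>i. i < n \<Longrightarrow> i \<notin> S \<Longrightarrow> R i \<le> \<tau>"
    and D: "d + k - \<tau> - C > 0" and Q: "Q \<ge> 0"
  shows "(\<Sum>i<n. R i * (v i)\<^sup>2) - bilin n W v v \<le> (d + k + Q / (d + k - \<tau> - C)) * sqn n v"
proof -
  define D where "D = d + k - \<tau> - C"
  have Dp: "D > 0" using D by (simp add: D_def)
  define x where "x i = (if i \<in> S then v i else 0)" for i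
  define y where "y i = (if i \<in> S then 0 else v i)" for i
  have v: "v = (\<lambda>i. x i + y i)" by (auto simp: x_def y_def)
  have nv: "sqn n v = sqn n x + sqn n y" unfolding x_def y_def by (rule sqn_split)
  have sx: "supp n x \<subseteq> S" "supp n (\<lambda>i. (-1) * x i) \<subseteq> S" by (auto simp: supp_def x_def)
  have sq: "sqn n (\<lambda>i. (-1) * x i) = sqn n x" for x by (simp add: sqn_def)
  have "(\<Sum>i<n. R i * (v i)\<^sup>2) \<le> (\<Sum>i<n. d * (x i)\<^sup>2 + \<tau> * (y i)\<^sup>2)"
    using R RS by (intro sum_mono) (auto simp: x_def y_def intro!: mult_right_mono)
  also have "\<dots> = d * sqn n x + \<tau> * sqn n y"
    by (simp add: sqn_def sum.distrib sum_distrib_left)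
  finally have a: "(\<Sum>i<n. R i * (v i)\<^sup>2) \<le> d * sqn n x + \<tau> * sqn n y" .
  have "bilin n W (\<lambda>i. (-1) * x i) x \<le> k * sqn n x"
    using blk[OF sx(2,1)] unfolding sq by (simp add: mult.assoc)
  then have b: "- bilin n W x x \<le> k * sqn n x" unfolding bilin_scale_left by simp
  have "bilin n W (\<lambda>i. (-1) * y i) y \<le> C * sqn n y"
    using nrm[of "\<lambda>i. (-1) * y i" y] unfolding sq by (simp add: mult.assoc)
  then have c: "- bilin n W y y \<le> C * sqn n y" unfolding bilin_scale_left by simp
  have e: "- 2 * bilin n W y x \<le> D * sqn n y + Q / D * sqn n x"
  proof -
    have "- 2 * bilin n W y x = (\<Sum>i<n. - 2 * (y i * (\<Sum>j<n. W i j * x j)))"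
      unfolding bilin_left by (simp add: sum_distrib_left)
    also have "\<dots> \<le> (\<Sum>i<n. D * (y i)\<^sup>2 + (if i \<in> S then 0 else (\<Sum>j<n. W i j * x j)\<^sup>2 / D))"
    proof (intro sum_mono)
      fix i
      have "0 \<le> (D * y i + (\<Sum>j<n. W i j * x j))\<^sup>2 / D" using Dp by simp
      also have "\<dots> = D * (y i)\<^sup>2 + 2 * (y i * (\<Sum>j<n. W i j * x j)) + (\<Sum>j<n. W i j * x j)\<^sup>2 / D"
        using Dp by (simp add: power2_eq_square field_simps)
      finally show "- 2 * (y i * (\<Sum>j<n. W i j * x j)) \<le> D * (y i)\<^sup>2 + (if i \<in> S then 0 else (\<Sum>j<n. W i j * x j)\<^sup>2 / D)"
        by (auto simp: y_def)
    qed
    also have "\<dots> = D * sqn n y + off_sqn n W S x / D"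
    proof -
      have "(\<Sum>i<n. if i \<in> S then 0 else (\<Sum>j<n. W i j * x j)\<^sup>2 / D) = (\<Sum>i\<in>{..<n} - S. (\<Sum>j<n. W i j * x j)\<^sup>2 / D)"
        by (rule sum.mono_neutral_cong_right) auto
      then show ?thesis
        by (simp add: sum.distrib sqn_def off_sqn_def sum_distrib_left sum_divide_distrib)
    qed
    also have "off_sqn n W S x / D \<le> Q / D * sqn n x"
      using off[OF sx(1)] Dp by (simp add: field_simps)
    finally show ?thesis by simp
  qed
  have "bilin n W v v = bilin n W x x + 2 * bilin n W y x + bilin n W y y"
    unfolding v bilin_add_left bilin_add_right using bilin_sym[OF sym, where x=x and y=y] by simp
  then have "(\<Sum>i<n. R i * (v i)\<^sup>2) - bilin n W v v
     \<le> (d + k + Q / D) * sqn n x + (\<tau> + C + D) * sqn n y"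
    using a b c e by (simp add: algebra_simps)
  also have "(\<tau> + C + D) * sqn n y \<le> (d + k + Q / D) * sqn n y"
    using Q Dp by (intro mult_right_mono) (auto simp: D_def)
  finally show ?thesis unfolding nv D_def by (simp add: distrib_left)
qed

text \<open>The trial vector is \<open>e\<^sub>i\<close> minus \<open>1 / d\<close> times the part of the \<open>i\<close>-th row of \<open>W\<close> outside \<open>S\<close>.\<close>

lemma rayleigh_lower:
  assumes sym: "\<And>i j. i < n \<Longrightarrow> j < n \<Longrightarrow> W i j = W j i" and i: "i < n" "W i i = 0"
    and nrm: "\<And>x y. bilin n W x y \<le> C * sqrt (sqn n x) * sqrt (sqn n y)"
    and blk: "\<And>x y. supp n x \<subseteq> insert i S \<Longrightarrow> supp n y \<subseteq> insert i S \<Longrightarrow> bilin n W x y \<le> k * sqrt (sqn n x) * sqrt (sqn n y)"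
    and C: "C > 0" and k: "k \<ge> 0"
    and row: "\<rho> \<le> (\<Sum>j<n. (W i j)\<^sup>2)"
    and R: "R i \<ge> d" and d: "d > 0" and RS: "\<And>i. i < n \<Longrightarrow> i \<notin> S \<Longrightarrow> R i \<ge> - \<tau>"
    and mu: "\<mu> \<ge> 0" "\<mu> * (1 + (C / d)\<^sup>2) \<le> (\<rho> - k\<^sup>2) * (1 / d - (\<tau> + C) / d\<^sup>2)"
    and pos: "1 / d - (\<tau> + C) / d\<^sup>2 \<ge> 0"
  shows "\<exists>v. sqn n v > 0 \<and> (\<Sum>j<n. R j * (v j)\<^sup>2) - bilin n W v v \<ge> (d + \<mu>) * sqn n v"
proof -
  define e where "e j = (if j = i then 1 else 0 :: real)" for j
  define u where "u j = (if j \<in> S then 0 else W i j)" for j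
  define w where "w j = (if j \<in> S then W i j else 0)" for j
  define q where "q = sqn n u"
  define c where "c = 1 / d"
  have c: "c > 0" using d by (simp add: c_def)
  have ei: "bilin n W e y = (\<Sum>j<n. W i j * y j)" for y
  proof -
    have "bilin n W e y = (\<Sum>l<n. if l = i then (\<Sum>j<n. W i j * y j) else 0)"
      unfolding bilin_left by (intro sum.cong refl) (auto simp: e_def)
    then show ?thesis using i by simp
  qed
  have ee: "sqn n e = 1" using i by (simp add: sqn_def e_def if_distrib[of "\<lambda>x. x\<^sup>2"] cong: if_cong)
  have eu: "bilin n W e u = q"
    unfolding ei q_def sqn_def by (intro sum.cong refl) (auto simp: u_def power2_eq_square)
  have ew: "bilin n W e w = sqn n w"
    unfolding ei sqn_def by (intro sum.cong refl) (auto simp: w_def power2_eq_square)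
  have e0: "bilin n W e e = 0"
    unfolding ei using i by (simp add: e_def if_distrib[of "\<lambda>x. W i _ * x"] cong: if_cong)
  have sqb: "s \<le> K\<^sup>2" if "s \<le> K * sqrt s" "s \<ge> 0" "K \<ge> 0" for s K :: real
  proof (cases "s = 0")
    case False
    then have "sqrt s > 0" using that by simp
    have "sqrt s * sqrt s \<le> K * sqrt s" using that by simp
    then have "sqrt s \<le> K" using \<open>sqrt s > 0\<close> by (rule mult_right_le_imp_le)
    then have "(sqrt s)\<^sup>2 \<le> K\<^sup>2" using that by (intro power_mono) auto
    then show ?thesis using that by simp
  qed simp
  \<comment> \<open>Paired with \<open>e\<close>, a part of the \<open>i\<close>-th row yields its
    own squared norm. The bound on the form thus becomes a bound on that norm: \<open>k\<close> for
    the part inside \<open>S\<close>, \<open>C\<close> for the part outside.\<close>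
  have "sqn n w \<le> k * sqrt (sqn n w)"
    using blk[of e w] by (simp add: ew ee supp_def e_def w_def subset_iff)
  then have w: "sqn n w \<le> k\<^sup>2" using k by (intro sqb) auto
  have "q \<le> C * sqrt q" using nrm[of e u] by (simp add: eu ee q_def)
  then have qC: "q \<le> C\<^sup>2" using C by (intro sqb) (auto simp: q_def)
  have "(\<Sum>j<n. (W i j)\<^sup>2) = sqn n w + q"
    unfolding q_def u_def w_def sqn_def sum.distrib[symmetric] by (intro sum.cong refl) auto
  then have q: "\<rho> - k\<^sup>2 \<le> q" using row w by simp
  have q0: "q \<ge> 0" by (simp add: q_def)
  define v where "v j = e j + (- c) * u j" for j
  have ui: "u i = 0" using i by (simp add: u_def)
  have vsq: "(v j)\<^sup>2 = (e j)\<^sup>2 + c\<^sup>2 * (u j)\<^sup>2" for j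
    using ui by (cases "j = i") (auto simp: v_def e_def power_mult_distrib)
  have sv: "sqn n v = 1 + c\<^sup>2 * q"
    using ee by (simp add: sqn_def vsq sum.distrib sum_distrib_left q_def)
  have "(\<Sum>j<n. R j * (v j)\<^sup>2) = (\<Sum>j<n. R j * (e j)\<^sup>2) + c\<^sup>2 * (\<Sum>j<n. R j * (u j)\<^sup>2)"
    by (simp add: vsq sum.distrib sum_distrib_left algebra_simps)
  moreover have "(\<Sum>j<n. R j * (e j)\<^sup>2) = R i"
    using i by (simp add: e_def if_distrib[of "\<lambda>x. x\<^sup>2"] if_distrib[of "\<lambda>x. R _ * x"] cong: if_cong)
  moreover have "(\<Sum>j<n. R j * (u j)\<^sup>2) \<ge> - \<tau> * q"
    unfolding q_def sqn_def sum_distrib_left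
  proof (intro sum_mono)
    fix j assume "j \<in> {..<n}"
    then show "- \<tau> * (u j)\<^sup>2 \<le> R j * (u j)\<^sup>2"
      using RS[of j] mult_right_mono[of "- \<tau>" "R j" "(u j)\<^sup>2"] by (cases "j \<in> S") (auto simp: u_def)
  qed
  then have "c\<^sup>2 * (\<Sum>j<n. R j * (u j)\<^sup>2) \<ge> c\<^sup>2 * (- \<tau> * q)" by (rule mult_left_mono) simp
  ultimately have a: "(\<Sum>j<n. R j * (v j)\<^sup>2) \<ge> d - c\<^sup>2 * \<tau> * q" using R by simp
  have "bilin n W v v = bilin n W e e - 2 * c * q + c\<^sup>2 * bilin n W u u"
    unfolding v_def bilin_add_left bilin_add_right bilin_scale_left bilin_scale_right
    using bilin_sym[OF sym, where x=u and y=e] eu by (simp add: power2_eq_square algebra_simps)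
  moreover have "bilin n W u u \<le> C * q" using nrm[of u u] by (simp add: q_def mult.assoc)
  then have "c\<^sup>2 * bilin n W u u \<le> c\<^sup>2 * (C * q)" by (rule mult_left_mono) simp
  ultimately have b: "bilin n W v v \<le> c\<^sup>2 * C * q - 2 * c * q" using e0 by simp
  have cd: "c\<^sup>2 * d = c" using d by (simp add: c_def power2_eq_square)
  have "\<mu> * (1 + c\<^sup>2 * q) \<le> \<mu> * (1 + (C / d)\<^sup>2)"
    using mult_left_mono[OF qC, of "c\<^sup>2"] mu(1)
    by (intro mult_left_mono) (auto simp: c_def power_divide)
  also have "\<dots> \<le> (\<rho> - k\<^sup>2) * (1 / d - (\<tau> + C) / d\<^sup>2)" by (rule mu)
  also have "\<dots> \<le> q * (1 / d - (\<tau> + C) / d\<^sup>2)" using q pos by (rule mult_right_mono)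
  also have "\<dots> = q * c - q * (c\<^sup>2 * (\<tau> + C))" by (simp add: c_def power_divide algebra_simps)
  finally have m: "\<mu> * (1 + c\<^sup>2 * q) \<le> q * c - q * (c\<^sup>2 * (\<tau> + C))" .
  have "(d + \<mu>) * sqn n v = d + q * (c\<^sup>2 * d) + \<mu> * (1 + c\<^sup>2 * q)"
    by (simp add: sv algebra_simps)
  also have "\<dots> \<le> (\<Sum>j<n. R j * (v j)\<^sup>2) - bilin n W v v"
    using m a b unfolding cd by (simp add: algebra_simps)
  finally have "(d + \<mu>) * sqn n v \<le> (\<Sum>j<n. R j * (v j)\<^sup>2) - bilin n W v v" .
  moreover have "sqn n v > 0" using q0 by (simp add: sv add_pos_nonneg)
  ultimately show ?thesis by blast
qed

subsection \<open>Gaussian tail bounds\<close>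

context prob_space
begin

lemma gauss_lin:
  fixes X :: "'i \<Rightarrow> 'a \<Rightarrow> real"
  assumes I: "finite I" and ind: "indep_vars (\<lambda>_. borel) X I"
    and X: "\<And>e. e \<in> I \<Longrightarrow> distributed M lborel (X e) (normal_density 0 s)" and s: "s > 0"
    and V: "(\<Sum>e\<in>I. (c e)\<^sup>2) > 0"
  shows "distributed M lborel (\<lambda>\<omega>. \<Sum>e\<in>I. c e * X e \<omega>) (normal_density 0 (s * sqrt (\<Sum>e\<in>I. (c e)\<^sup>2)))"
proof -
  \<comment> \<open>A zero coefficient would give a degenerate Gaussian, which has no
    density.\<close>
  define J where "J = {e \<in> I. c e \<noteq> 0}"
  have J: "finite J" "J \<subseteq> I" using I by (auto simp: J_def)
  have ne: "J \<noteq> {}"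
  proof
    assume "J = {}"
    then have "(\<Sum>e\<in>I. (c e)\<^sup>2) = 0" by (intro sum.neutral) (auto simp: J_def)
    then show False using V by simp
  qed
  have "distributed M lborel (\<lambda>\<omega>. \<Sum>e\<in>J. c e * X e \<omega>)
      (normal_density (\<Sum>e\<in>J. 0) (sqrt (\<Sum>e\<in>J. (\<bar>c e\<bar> * s)\<^sup>2)))"
  proof (rule sum_indep_normal[OF J(1) ne])
    show "indep_vars (\<lambda>i. borel) (\<lambda>e \<omega>. c e * X e \<omega>) J"
      by (rule indep_vars_compose2[OF indep_vars_subset[OF ind J(2)], where Y="\<lambda>e x. c e * x"]) simp
    show "distributed M lborel (\<lambda>\<omega>. c e * X e \<omega>) (normal_density 0 (\<bar>c e\<bar> * s))" if "e \<in> J" for e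
      using normal_density_affine[OF X s, of e "c e" 0] that by (simp add: J_def)
  qed (use s in \<open>auto simp: J_def\<close>)
  moreover have "(\<lambda>\<omega>. \<Sum>e\<in>J. c e * X e \<omega>) = (\<lambda>\<omega>. \<Sum>e\<in>I. c e * X e \<omega>)"
    by (rule ext, rule sum.mono_neutral_left) (use I in \<open>auto simp: J_def\<close>)
  moreover have "(\<Sum>e\<in>J. (\<bar>c e\<bar> * s)\<^sup>2) = (\<Sum>e\<in>I. (\<bar>c e\<bar> * s)\<^sup>2)"
    by (rule sum.mono_neutral_left) (use I in \<open>auto simp: J_def\<close>)
  moreover have "sqrt (\<Sum>e\<in>I. (\<bar>c e\<bar> * s)\<^sup>2) = s * sqrt (\<Sum>e\<in>I. (c e)\<^sup>2)"
    using s by (simp add: power_mult_distrib real_sqrt_mult flip: sum_distrib_right)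
  ultimately show ?thesis by simp
qed

lemma nn_integral_normal_density:
  assumes "\<sigma> > 0"
  shows "(\<integral>\<^sup>+x. ennreal (normal_density \<mu> \<sigma> x) \<partial>lborel) = 1"
  using assms by (subst nn_integral_eq_integral) auto

lemma normal_exp_moment:
  assumes Y: "distributed M lborel Y (normal_density 0 s)" and s: "s > 0"
  shows "(\<integral>\<^sup>+\<omega>. ennreal (exp (\<theta> * Y \<omega>)) \<partial>M) = ennreal (exp (\<theta>\<^sup>2 * s\<^sup>2 / 2))"
proof -
  have "(\<integral>\<^sup>+\<omega>. ennreal (exp (\<theta> * Y \<omega>)) \<partial>M)
      = (\<integral>\<^sup>+y. ennreal (normal_density 0 s y) * ennreal (exp (\<theta> * y)) \<partial>lborel)"
    by (rule distributed_nn_integral[OF Y, symmetric]) simp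
  also have "\<dots> = (\<integral>\<^sup>+y. ennreal (exp (\<theta>\<^sup>2 * s\<^sup>2 / 2)) * ennreal (normal_density (\<theta> * s\<^sup>2) s y) \<partial>lborel)"
  proof (intro nn_integral_cong)
    fix y
    have "- y\<^sup>2 / (2 * s\<^sup>2) + \<theta> * y = \<theta>\<^sup>2 * s\<^sup>2 / 2 - (y - \<theta> * s\<^sup>2)\<^sup>2 / (2 * s\<^sup>2)"
      using s by (simp add: field_simps power2_eq_square)
    then have "exp (- y\<^sup>2 / (2 * s\<^sup>2)) * exp (\<theta> * y)
        = exp (\<theta>\<^sup>2 * s\<^sup>2 / 2) * exp (- (y - \<theta> * s\<^sup>2)\<^sup>2 / (2 * s\<^sup>2))"
      by (simp add: exp_add[symmetric])
    then have "normal_density 0 s y * exp (\<theta> * y) = exp (\<theta>\<^sup>2 * s\<^sup>2 / 2) * normal_density (\<theta> * s\<^sup>2) s y"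
      by (simp add: normal_density_def field_simps)
    then show "ennreal (normal_density 0 s y) * ennreal (exp (\<theta> * y))
        = ennreal (exp (\<theta>\<^sup>2 * s\<^sup>2 / 2)) * ennreal (normal_density (\<theta> * s\<^sup>2) s y)"
      by (simp add: ennreal_mult'[symmetric])
  qed
  also have "\<dots> = ennreal (exp (\<theta>\<^sup>2 * s\<^sup>2 / 2))"
    by (simp add: nn_integral_cmult nn_integral_normal_density[OF s])
  finally show ?thesis .
qed

lemma normal_exp_square_moment:
  assumes Y: "distributed M lborel Y (normal_density 0 s)" and s: "s > 0" and t: "2 * \<theta> * s\<^sup>2 < 1"
  shows "(\<integral>\<^sup>+\<omega>. ennreal (exp (\<theta> * (Y \<omega>)\<^sup>2)) \<partial>M) = ennreal (1 / sqrt (1 - 2 * \<theta> * s\<^sup>2))"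
proof -
  \<comment> \<open>Tilting by the exponential of a square turns the density into another centred
    normal one with this standard deviation, up to the factor \<open>r / s\<close>.\<close>
  define r where "r = s / sqrt (1 - 2 * \<theta> * s\<^sup>2)"
  have r: "r > 0" using s t by (simp add: r_def)
  have r2: "r\<^sup>2 = s\<^sup>2 / (1 - 2 * \<theta> * s\<^sup>2)" using t by (simp add: r_def power_divide)
  have "(\<integral>\<^sup>+\<omega>. ennreal (exp (\<theta> * (Y \<omega>)\<^sup>2)) \<partial>M)
      = (\<integral>\<^sup>+y. ennreal (normal_density 0 s y) * ennreal (exp (\<theta> * y\<^sup>2)) \<partial>lborel)"
    by (rule distributed_nn_integral[OF Y, symmetric]) simp
  also have "\<dots> = (\<integral>\<^sup>+y. ennreal (r / s) * ennreal (normal_density 0 r y) \<partial>lborel)"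
  proof (intro nn_integral_cong)
    fix y
    have "- y\<^sup>2 / (2 * s\<^sup>2) + \<theta> * y\<^sup>2 = - y\<^sup>2 / (2 * r\<^sup>2)"
      using s t by (simp add: r2 field_simps)
    then have "exp (- y\<^sup>2 / (2 * s\<^sup>2)) * exp (\<theta> * y\<^sup>2) = exp (- y\<^sup>2 / (2 * r\<^sup>2))"
      by (simp add: exp_add[symmetric])
    moreover have "sqrt (2 * pi * s\<^sup>2) = sqrt (2 * pi) * s" "sqrt (2 * pi * r\<^sup>2) = sqrt (2 * pi) * r"
      using s r by (simp_all add: real_sqrt_mult)
    ultimately have "normal_density 0 s y * exp (\<theta> * y\<^sup>2) = r / s * normal_density 0 r y"
      using s r by (simp add: normal_density_def)
    then show "ennreal (normal_density 0 s y) * ennreal (exp (\<theta> * y\<^sup>2))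
        = ennreal (r / s) * ennreal (normal_density 0 r y)"
      using r s by (simp add: ennreal_mult'[symmetric])
  qed
  also have "\<dots> = ennreal (r / s)"
    by (simp add: nn_integral_cmult nn_integral_normal_density[OF r])
  finally show ?thesis using s by (simp add: r_def)
qed

lemma exp_Markov:
  assumes Z: "Z \<in> borel_measurable M" and K: "(\<integral>\<^sup>+\<omega>. ennreal (exp (Z \<omega>)) \<partial>M) \<le> ennreal K" "K \<ge> 0"
  shows "prob {\<omega> \<in> space M. Z \<omega> \<ge> t} \<le> K * exp (- t)"
proof -
  have "emeasure M {\<omega> \<in> space M. 1 \<le> ennreal (exp (- t)) * ennreal (exp (Z \<omega>))}
      \<le> ennreal (exp (- t)) * (\<integral>\<^sup>+\<omega>. ennreal (exp (Z \<omega>)) * indicator (space M) \<omega> \<partial>M)"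
    using Z by (intro nn_integral_Markov_inequality) auto
  also have "(\<integral>\<^sup>+\<omega>. ennreal (exp (Z \<omega>)) * indicator (space M) \<omega> \<partial>M) = (\<integral>\<^sup>+\<omega>. ennreal (exp (Z \<omega>)) \<partial>M)"
    by (intro nn_integral_cong) auto
  also have "ennreal (exp (- t)) * \<dots> \<le> ennreal (exp (- t)) * ennreal K"
    by (intro mult_left_mono K) auto
  also have "\<dots> = ennreal (K * exp (- t))"
    using K by (simp add: ennreal_mult' mult.commute)
  also have "{\<omega> \<in> space M. 1 \<le> ennreal (exp (- t)) * ennreal (exp (Z \<omega>))} = {\<omega> \<in> space M. Z \<omega> \<ge> t}"
    by (auto simp: ennreal_mult'[symmetric] exp_add[symmetric] simp flip: ennreal_1)
  finally show ?thesis
    using K by (simp add: emeasure_eq_measure)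
qed

lemma normal_tail:
  assumes Y: "distributed M lborel Y (normal_density 0 s)" and s: "s > 0" and t: "t \<ge> 0"
  shows "prob {\<omega> \<in> space M. Y \<omega> \<ge> t} \<le> exp (- t\<^sup>2 / (2 * s\<^sup>2))"
proof (cases "t = 0")
  case False
  then have t: "t > 0" using t by simp
  have m: "Y \<in> borel_measurable M" using distributed_measurable[OF Y] by simp
  \<comment> \<open>The minimiser of the Chernoff exponent; it is positive only for
    \<open>t > 0\<close>, and for \<open>t = 0\<close> the bound is trivial.\<close>
  define \<theta> where "\<theta> = t / s\<^sup>2"
  have th: "\<theta> > 0" using t s by (simp add: \<theta>_def)
  have "prob {\<omega> \<in> space M. \<theta> * Y \<omega> \<ge> \<theta> * t} \<le> exp (\<theta>\<^sup>2 * s\<^sup>2 / 2) * exp (- (\<theta> * t))"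
    using m by (intro exp_Markov) (auto simp: normal_exp_moment[OF Y s])
  also have "\<dots> = exp (- t\<^sup>2 / (2 * s\<^sup>2))"
    unfolding exp_add[symmetric] using s by (simp add: \<theta>_def power2_eq_square field_simps)
  finally show ?thesis using th by simp
qed simp

lemma normal_tail_abs:
  assumes Y: "distributed M lborel Y (normal_density 0 s)" and s: "s > 0" and t: "t \<ge> 0"
  shows "prob {\<omega> \<in> space M. \<bar>Y \<omega>\<bar> \<ge> t} \<le> 2 * exp (- t\<^sup>2 / (2 * s\<^sup>2))"
proof -
  have m[measurable]: "Y \<in> borel_measurable M" using distributed_measurable[OF Y] by simp
  have Y': "distributed M lborel (\<lambda>\<omega>. - Y \<omega>) (normal_density 0 s)"
    using normal_density_affine[OF Y s, of "-1" 0] by simp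
  have "{\<omega> \<in> space M. \<bar>Y \<omega>\<bar> \<ge> t} = {\<omega> \<in> space M. Y \<omega> \<ge> t} \<union> {\<omega> \<in> space M. - Y \<omega> \<ge> t}"
    by auto
  also have "prob \<dots> \<le> prob {\<omega> \<in> space M. Y \<omega> \<ge> t} + prob {\<omega> \<in> space M. - Y \<omega> \<ge> t}"
    by (rule measure_Un_le) auto
  also have "\<dots> \<le> 2 * exp (- t\<^sup>2 / (2 * s\<^sup>2))"
    using normal_tail[OF Y s t] normal_tail[OF Y' s t] by simp
  finally show ?thesis .
qed

text \<open>The parameter may have either sign, so that one Chernoff bound serves both
  tails.\<close>

lemma chi_square_exp_Markov:
  assumes T: "finite T" and ind: "indep_vars (\<lambda>_. borel) Y T"
    and Y: "\<And>i. i \<in> T \<Longrightarrow> distributed M lborel (Y i) (normal_density 0 s)" and s: "s > 0"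
    and t: "2 * \<theta> * s\<^sup>2 < 1"
  shows "prob {\<omega> \<in> space M. \<theta> * (\<Sum>i\<in>T. (Y i \<omega>)\<^sup>2) \<ge> u} \<le> (1 / sqrt (1 - 2 * \<theta> * s\<^sup>2)) ^ card T * exp (- u)"
proof (rule exp_Markov)
  have m: "Y i \<in> borel_measurable M" if "i \<in> T" for i
    using distributed_measurable[OF Y[OF that]] by simp
  show "(\<lambda>\<omega>. \<theta> * (\<Sum>i\<in>T. (Y i \<omega>)\<^sup>2)) \<in> borel_measurable M" using m by measurable
  have "(\<integral>\<^sup>+\<omega>. ennreal (exp (\<theta> * (\<Sum>i\<in>T. (Y i \<omega>)\<^sup>2))) \<partial>M)
      = (\<integral>\<^sup>+\<omega>. (\<Prod>i\<in>T. ennreal (exp (\<theta> * (Y i \<omega>)\<^sup>2))) \<partial>M)"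
    by (simp add: sum_distrib_left exp_sum[OF T] prod_ennreal)
  also have "\<dots> = (\<Prod>i\<in>T. \<integral>\<^sup>+\<omega>. ennreal (exp (\<theta> * (Y i \<omega>)\<^sup>2)) \<partial>M)"
  proof (rule indep_vars_nn_integral[OF T])
    show "indep_vars (\<lambda>_. borel) (\<lambda>i \<omega>. ennreal (exp (\<theta> * (Y i \<omega>)\<^sup>2))) T"
      by (rule indep_vars_compose2[OF ind, where Y="\<lambda>_ y. ennreal (exp (\<theta> * y\<^sup>2))"]) measurable
  qed auto
  also have "\<dots> = (\<Prod>i\<in>T. ennreal (1 / sqrt (1 - 2 * \<theta> * s\<^sup>2)))"
    by (intro prod.cong refl normal_exp_square_moment[OF Y s t])
  also have "\<dots> = ennreal ((1 / sqrt (1 - 2 * \<theta> * s\<^sup>2)) ^ card T)"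
    using t by (subst prod_ennreal) auto
  finally show "(\<integral>\<^sup>+\<omega>. ennreal (exp (\<theta> * (\<Sum>i\<in>T. (Y i \<omega>)\<^sup>2))) \<partial>M) \<le> ennreal ((1 / sqrt (1 - 2 * \<theta> * s\<^sup>2)) ^ card T)"
    by simp
qed (use t in auto)

text \<open>The reference value is \<open>n * s\<^sup>2\<close> even if there are fewer terms: each
  further factor of the moment bound is at least 1.\<close>

lemma chi_square_upper_tail:
  assumes T: "finite T" "card T \<le> n" and ind: "indep_vars (\<lambda>_. borel) Y T"
    and Y: "\<And>i. i \<in> T \<Longrightarrow> distributed M lborel (Y i) (normal_density 0 s)" and s: "s > 0"
    and e: "0 < e" "e \<le> 1"
  shows "prob {\<omega> \<in> space M. (\<Sum>i\<in>T. (Y i \<omega>)\<^sup>2) \<ge> (1 + e) * (real n * s\<^sup>2)} \<le> exp (- real n * e\<^sup>2 / 16)"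
proof -
  \<comment> \<open>With \<open>- ln (1 - h) \<le> h + 2 * h\<^sup>2\<close>, twice the exponent per
    term is at most \<open>h * (2 * h - e)\<close>, which this \<open>h\<close> makes
    \<open>- e\<^sup>2 / 8\<close>.\<close>
  define h where "h = e / 4"
  define \<theta> where "\<theta> = h / (2 * s\<^sup>2)"
  have h: "0 < h" "h \<le> 1/4" using e by (simp_all add: h_def)
  have th: "2 * \<theta> * s\<^sup>2 = h" "\<theta> > 0" using s h by (simp_all add: \<theta>_def)
  have "{\<omega> \<in> space M. (\<Sum>i\<in>T. (Y i \<omega>)\<^sup>2) \<ge> (1 + e) * (real n * s\<^sup>2)}
      = {\<omega> \<in> space M. \<theta> * (\<Sum>i\<in>T. (Y i \<omega>)\<^sup>2) \<ge> \<theta> * ((1 + e) * (real n * s\<^sup>2))}"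
    using th by simp
  also have "prob \<dots> \<le> (1 / sqrt (1 - 2 * \<theta> * s\<^sup>2)) ^ card T * exp (- (\<theta> * ((1 + e) * (real n * s\<^sup>2))))"
    using th h by (intro chi_square_exp_Markov[OF T(1) ind Y s]) auto
  also have "\<dots> \<le> (1 / sqrt (1 - h)) ^ n * exp (- (\<theta> * ((1 + e) * (real n * s\<^sup>2))))"
    unfolding th using h T by (intro mult_right_mono power_increasing) auto
  also have "(1 / sqrt (1 - h)) = exp (- ln (1 - h) / 2)"
    using h by (simp add: ln_sqrt[symmetric] exp_minus inverse_eq_divide)
  also have "\<theta> * ((1 + e) * (real n * s\<^sup>2)) = real n * (h * (1 + e) / 2)"
    using s by (simp add: \<theta>_def field_simps)
  also have "exp (- ln (1 - h) / 2) ^ n * exp (- (real n * (h * (1 + e) / 2)))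
      = exp (real n * (- (ln (1 - h) + h * (1 + e)) / 2))"
    by (simp add: exp_of_nat_mult[symmetric] exp_add[symmetric] algebra_simps add_divide_distrib diff_divide_distrib)
  also have "\<dots> \<le> exp (- real n * e\<^sup>2 / 16)"
  proof -
    have "- h - 2 * h\<^sup>2 \<le> ln (1 - h)" using ln_one_minus_pos_lower_bound[of h] h by simp
    then have "- (ln (1 - h) + h * (1 + e)) / 2 \<le> - e\<^sup>2 / 16"
      by (simp add: h_def power2_eq_square algebra_simps)
    then have "real n * (- (ln (1 - h) + h * (1 + e)) / 2) \<le> real n * (- e\<^sup>2 / 16)"
      by (rule mult_left_mono) simp
    then show ?thesis by simp
  qed
  finally show ?thesis .
qed

text \<open>One term may be missing, as in a row of \<open>W\<close>, whose diagonal entry is zero.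
  The summand 1 in the exponent pays for it.\<close>

lemma chi_square_lower_tail:
  assumes T: "finite T" "n \<le> card T + 1" and ind: "indep_vars (\<lambda>_. borel) Y T"
    and Y: "\<And>i. i \<in> T \<Longrightarrow> distributed M lborel (Y i) (normal_density 0 s)" and s: "s > 0"
    and e: "0 < e" "e \<le> 1"
  shows "prob {\<omega> \<in> space M. (\<Sum>i\<in>T. (Y i \<omega>)\<^sup>2) \<le> (1 - e) * (real n * s\<^sup>2)} \<le> exp (1 - real n * e\<^sup>2 / 8)"
proof -
  \<comment> \<open>With \<open>ln (1 + h) \<ge> h - h\<^sup>2\<close>, twice the exponent per term
    is at most \<open>h * (h - e)\<close>, which is smallest at this \<open>h\<close>.\<close>
  define h where "h = e / 2"
  define \<theta> where "\<theta> = - h / (2 * s\<^sup>2)"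
  have h: "0 < h" "h \<le> 1/2" using e by (simp_all add: h_def)
  have th: "2 * \<theta> * s\<^sup>2 = - h" "\<theta> < 0" using s h by (simp_all add: \<theta>_def)
  have "{\<omega> \<in> space M. (\<Sum>i\<in>T. (Y i \<omega>)\<^sup>2) \<le> (1 - e) * (real n * s\<^sup>2)}
      = {\<omega> \<in> space M. \<theta> * (\<Sum>i\<in>T. (Y i \<omega>)\<^sup>2) \<ge> \<theta> * ((1 - e) * (real n * s\<^sup>2))}"
    using th by simp
  also have "prob \<dots> \<le> (1 / sqrt (1 - 2 * \<theta> * s\<^sup>2)) ^ card T * exp (- (\<theta> * ((1 - e) * (real n * s\<^sup>2))))"
    using th h by (intro chi_square_exp_Markov[OF T(1) ind Y s]) auto
  also have "\<dots> \<le> (1 / sqrt (1 + h)) ^ (n - 1) * exp (- (\<theta> * ((1 - e) * (real n * s\<^sup>2))))"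
    unfolding th using h T by (intro mult_right_mono power_decreasing) auto
  also have "(1 / sqrt (1 + h)) = exp (- ln (1 + h) / 2)"
    using h by (simp add: ln_sqrt[symmetric] exp_minus inverse_eq_divide)
  also have "\<theta> * ((1 - e) * (real n * s\<^sup>2)) = real n * (- h * (1 - e) / 2)"
    using s by (simp add: \<theta>_def field_simps)
  also have "exp (- ln (1 + h) / 2) ^ (n - 1) * exp (- (real n * (- h * (1 - e) / 2)))
      = exp (real (n - 1) * (- ln (1 + h) / 2) + real n * (h * (1 - e) / 2))"
    by (simp add: exp_of_nat_mult[symmetric] exp_add[symmetric])
  also have "\<dots> \<le> exp (1 - real n * e\<^sup>2 / 8)"
  proof -
    have l: "h - h\<^sup>2 \<le> ln (1 + h)" using ln_one_plus_pos_lower_bound[of h] h by simp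
    have "(real n - 1) * (h - h\<^sup>2) \<le> real (n - 1) * ln (1 + h)"
    proof (cases "n = 0")
      case True
      have "h\<^sup>2 \<le> h" using h by (simp add: power2_eq_square mult_le_cancel_left1)
      then show ?thesis using True by simp
    next
      case False
      then show ?thesis using l by (simp add: of_nat_diff mult_left_mono)
    qed
    then have "real (n - 1) * (- ln (1 + h) / 2) + real n * (h * (1 - e) / 2)
        \<le> (h - h\<^sup>2) / 2 + real n * ((h * (1 - e) - (h - h\<^sup>2)) / 2)"
      by (simp add: algebra_simps add_divide_distrib diff_divide_distrib)
    also have "(h * (1 - e) - (h - h\<^sup>2)) / 2 = - e\<^sup>2 / 8"
      by (simp add: h_def power2_eq_square field_simps)
    also have "(h - h\<^sup>2) / 2 \<le> 1"
    proof -
      have "h - h\<^sup>2 \<le> 2" using order_trans[of "h - h\<^sup>2" h 2] h by simp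
      then show ?thesis by simp
    qed
    finally show ?thesis by simp
  qed
  finally show ?thesis .
qed

end

subsection \<open>Symmetric Gaussian matrices\<close>

definition upper_pairs :: "nat \<Rightarrow> (nat \<times> nat) set" where
  "upper_pairs n = {(i, j). i < j \<and> j < n}"

lemma finite_upper_pairs [simp]: "finite (upper_pairs n)"
  by (rule finite_subset[of _ "{..<n} \<times> {..<n}"]) (auto simp: upper_pairs_def)

text \<open>Writes a bilinear form through the independent entries of \<open>W\<close>, each of
  which collects two terms; its variance can then be computed.\<close>

lemma sum_upper_pairs:
  fixes f :: "nat \<Rightarrow> nat \<Rightarrow> real"
  assumes "\<And>i. i < n \<Longrightarrow> f i i = 0"
  shows "(\<Sum>i<n. \<Sum>j<n. f i j) = (\<Sum>(i,j)\<in>upper_pairs n. f i j + f j i)"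
proof -
  let ?E = "upper_pairs n" and ?E' = "(\<lambda>(i,j). (j,i)) ` upper_pairs n"
  have "(\<Sum>i<n. \<Sum>j<n. f i j) = (\<Sum>(i,j)\<in>{..<n} \<times> {..<n}. f i j)"
    by (rule sum.cartesian_product)
  also have "\<dots> = (\<Sum>(i,j)\<in>?E \<union> ?E'. f i j)"
  proof (rule sum.mono_neutral_right)
    have "(i, j) \<in> ?E \<union> ?E' \<or> i = j" if "i < n" "j < n" for i j
      using that by (cases i j rule: linorder_cases) (auto simp: upper_pairs_def image_iff)
    then show "\<forall>p\<in>{..<n} \<times> {..<n} - (?E \<union> ?E'). (case p of (i, j) \<Rightarrow> f i j) = 0"
      using assms by fastforce
  qed (auto simp: upper_pairs_def)
  also have "\<dots> = (\<Sum>(i,j)\<in>?E. f i j) + (\<Sum>(i,j)\<in>?E'. f i j)"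
    by (rule sum.union_disjoint, simp, simp) (auto simp: upper_pairs_def)
  also have "(\<Sum>(i,j)\<in>?E'. f i j) = (\<Sum>(i,j)\<in>?E. f j i)"
    by (subst sum.reindex) (auto simp: inj_on_def case_prod_unfold)
  finally show ?thesis by (simp add: sum.distrib case_prod_unfold)
qed

text \<open>The off-diagonal part of a GOE matrix. Symmetry and the zero diagonal are demanded for
  all indices and all outcomes, which spares side conditions; \<open>n \<ge> 2\<close> makes the row
  sums nondegenerate.\<close>

locale gauss_mat = prob_space M for M :: "'w measure" +
  fixes n :: nat and W :: "nat \<Rightarrow> nat \<Rightarrow> 'w \<Rightarrow> real"
  assumes n: "n \<ge> 2"
    and sym: "W i j = W j i" and diag: "W i i \<omega> = 0"
    and indep: "indep_vars (\<lambda>_. borel) (\<lambda>(i,j). W i j) (upper_pairs n)"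
    and normal: "i < j \<Longrightarrow> j < n \<Longrightarrow> distributed M lborel (W i j) (normal_density 0 (1 / sqrt n))"
begin

lemma sd_pos: "1 / sqrt (real n) > 0" using n by simp

lemma sd_sq: "(1 / sqrt (real n))\<^sup>2 = 1 / real n" by (simp add: power_divide)

lemma normal': "i < n \<Longrightarrow> j < n \<Longrightarrow> i \<noteq> j \<Longrightarrow> distributed M lborel (W i j) (normal_density 0 (1 / sqrt n))"
  using normal[of i j] normal[of j i] sym[of i j] by (cases "i < j") auto

lemma W_measurable: "i < n \<Longrightarrow> j < n \<Longrightarrow> W i j \<in> borel_measurable M"
proof (cases "i = j")
  case True
  then have "W i j = (\<lambda>_. 0)" using diag by auto
  then show ?thesis by simp
next
  case False
  assume "i < n" "j < n"
  then show ?thesis using distributed_measurable[OF normal'] False by auto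
qed

lemma bilin_measurable: "(\<lambda>\<omega>. bilin n (\<lambda>i j. W i j \<omega>) x y) \<in> borel_measurable M"
  unfolding bilin_def by (intro borel_measurable_sum borel_measurable_times borel_measurable_const W_measurable) auto

lemma off_sqn_measurable: "(\<lambda>\<omega>. off_sqn n (\<lambda>i j. W i j \<omega>) S x) \<in> borel_measurable M"
  unfolding off_sqn_def
  by (intro borel_measurable_sum borel_measurable_power borel_measurable_times borel_measurable_const W_measurable) auto

text \<open>Each sum depends on the unordered pairs joining its row to \<open>S\<close>. Since
  \<open>S\<close> and \<open>T\<close> are disjoint, different rows in \<open>T\<close> use
  disjoint sets of pairs; \<open>edge\<close> sorts a pair into the upper triangle, where
  independence is assumed.\<close>

lemma indep_rows:
  assumes S: "S \<subseteq> {..<n}" and T: "T \<subseteq> {..<n}" and ST: "S \<inter> T = {}"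
  shows "indep_vars (\<lambda>_. borel) (\<lambda>i \<omega>. \<Sum>j\<in>S. x j * W i j \<omega>) T"
proof -
  define edge where "edge i j = (min i j, max i j)" for i j :: nat
  define X where "X = (\<lambda>(i,j). W i j)"
  have X: "X (edge i j) = W i j" for i j
    using sym[of i j] by (auto simp: X_def edge_def min_def max_def)
  have K: "edge i ` S \<subseteq> upper_pairs n" if "i \<in> T" for i
  proof (rule image_subsetI)
    fix j assume "j \<in> S"
    then have "i \<noteq> j" "i < n" "j < n" using S T ST that by auto
    then show "edge i j \<in> upper_pairs n" by (auto simp: edge_def upper_pairs_def min_def max_def)
  qed
  have "disjoint_family_on (\<lambda>i. edge i ` S) T"
    using ST by (auto simp: disjoint_family_on_def edge_def min_def max_def split: if_splits)
  from indep_vars_restrict[OF indep[folded X_def], of T "\<lambda>i. edge i ` S", OF K this]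
  have "indep_vars (\<lambda>i. PiM (edge i ` S) (\<lambda>_. borel)) (\<lambda>i \<omega>. restrict (\<lambda>e. X e \<omega>) (edge i ` S)) T"
    by simp
  then have "indep_vars (\<lambda>_. borel) (\<lambda>i \<omega>. \<Sum>j\<in>S. x j * (restrict (\<lambda>e. X e \<omega>) (edge i ` S)) (edge i j)) T"
    by (rule indep_vars_compose2[where Y="\<lambda>i f. \<Sum>j\<in>S. x j * f (edge i j)"])
       (intro borel_measurable_sum borel_measurable_times borel_measurable_const measurable_component_singleton, auto)
  moreover have "(\<lambda>i \<omega>. \<Sum>j\<in>S. x j * (restrict (\<lambda>e. X e \<omega>) (edge i ` S)) (edge i j)) = (\<lambda>i \<omega>. \<Sum>j\<in>S. x j * W i j \<omega>)"
    by (intro ext sum.cong refl) (simp add: X)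
  ultimately show ?thesis by simp
qed

text \<open>A single column, read as a row by symmetry.\<close>

lemma indep_row:
  assumes "i < n" "S \<subseteq> {..<n}" "i \<notin> S"
  shows "indep_vars (\<lambda>_. borel) (W i) S"
proof -
  have "(\<lambda>j. W j i) = W i" by (rule ext) (rule sym)
  then show ?thesis using indep_rows[of "{i}" S "\<lambda>_. 1"] assms by simp
qed

lemma row_normal:
  assumes i: "i < n" "i \<notin> S" and S: "S \<subseteq> {..<n}" and V: "(\<Sum>j\<in>S. (x j)\<^sup>2) > 0"
  shows "distributed M lborel (\<lambda>\<omega>. \<Sum>j\<in>S. x j * W i j \<omega>) (normal_density 0 (1 / sqrt n * sqrt (\<Sum>j\<in>S. (x j)\<^sup>2)))"
  using i S V finite_subset[OF S] sd_pos by (intro gauss_lin indep_row normal') auto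

text \<open>The form is a centred Gaussian of variance \<open>V / n\<close>. An entry above the
  diagonal carries the coefficient \<open>w i * z j + w j * z i\<close>, so \<open>V\<close> is at
  most twice the product of the squared norms. If \<open>V = 0\<close> the form vanishes identically
  and has no density.\<close>

lemma bilin_tail:
  assumes w: "sqn n w \<le> m" and z: "sqn n z \<le> m" and t: "t > 0" and m: "m > 0"
  shows "prob {\<omega> \<in> space M. t < bilin n (\<lambda>i j. W i j \<omega>) w z} \<le> exp (- t\<^sup>2 * real n / (4 * m\<^sup>2))"
proof -
  define c where "c = (\<lambda>(i,j). w i * z j + w j * z i)"
  define V where "V = (\<Sum>e\<in>upper_pairs n. (c e)\<^sup>2)"
  have b: "bilin n (\<lambda>i j. W i j \<omega>) w z = (\<Sum>e\<in>upper_pairs n. c e * (case e of (i,j) \<Rightarrow> W i j) \<omega>)" for \<omega>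
    unfolding bilin_def using sym
    by (subst sum_upper_pairs) (auto simp: diag c_def case_prod_unfold algebra_simps intro!: sum.cong)
  have V0: "V \<ge> 0" by (simp add: V_def sum_nonneg)
  have "V \<le> (\<Sum>(i,j)\<in>upper_pairs n. 2 * ((w i)\<^sup>2 * (z j)\<^sup>2) + 2 * ((w j)\<^sup>2 * (z i)\<^sup>2))"
    unfolding V_def c_def
  proof (rule sum_mono)
    fix e :: "nat \<times> nat"
    have "(w i * z j + w j * z i)\<^sup>2 \<le> 2 * ((w i)\<^sup>2 * (z j)\<^sup>2) + 2 * ((w j)\<^sup>2 * (z i)\<^sup>2)" for i j
      using sum_squares_bound[of "w i * z j" "w j * z i"] by (simp add: power2_sum power_mult_distrib)
    then show "(case e of (i, j) \<Rightarrow> w i * z j + w j * z i)\<^sup>2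
        \<le> (case e of (i, j) \<Rightarrow> 2 * ((w i)\<^sup>2 * (z j)\<^sup>2) + 2 * ((w j)\<^sup>2 * (z i)\<^sup>2))"
      by (cases e) simp
  qed
  also have "\<dots> = (\<Sum>(i,j)\<in>upper_pairs n. (if i = j then 0 else 2 * ((w i)\<^sup>2 * (z j)\<^sup>2)) + (if j = i then 0 else 2 * ((w j)\<^sup>2 * (z i)\<^sup>2)))"
    by (intro sum.cong refl) (auto simp: upper_pairs_def)
  also have "\<dots> = (\<Sum>i<n. \<Sum>j<n. if i = j then 0 else 2 * ((w i)\<^sup>2 * (z j)\<^sup>2))"
    by (subst sum_upper_pairs) auto
  also have "\<dots> \<le> (\<Sum>i<n. \<Sum>j<n. 2 * ((w i)\<^sup>2 * (z j)\<^sup>2))"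
    by (intro sum_mono) auto
  also have "\<dots> = 2 * sqn n w * sqn n z"
    by (simp add: sqn_def sum_product sum_distrib_left mult_ac)
  also have "\<dots> \<le> 2 * m * m" using w z m by (intro mult_mono) auto
  finally have V: "V \<le> 2 * m\<^sup>2" by (simp add: power2_eq_square)
  show ?thesis
  proof (cases "V = 0")
    case True
    then have "c e = 0" if "e \<in> upper_pairs n" for e
      using that by (simp add: V_def sum_nonneg_eq_0_iff)
    then have "bilin n (\<lambda>i j. W i j \<omega>) w z = 0" for \<omega> by (simp add: b)
    then show ?thesis using t by simp
  next
    case False
    then have Vp: "V > 0" using V0 by simp
    let ?Y = "\<lambda>\<omega>. bilin n (\<lambda>i j. W i j \<omega>) w z" and ?s = "1 / sqrt n * sqrt V"
    have Y: "distributed M lborel ?Y (normal_density 0 ?s)"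
      unfolding b V_def
    proof (intro gauss_lin indep finite_upper_pairs)
      show "distributed M lborel (case e of (i, j) \<Rightarrow> W i j) (normal_density 0 (1 / sqrt n))"
        if "e \<in> upper_pairs n" for e
        using that normal by (auto simp: upper_pairs_def)
    qed (use Vp sd_pos in \<open>auto simp: V_def\<close>)
    have "prob {\<omega> \<in> space M. t < ?Y \<omega>} \<le> prob {\<omega> \<in> space M. ?Y \<omega> \<ge> t}"
      using bilin_measurable[of w z] by (intro finite_measure_mono) auto
    also have "\<dots> \<le> exp (- t\<^sup>2 / (2 * ?s\<^sup>2))"
      using t Vp n by (intro normal_tail Y) auto
    also have "?s\<^sup>2 = V / real n" using Vp by (simp add: power_mult_distrib power_divide)
    also have "- t\<^sup>2 / (2 * (V / real n)) = - (t\<^sup>2 * real n / (2 * V))" by simp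
    also have "t\<^sup>2 * real n / (2 * V) \<ge> t\<^sup>2 * real n / (4 * m\<^sup>2)"
    proof (rule divide_left_mono)
      show "0 < 4 * m\<^sup>2 * (2 * V)" using m Vp by simp
    qed (use V in auto)
    then have "exp (- (t\<^sup>2 * real n / (2 * V))) \<le> exp (- (t\<^sup>2 * real n / (4 * m\<^sup>2)))" by simp
    finally show ?thesis by simp
  qed
qed

text \<open>A union bound over pairs of lattice points. Level \<open>k * s\<close> and squared
  radius \<open>4 * s\<close> scale alike, so \<open>s\<close> cancels from the exponent and
  survives only in the number of points.\<close>

lemma prob_bilin_int_ball:
  assumes s: "s > 0" and k: "k > 0"
  shows "prob {\<omega> \<in> space M. \<exists>w\<in>int_ball n (4 * real s). \<exists>z\<in>int_ball n (4 * real s).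
      k * real s < bilin n (\<lambda>i j. W i j \<omega>) (rv w) (rv z)}
    \<le> (real (card (int_ball n (4 * real s))))\<^sup>2 * exp (- k\<^sup>2 * real n / 64)"
proof -
  let ?B = "int_ball n (4 * real s)"
  let ?A = "\<lambda>p. {\<omega> \<in> space M. k * real s < bilin n (\<lambda>i j. W i j \<omega>) (rv (fst p)) (rv (snd p))}"
  have "{\<omega> \<in> space M. \<exists>w\<in>?B. \<exists>z\<in>?B. k * real s < bilin n (\<lambda>i j. W i j \<omega>) (rv w) (rv z)}
      = (\<Union>p\<in>?B \<times> ?B. ?A p)"
    unfolding set_eq_iff UN_iff mem_Collect_eq Bex_def mem_Times_iff split_paired_Ex fst_conv snd_conv by metis
  also have "prob \<dots> \<le> (\<Sum>p\<in>?B \<times> ?B. prob (?A p))"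
    using bilin_measurable
    by (intro finite_measure_subadditive_finite finite_cartesian_product finite_int_ball) auto
  also have "\<dots> \<le> (\<Sum>p\<in>?B \<times> ?B. exp (- (k * real s)\<^sup>2 * real n / (4 * (4 * real s)\<^sup>2)))"
  proof (rule sum_mono)
    fix p assume "p \<in> ?B \<times> ?B"
    then have "sqn n (rv (fst p)) \<le> 4 * real s" "sqn n (rv (snd p)) \<le> 4 * real s"
      by (simp_all add: int_ball_def mem_Times_iff)
    then show "prob (?A p) \<le> exp (- (k * real s)\<^sup>2 * real n / (4 * (4 * real s)\<^sup>2))"
      by (rule bilin_tail) (use s k in simp_all)
  qed
  also have "- (k * real s)\<^sup>2 * real n / (4 * (4 * real s)\<^sup>2) = - k\<^sup>2 * real n / 64"
    using s by (simp add: power_mult_distrib)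
  finally show ?thesis by (simp add: card_cartesian_product power2_eq_square)
qed

text \<open>For a fixed \<open>z\<close> the coordinates of \<open>W z\<close> outside its support
  are independent centred Gaussians of variance \<open>sqn n (rv z) / n\<close>. Their sum of
  squares is a scaled chi-square variable with at most \<open>n\<close> degrees of freedom.\<close>

lemma prob_off_sqn_int_ball:
  assumes e: "0 < e" "e \<le> 1"
  shows "prob {\<omega> \<in> space M. \<exists>z\<in>int_ball n m.
      (1 + e) * sqn n (rv z) < off_sqn n (\<lambda>i j. W i j \<omega>) (supp n (rv z)) (rv z)}
    \<le> real (card (int_ball n m)) * exp (- real n * e\<^sup>2 / 16)"
proof -
  let ?A = "\<lambda>z. {\<omega> \<in> space M. (1 + e) * sqn n (rv z) < off_sqn n (\<lambda>i j. W i j \<omega>) (supp n (rv z)) (rv z)}"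
  have *: "prob (?A z) \<le> exp (- real n * e\<^sup>2 / 16)" for z
  proof (cases "sqn n (rv z) = 0")
    case True
    then have "off_sqn n (\<lambda>i j. W i j \<omega>) (supp n (rv z)) (rv z) = 0" for \<omega>
      by (simp add: off_sqn_def sqn_eq_0)
    then show ?thesis by (simp add: True)
  next
    case False
    then have p: "sqn n (rv z) > 0" using sqn_nonneg[of n "rv z"] by linarith
    let ?S = "supp n (rv z)"
    let ?T = "{..<n} - ?S"
    let ?Y = "\<lambda>i \<omega>. \<Sum>j\<in>?S. rv z j * W i j \<omega>" and ?s = "1 / sqrt n * sqrt (sqn n (rv z))"
    have sS: "(\<Sum>j\<in>?S. (rv z j)\<^sup>2) = sqn n (rv z)"
      unfolding sqn_def by (rule sum.mono_neutral_left) (auto simp: supp_def)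
    have rs: "(\<Sum>j<n. W i j \<omega> * rv z j) = ?Y i \<omega>" for i \<omega>
      by (rule sum.mono_neutral_cong_right) (auto simp: supp_def)
    have "?A z \<subseteq> {\<omega> \<in> space M. (\<Sum>i\<in>?T. (?Y i \<omega>)\<^sup>2) \<ge> (1 + e) * (real n * ?s\<^sup>2)}"
      using p n by (auto simp: off_sqn_def rs power_mult_distrib power_divide)
    moreover have ind: "indep_vars (\<lambda>_. borel) ?Y ?T"
      by (rule indep_rows) (auto simp: supp_def)
    ultimately have "prob (?A z) \<le> prob {\<omega> \<in> space M. (\<Sum>i\<in>?T. (?Y i \<omega>)\<^sup>2) \<ge> (1 + e) * (real n * ?s\<^sup>2)}"
    proof (intro finite_measure_mono)
      have "?Y i \<in> borel_measurable M" if "i \<in> ?T" for i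
        using ind that by (simp add: indep_vars_def2)
      then show "{\<omega> \<in> space M. (\<Sum>i\<in>?T. (?Y i \<omega>)\<^sup>2) \<ge> (1 + e) * (real n * ?s\<^sup>2)} \<in> events"
        by measurable
    qed
    also have "\<dots> \<le> exp (- real n * e\<^sup>2 / 16)"
    proof (rule chi_square_upper_tail)
      show "card ?T \<le> n" using card_mono[of "{..<n}" ?T] by simp
      show "distributed M lborel (?Y i) (normal_density 0 ?s)" if "i \<in> ?T" for i
        using row_normal[of i ?S "rv z", unfolded sS] that p by (auto simp: supp_def)
    qed (use ind e p n in auto)
    finally show ?thesis .
  qed
  have "{\<omega> \<in> space M. \<exists>z\<in>int_ball n m. (1 + e) * sqn n (rv z) < off_sqn n (\<lambda>i j. W i j \<omega>) (supp n (rv z)) (rv z)}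
      = (\<Union>z\<in>int_ball n m. ?A z)" by auto
  also have "prob \<dots> \<le> (\<Sum>z\<in>int_ball n m. prob (?A z))"
    using off_sqn_measurable by (intro finite_measure_subadditive_finite finite_int_ball) auto
  also have "\<dots> \<le> (\<Sum>z\<in>int_ball n m. exp (- real n * e\<^sup>2 / 16))" by (intro sum_mono *)
  finally show ?thesis by simp
qed

lemma prob_row_norm_small:
  assumes e: "0 < e" "e \<le> 1"
  shows "prob {\<omega> \<in> space M. \<exists>i<n. (\<Sum>j<n. (W i j \<omega>)\<^sup>2) < 1 - e} \<le> real n * exp (1 - real n * e\<^sup>2 / 8)"
proof -
  let ?A = "\<lambda>i. {\<omega> \<in> space M. (\<Sum>j<n. (W i j \<omega>)\<^sup>2) < 1 - e}"
  have m: "(\<lambda>\<omega>. \<Sum>j\<in>T. (W i j \<omega>)\<^sup>2) \<in> borel_measurable M" if "i < n" "T \<subseteq> {..<n}" for i T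
    using that by (intro borel_measurable_sum borel_measurable_power W_measurable) auto
  have *: "prob (?A i) \<le> exp (1 - real n * e\<^sup>2 / 8)" if i: "i < n" for i
  proof -
    let ?T = "{..<n} - {i}"
    have "(\<Sum>j<n. (W i j \<omega>)\<^sup>2) = (\<Sum>j\<in>?T. (W i j \<omega>)\<^sup>2)" for \<omega>
      by (rule sum.mono_neutral_right) (auto simp: diag)
    then have "prob (?A i) \<le> prob {\<omega> \<in> space M. (\<Sum>j\<in>?T. (W i j \<omega>)\<^sup>2) \<le> (1 - e) * (real n * (1 / sqrt n)\<^sup>2)}"
      using m[of i ?T] i n by (intro finite_measure_mono) (auto simp: sd_sq)
    also have "\<dots> \<le> exp (1 - real n * e\<^sup>2 / 8)"
      using i e n by (intro chi_square_lower_tail indep_row normal') auto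
    finally show ?thesis .
  qed
  have "{\<omega> \<in> space M. \<exists>i<n. (\<Sum>j<n. (W i j \<omega>)\<^sup>2) < 1 - e} = (\<Union>i<n. ?A i)" by auto
  also have "prob \<dots> \<le> (\<Sum>i<n. prob (?A i))"
    using m by (intro finite_measure_subadditive_finite) auto
  also have "\<dots> \<le> (\<Sum>i<n. exp (1 - real n * e\<^sup>2 / 8))" by (intro sum_mono *) auto
  finally show ?thesis by simp
qed

definition rowsum :: "nat \<Rightarrow> 'w \<Rightarrow> real" where
  "rowsum i \<omega> = (\<Sum>j<n. W i j \<omega>)"

lemma rowsum_measurable: "i < n \<Longrightarrow> rowsum i \<in> borel_measurable M"
  unfolding rowsum_def by (intro borel_measurable_sum W_measurable) auto

lemma rowsum_tail:
  assumes i: "i < n" and t: "t \<ge> 0"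
  shows "prob {\<omega> \<in> space M. \<bar>rowsum i \<omega>\<bar> > t} \<le> 2 * exp (- t\<^sup>2 / 2)"
proof -
  let ?T = "{..<n} - {i}" and ?s = "1 / sqrt n * sqrt (real n - 1)"
  have "rowsum i = (\<lambda>\<omega>. \<Sum>j\<in>?T. 1 * W i j \<omega>)"
    unfolding rowsum_def by (intro ext sum.mono_neutral_cong_right) (auto simp: diag)
  moreover have "(\<Sum>j\<in>?T. 1\<^sup>2) = real n - 1" using i by (simp add: of_nat_diff)
  ultimately have Y: "distributed M lborel (rowsum i) (normal_density 0 ?s)"
    using row_normal[of i ?T "\<lambda>_. 1"] i n by simp
  have "prob {\<omega> \<in> space M. \<bar>rowsum i \<omega>\<bar> > t} \<le> prob {\<omega> \<in> space M. \<bar>rowsum i \<omega>\<bar> \<ge> t}"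
    using rowsum_measurable[OF i] by (intro finite_measure_mono) auto
  also have "\<dots> \<le> 2 * exp (- t\<^sup>2 / (2 * ?s\<^sup>2))"
    using n t by (intro normal_tail_abs Y) auto
  also have "?s\<^sup>2 = (real n - 1) / real n" using n by (simp add: power_mult_distrib power_divide)
  also have "exp (- t\<^sup>2 / (2 * ((real n - 1) / real n))) \<le> exp (- t\<^sup>2 / 2)"
  proof -
    have "t\<^sup>2 / 2 \<le> t\<^sup>2 / (2 * ((real n - 1) / real n))"
    proof (rule divide_left_mono)
      show "2 * ((real n - 1) / real n) \<le> 2" using n by (simp add: field_simps)
    qed (use n in auto)
    then show ?thesis by simp
  qed
  finally show ?thesis by simp
qed

lemma card_large_rowsums:
  assumes "\<omega> \<in> space M"
  shows "real (card {i. i < n \<and> \<bar>rowsum i \<omega>\<bar> > t})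
    = (\<Sum>i<n. indicator {\<omega> \<in> space M. \<bar>rowsum i \<omega>\<bar> > t} \<omega>)"
proof -
  have "(\<Sum>i<n. indicator {\<omega> \<in> space M. \<bar>rowsum i \<omega>\<bar> > t} \<omega>)
      = (\<Sum>i<n. if \<bar>rowsum i \<omega>\<bar> > t then 1 else 0 :: real)"
    using assms by (intro sum.cong) (auto simp: indicator_def)
  also have "\<dots> = real (card ({..<n} \<inter> {i. \<bar>rowsum i \<omega>\<bar> > t}))"
    by (subst sum.If_cases) auto
  also have "{..<n} \<inter> {i. \<bar>rowsum i \<omega>\<bar> > t} = {i. i < n \<and> \<bar>rowsum i \<omega>\<bar> > t}" by auto
  finally show ?thesis by simp
qed

text \<open>Markov's inequality for the expected count, to which the dependence between row sums
  does not matter.\<close>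

lemma prob_many_large_rowsums:
  assumes t: "t \<ge> 0" and s: "s > 0"
  shows "prob {\<omega> \<in> space M. s \<le> card {i. i < n \<and> \<bar>rowsum i \<omega>\<bar> > t}} \<le> 2 * real n * exp (- t\<^sup>2 / 2) / real s"
proof -
  let ?A = "\<lambda>i. {\<omega> \<in> space M. \<bar>rowsum i \<omega>\<bar> > t}"
  let ?N = "\<lambda>\<omega>. card {i. i < n \<and> \<bar>rowsum i \<omega>\<bar> > t}"
  have A: "?A i \<in> events" if "i < n" for i using rowsum_measurable[OF that] by measurable
  have N: "real (?N \<omega>) = (\<Sum>i<n. indicator (?A i) \<omega>)" if "\<omega> \<in> space M" for \<omega>
    by (rule card_large_rowsums[OF that])
  have int: "integrable M (\<lambda>\<omega>. \<Sum>i<n. indicator (?A i) \<omega> :: real)"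
    using A by (intro Bochner_Integration.integrable_sum) (auto simp: emeasure_eq_measure)
  have "{\<omega> \<in> space M. s \<le> ?N \<omega>} = {\<omega> \<in> space M. (\<Sum>i<n. indicator (?A i) \<omega>) \<ge> real s}"
    using N by (metis (mono_tags, lifting) of_nat_le_iff)
  also have "prob \<dots> \<le> (\<integral>\<omega>. (\<Sum>i<n. indicator (?A i) \<omega>) \<partial>M) / real s"
    using s by (intro integral_Markov_inequality_measure[OF int, where A="space M"]) (auto intro!: AE_I2 sum_nonneg)
  also have "(\<integral>\<omega>. (\<Sum>i<n. indicator (?A i) \<omega>) \<partial>M) = (\<Sum>i<n. prob (?A i))"
    using A by (subst Bochner_Integration.integral_sum) (auto simp: emeasure_eq_measure)
  also have "\<dots> \<le> (\<Sum>i<n. 2 * exp (- t\<^sup>2 / 2))" using t by (intro sum_mono rowsum_tail) auto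
  finally show ?thesis using s by (simp add: divide_right_mono mult_ac)
qed

end

section \<open>The good event and its failure probability\<close>

text \<open>The terms bound, in this order, the failure of: norm at most 30; norm at most
  \<open>k\<close> on \<open>s\<close>-sparse vectors; near isometry of sparse columns into the
  complement; squared row norms at least \<open>1 - e\<close>; fewer than \<open>s\<close> row sums
  beyond \<open>t\<close>.\<close>

definition bad_bound :: "nat \<Rightarrow> nat \<Rightarrow> real \<Rightarrow> real \<Rightarrow> real \<Rightarrow> real" where
  "bad_bound n s k e t =
     (real (card (int_ball n (4 * real n))))\<^sup>2 * exp (- 30\<^sup>2 * real n / 64)
   + (real (card (int_ball n (4 * real s))))\<^sup>2 * exp (- k\<^sup>2 * real n / 64)
   + real (card (int_ball n (real s * (1 + 1 / e)\<^sup>2))) * exp (- real n * e\<^sup>2 / 16)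
   + real n * exp (1 - real n * e\<^sup>2 / 8)
   + 2 * real n * exp (- t\<^sup>2 / 2) / real s"

context gauss_mat
begin

text \<open>The conclusion of \<open>rayleigh_upper\<close> with \<open>C = 30\<close> and
  \<open>Q = (1 + e) ^ 3\<close>. The random set \<open>S\<close> no longer occurs, so the later
  probability estimates need not refer to it.\<close>

definition rayleigh_upper_ok :: "real \<Rightarrow> real \<Rightarrow> real \<Rightarrow> 'w \<Rightarrow> bool" where
  "rayleigh_upper_ok k e t \<omega> \<longleftrightarrow> (\<forall>d v. (\<forall>i<n. rowsum i \<omega> \<le> d) \<longrightarrow> d + k - t - 30 > 0 \<longrightarrow>
      (\<Sum>i<n. rowsum i \<omega> * (v i)\<^sup>2) - bilin n (\<lambda>i j. W i j \<omega>) v v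
        \<le> (d + k + (1 + e) ^ 3 / (d + k - t - 30)) * sqn n v)"

definition rayleigh_lower_ok :: "real \<Rightarrow> real \<Rightarrow> real \<Rightarrow> 'w \<Rightarrow> bool" where
  "rayleigh_lower_ok k e t \<omega> \<longleftrightarrow> (\<forall>d i \<mu>. i < n \<longrightarrow> d \<le> rowsum i \<omega> \<longrightarrow> d > 0 \<longrightarrow> \<mu> \<ge> 0 \<longrightarrow>
      \<mu> * (1 + (30 / d)\<^sup>2) \<le> (1 - e - k\<^sup>2) * (1 / d - (t + 30) / d\<^sup>2) \<longrightarrow> 0 \<le> 1 / d - (t + 30) / d\<^sup>2 \<longrightarrow>
      (\<exists>v. sqn n v > 0 \<and> (d + \<mu>) * sqn n v
        \<le> (\<Sum>i<n. rowsum i \<omega> * (v i)\<^sup>2) - bilin n (\<lambda>i j. W i j \<omega>) v v))"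

text \<open>Off \<open>B\<close> the sparse estimates hold for every small index set, hence also for
  the random set of large row sums, although it depends on the same entries.\<close>

lemma good_event:
  assumes s: "s > 0" and k: "k > 0" and e: "0 < e" "e \<le> 1" and t: "t \<ge> 0"
  obtains B where "B \<in> events" "prob B \<le> bad_bound n s k e t"
    "\<And>\<omega>. \<omega> \<in> space M - B \<Longrightarrow> rayleigh_upper_ok k e t \<omega>"
    "\<And>\<omega>. \<omega> \<in> space M - B \<Longrightarrow> rayleigh_lower_ok k e t \<omega>"
proof -
  let ?W = "\<lambda>\<omega> i j. W i j \<omega>"
  define B1 where "B1 = {\<omega> \<in> space M. \<exists>w\<in>int_ball n (4 * real n). \<exists>z\<in>int_ball n (4 * real n).
      30 * real n < bilin n (?W \<omega>) (rv w) (rv z)}"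
  define B2 where "B2 = {\<omega> \<in> space M. \<exists>w\<in>int_ball n (4 * real s). \<exists>z\<in>int_ball n (4 * real s).
      k * real s < bilin n (?W \<omega>) (rv w) (rv z)}"
  define B3 where "B3 = {\<omega> \<in> space M. \<exists>z\<in>int_ball n (real s * (1 + 1 / e)\<^sup>2).
      (1 + e) * sqn n (rv z) < off_sqn n (?W \<omega>) (supp n (rv z)) (rv z)}"
  define B4 where "B4 = {\<omega> \<in> space M. \<exists>i<n. (\<Sum>j<n. (W i j \<omega>)\<^sup>2) < 1 - e}"
  define B5 where "B5 = {\<omega> \<in> space M. s \<le> card {i. i < n \<and> \<bar>rowsum i \<omega>\<bar> > t}}"
  note B_defs = B1_def B2_def B3_def B4_def B5_def
  have [measurable]: "(\<lambda>\<omega>. bilin n (?W \<omega>) x y) \<in> borel_measurable M" for x y by (rule bilin_measurable)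
  have [measurable]: "(\<lambda>\<omega>. off_sqn n (?W \<omega>) S x) \<in> borel_measurable M" for S x by (rule off_sqn_measurable)
  have rm: "(\<lambda>\<omega>. \<Sum>j<n. (W i j \<omega>)\<^sup>2) \<in> borel_measurable M" if "i < n" for i
    using that by (intro borel_measurable_sum borel_measurable_power W_measurable) auto
  have B12: "B1 \<in> events" "B2 \<in> events"
    unfolding B1_def B2_def by (intro sets.sets_Collect_finite_Ex finite_int_ball; measurable)+
  have B3: "B3 \<in> events"
    unfolding B3_def by (intro sets.sets_Collect_finite_Ex finite_int_ball) measurable
  have "B4 = (\<Union>i<n. {\<omega> \<in> space M. (\<Sum>j<n. (W i j \<omega>)\<^sup>2) < 1 - e})" by (auto simp: B4_def)
  also have "\<dots> \<in> events" using rm by (intro sets.finite_UN) auto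
  finally have B4: "B4 \<in> events" .
  have A: "{\<omega> \<in> space M. \<bar>rowsum i \<omega>\<bar> > t} \<in> events" if "i < n" for i
    using rowsum_measurable[OF that] by measurable
  have "B5 = {\<omega> \<in> space M. real s \<le> (\<Sum>i<n. indicator {\<omega> \<in> space M. \<bar>rowsum i \<omega>\<bar> > t} \<omega>)}"
    unfolding B5_def by (metis (mono_tags, lifting) of_nat_le_iff card_large_rowsums)
  also have "\<dots> \<in> events" using A by measurable
  finally have B5: "B5 \<in> events" .
  let ?B = "B1 \<union> B2 \<union> B3 \<union> B4 \<union> B5"
  have "prob ?B \<le> prob B1 + prob B2 + prob B3 + prob B4 + prob B5"
    using B12 B3 B4 B5 by (intro order_trans[OF measure_Un_le] add_mono order_refl) auto
  also have "\<dots> \<le> bad_bound n s k e t"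
    unfolding bad_bound_def B_defs using n
    by (intro add_mono prob_bilin_int_ball prob_off_sqn_int_ball prob_row_norm_small prob_many_large_rowsums s k e t) auto
  finally have prob: "prob ?B \<le> bad_bound n s k e t" .
  define S where "S \<omega> = {i. i < n \<and> \<bar>rowsum i \<omega>\<bar> > t}" for \<omega>
  have S: "S \<omega> \<subseteq> {..<n}" "finite (S \<omega>)" for \<omega> by (auto simp: S_def)
  \<comment> \<open>Strict, so that the index of the trial vector can be adjoined and the set still
    has at most \<open>s\<close> elements.\<close>
  have cS: "card (S \<omega>) < s" if "\<omega> \<in> space M - ?B" for \<omega>
    using that by (auto simp: B5_def S_def not_le)
  have RS: "\<bar>rowsum i \<omega>\<bar> \<le> t" if "i < n" "i \<notin> S \<omega>" for i \<omega>
    using that by (auto simp: S_def)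
  have nrm: "bilin n (?W \<omega>) x y \<le> 30 * sqrt (sqn n x) * sqrt (sqn n y)" if "\<omega> \<in> space M - ?B" for \<omega> x y
  proof (rule bilin_sparse_bound[where s=n])
    have "card (supp n x) \<le> card {..<n}" for x by (intro card_mono) (auto simp: supp_def)
    then show "card (supp n x) \<le> n" "card (supp n y) \<le> n" by simp_all
  qed (use that n in \<open>auto simp: B1_def not_less\<close>)
  have blk: "bilin n (?W \<omega>) x y \<le> k * sqrt (sqn n x) * sqrt (sqn n y)"
    if w: "\<omega> \<in> space M - ?B" and T: "finite T" "card T \<le> s" and x: "supp n x \<subseteq> T" "supp n y \<subseteq> T" for \<omega> x y T
  proof (rule bilin_sparse_bound[OF _ s])
    show "card (supp n x) \<le> s" "card (supp n y) \<le> s"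
      using card_mono[OF T(1) x(1)] card_mono[OF T(1) x(2)] T(2) by simp_all
  qed (use w in \<open>auto simp: B2_def not_less\<close>)
  have off: "off_sqn n (?W \<omega>) (S \<omega>) x \<le> (1 + e) ^ 3 * sqn n x"
    if w: "\<omega> \<in> space M - ?B" and x: "supp n x \<subseteq> S \<omega>" for \<omega> x
  proof -
    \<comment> \<open>One factor \<open>1 + e\<close> comes from the fluctuation at lattice points,
      the other two from rounding with relative mesh \<open>e\<close>.\<close>
    have "off_sqn n (?W \<omega>) (S \<omega>) x \<le> (1 + e) * (1 + e)\<^sup>2 * sqn n x"
      using e cS[OF w] w by (intro off_sqn_sparse_bound s S x) (auto simp: B3_def not_less)
    then show ?thesis by (simp add: power3_eq_cube power2_eq_square)
  qed
  show ?thesis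
  proof (rule that)
    show "?B \<in> events" using B12 B3 B4 B5 by auto
    show "prob ?B \<le> bad_bound n s k e t" by (rule prob)
  next
    fix \<omega> assume w: "\<omega> \<in> space M - ?B"
    show "rayleigh_upper_ok k e t \<omega>"
      unfolding rayleigh_upper_ok_def
    proof (intro allI impI)
      fix d v
      assume R: "\<forall>i<n. rowsum i \<omega> \<le> d" and D: "d + k - t - 30 > 0"
      show "(\<Sum>i<n. rowsum i \<omega> * (v i)\<^sup>2) - bilin n (?W \<omega>) v v
          \<le> (d + k + (1 + e) ^ 3 / (d + k - t - 30)) * sqn n v"
      proof (rule rayleigh_upper[where S="S \<omega>"])
        show "bilin n (?W \<omega>) x y \<le> k * sqrt (sqn n x) * sqrt (sqn n y)"
          if "supp n x \<subseteq> S \<omega>" "supp n y \<subseteq> S \<omega>" for x y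
          using that cS[OF w] by (intro blk[OF w S(2)]) auto
        show "rowsum i \<omega> \<le> t" if "i < n" "i \<notin> S \<omega>" for i using RS[OF that] by simp
      qed (use R D e nrm[OF w] off[OF w] sym in auto)
    qed
    show "rayleigh_lower_ok k e t \<omega>"
      unfolding rayleigh_lower_ok_def
    proof (intro allI impI)
      fix d i \<mu>
      assume i: "i < n" "d \<le> rowsum i \<omega>" and d: "d > 0" and mu: "\<mu> \<ge> 0"
        "\<mu> * (1 + (30 / d)\<^sup>2) \<le> (1 - e - k\<^sup>2) * (1 / d - (t + 30) / d\<^sup>2)" "0 \<le> 1 / d - (t + 30) / d\<^sup>2"
      have "card (insert i (S \<omega>)) \<le> s"
        using cS[OF w] card_insert_le_m1[of s "S \<omega>" i] s by auto
      then have blk': "bilin n (?W \<omega>) x y \<le> k * sqrt (sqn n x) * sqrt (sqn n y)"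
        if "supp n x \<subseteq> insert i (S \<omega>)" "supp n y \<subseteq> insert i (S \<omega>)" for x y
        using that S by (intro blk[OF w]) auto
      have "\<not> (\<Sum>j<n. (W i j \<omega>)\<^sup>2) < 1 - e" using w i by (auto simp: B4_def)
      then have row: "1 - e \<le> (\<Sum>j<n. (W i j \<omega>)\<^sup>2)" by simp
      have RS': "- t \<le> rowsum i \<omega>" if "i < n" "i \<notin> S \<omega>" for i using RS[OF that] by simp
      show "\<exists>v. sqn n v > 0 \<and> (d + \<mu>) * sqn n v \<le> (\<Sum>i<n. rowsum i \<omega> * (v i)\<^sup>2) - bilin n (?W \<omega>) v v"
        by (rule rayleigh_lower[where S="S \<omega>" and C=30 and k=k and \<rho>="1 - e" and \<tau>=t and i=i])
           (use i d mu nrm[OF w] blk' row RS' diag sym k in auto)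
    qed
  qed
qed

end

text \<open>It must exceed by far the expected number of row sums beyond
  \<open>(ln n) powr (1/4)\<close>, which is at most \<open>2 * n * exp (- sqrt (ln n) / 2)\<close>,
  while the entropy \<open>s * ln n\<close> must stay far below the exponent
  \<open>n / (ln n)\<^sup>2\<close> of the block bound. The fourth power leaves a factor
  \<open>ln n\<close> in the latter.\<close>

definition sparsity :: "nat \<Rightarrow> nat" where
  "sparsity n = nat \<lfloor>real n / (ln (real n)) ^ 4\<rfloor>"

text \<open>The weight \<open>b = ln n\<close> keeps the product over all coordinates bounded by
  \<open>exp 4\<close>; each unit of squared norm then costs \<open>ln n\<close>.\<close>

lemma card_int_ball_ln:
  assumes n: "ln (real n) \<ge> 1"
  shows "real (card (int_ball n m)) \<le> exp (m * ln (real n) + 4)"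
proof -
  have np: "real n > 0" using n by (cases "n = 0") auto
  have "real (card (int_ball n m)) \<le> exp (ln (real n) * m) * (1 + 4 * exp (- ln (real n))) ^ n"
    by (rule card_int_ball[OF n])
  also have "exp (- ln (real n)) = 1 / real n" using np by (simp add: exp_minus inverse_eq_divide)
  also have "(1 + 4 * (1 / real n)) ^ n \<le> exp (4 / real n) ^ n"
    using exp_ge_add_one_self[of "4 / real n"] by (intro power_mono) auto
  also have "exp (4 / real n) ^ n = exp 4" using np by (simp add: exp_of_nat_mult[symmetric])
  finally show ?thesis by (simp add: exp_add mult.commute)
qed

text \<open>For dense vectors the weight \<open>b = 1\<close> gives linear entropy. Pairs of points
  contribute \<open>12 * n\<close>; the norm constant 30 is chosen because
  \<open>30\<^sup>2 / 64\<close> exceeds 14.\<close>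

lemma card_int_ball_full: "real (card (int_ball n (4 * real n))) \<le> exp (6 * real n)"
proof -
  have "exp (- 1) \<le> (1/2 :: real)"
    using exp_ge_add_one_self[of 1] by (simp add: exp_minus field_simps)
  then have "1 + 4 * exp (- 1) \<le> exp (2::real)" using exp_ge_add_one_self[of 2] by linarith
  then have "(1 + 4 * exp (- 1)) ^ n \<le> exp (2::real) ^ n" by (intro power_mono) (auto intro: add_nonneg_nonneg)
  then have "exp (1 * (4 * real n)) * (1 + 4 * exp (- 1)) ^ n \<le> exp (4 * real n) * exp 2 ^ n"
    by (intro mult_mono) auto
  also have "\<dots> = exp (6 * real n)" by (simp add: exp_of_nat_mult[symmetric] exp_add[symmetric])
  finally show ?thesis using card_int_ball[of 1 n "4 * real n"] by simp
qed

text \<open>The block norm \<open>1 / ln n\<close> is of smaller order than \<open>1 / a\<close>,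
  and the cutoff \<open>(ln n) powr (1/4)\<close> of smaller order than \<open>a\<close>; both are
  still coarse enough for the failure probability to vanish.\<close>

lemma bad_bound_tendsto_0:
  assumes e: "0 < e"
  shows "(\<lambda>n. bad_bound n (sparsity n) (1 / ln (real n)) e (ln (real n) powr (1/4))) \<longlonglongrightarrow> 0"
proof -
  define c where "c = (1 + 1 / e)\<^sup>2"
  have c: "c > 0" using e unfolding c_def by (intro zero_less_power add_pos_pos) auto
  define s where "s n = real n / (ln (real n)) ^ 4" for n
  \<comment> \<open>An explicit majorant: lattice counts are replaced by exponentials and the
    rounded \<open>sparsity n\<close> by \<open>s n\<close> or, in the denominator, by
    \<open>s n - 1\<close>.\<close>
  define f where "f n = exp (- 2 * real n)
     + exp (8 * s n * ln (real n) + 8 - (1 / ln (real n))\<^sup>2 * real n / 64)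
     + exp (s n * c * ln (real n) + 4 - real n * e\<^sup>2 / 16)
     + real n * exp (1 - real n * e\<^sup>2 / 8)
     + 2 * real n * exp (- (ln (real n) powr (1/4))\<^sup>2 / 2) / (s n - 1)" for n
  have e2: "e\<^sup>2 > 0" using e by simp
  have f: "f \<longlonglongrightarrow> 0"
  proof -
    have "(\<lambda>n. exp (- 2 * real n)) \<longlonglongrightarrow> 0" by real_asymp
    moreover have "(\<lambda>n. exp (8 * s n * ln (real n) + 8 - (1 / ln (real n))\<^sup>2 * real n / 64)) \<longlonglongrightarrow> 0"
      unfolding s_def by real_asymp
    moreover have "(\<lambda>n. exp (s n * c * ln (real n) + 4 - real n * e\<^sup>2 / 16)) \<longlonglongrightarrow> 0"
      unfolding s_def using c e2 by real_asymp
    moreover have "(\<lambda>n. real n * exp (1 - real n * e\<^sup>2 / 8)) \<longlonglongrightarrow> 0"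
      using e2 by real_asymp
    moreover have "(\<lambda>n. 2 * real n * exp (- (ln (real n) powr (1/4))\<^sup>2 / 2) / (s n - 1)) \<longlonglongrightarrow> 0"
      unfolding s_def by real_asymp
    ultimately have "(\<lambda>n. f n) \<longlonglongrightarrow> 0 + 0 + 0 + 0 + 0" unfolding f_def by (intro tendsto_add)
    then show ?thesis by simp
  qed
  have ev: "\<forall>\<^sub>F n in sequentially. ln (real n) \<ge> 1 \<and> s n > 1"
    unfolding s_def by (intro eventually_conj; real_asymp)
  have le: "\<forall>\<^sub>F n in sequentially. bad_bound n (sparsity n) (1 / ln (real n)) e (ln (real n) powr (1/4)) \<le> f n"
    using ev
  proof eventually_elim
    case (elim n)
    have sp: "real (sparsity n) \<le> s n" "s n - 1 \<le> real (sparsity n)"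
      using elim unfolding sparsity_def s_def[symmetric] by linarith+
    have ln0: "ln (real n) \<ge> 0" using elim by simp
    have 1: "(real (card (int_ball n (4 * real n))))\<^sup>2 * exp (- 30\<^sup>2 * real n / 64) \<le> exp (- 2 * real n)"
    proof -
      have "(real (card (int_ball n (4 * real n))))\<^sup>2 \<le> (exp (6 * real n))\<^sup>2"
        by (intro power_mono card_int_ball_full) auto
      then have "(real (card (int_ball n (4 * real n))))\<^sup>2 * exp (- 30\<^sup>2 * real n / 64)
          \<le> (exp (6 * real n))\<^sup>2 * exp (- 30\<^sup>2 * real n / 64)" by (rule mult_right_mono) simp
      also have "\<dots> \<le> exp (- 2 * real n)"
        by (simp add: power2_eq_square exp_add[symmetric])
      finally show ?thesis .
    qed
    have 2: "(real (card (int_ball n (4 * real (sparsity n)))))\<^sup>2 * exp (- (1 / ln (real n))\<^sup>2 * real n / 64)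
        \<le> exp (8 * s n * ln (real n) + 8 - (1 / ln (real n))\<^sup>2 * real n / 64)"
    proof -
      have "real (card (int_ball n (4 * real (sparsity n)))) \<le> exp (4 * real (sparsity n) * ln (real n) + 4)"
        using elim by (intro card_int_ball_ln) auto
      also have "\<dots> \<le> exp (4 * s n * ln (real n) + 4)"
        using sp ln0 by (simp add: mult_right_mono)
      finally have "(real (card (int_ball n (4 * real (sparsity n)))))\<^sup>2 \<le> (exp (4 * s n * ln (real n) + 4))\<^sup>2"
        by (intro power_mono) auto
      then have "(real (card (int_ball n (4 * real (sparsity n)))))\<^sup>2 * exp (- (1 / ln (real n))\<^sup>2 * real n / 64)
        \<le> (exp (4 * s n * ln (real n) + 4))\<^sup>2 * exp (- (1 / ln (real n))\<^sup>2 * real n / 64)"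
        by (rule mult_right_mono) simp
      also have "\<dots> = exp (8 * s n * ln (real n) + 8 - (1 / ln (real n))\<^sup>2 * real n / 64)"
        by (simp add: power2_eq_square exp_add[symmetric])
      finally show ?thesis .
    qed
    have 3: "real (card (int_ball n (real (sparsity n) * (1 + 1 / e)\<^sup>2))) * exp (- real n * e\<^sup>2 / 16)
        \<le> exp (s n * c * ln (real n) + 4 - real n * e\<^sup>2 / 16)"
    proof -
      have "real (card (int_ball n (real (sparsity n) * c))) \<le> exp (real (sparsity n) * c * ln (real n) + 4)"
        using elim by (intro card_int_ball_ln) auto
      also have "\<dots> \<le> exp (s n * c * ln (real n) + 4)"
        using sp ln0 c by (simp add: mult_right_mono)
      finally have "real (card (int_ball n (real (sparsity n) * c))) * exp (- real n * e\<^sup>2 / 16)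
          \<le> exp (s n * c * ln (real n) + 4) * exp (- real n * e\<^sup>2 / 16)" by (rule mult_right_mono) simp
      also have "\<dots> = exp (s n * c * ln (real n) + 4 - real n * e\<^sup>2 / 16)" by (simp add: exp_add[symmetric])
      finally show ?thesis by (simp add: c_def)
    qed
    have 5: "2 * real n * exp (- (ln (real n) powr (1/4))\<^sup>2 / 2) / real (sparsity n)
        \<le> 2 * real n * exp (- (ln (real n) powr (1/4))\<^sup>2 / 2) / (s n - 1)"
      using sp elim by (intro divide_left_mono) auto
    show ?case unfolding bad_bound_def f_def by (intro add_mono 1 2 3 5 order_refl)
  qed
  have "\<forall>\<^sub>F n in sequentially. 0 \<le> bad_bound n (sparsity n) (1 / ln (real n)) e (ln (real n) powr (1/4))"
    by (intro always_eventually allI) (simp add: bad_bound_def)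
  from tendsto_sandwich[OF this le _ f] show ?thesis by simp
qed

subsection \<open>Factorial moments and the normal tail\<close>

text \<open>For \<open>N > 0\<close> the partial sum telescopes to
  \<open>(- 1) ^ m * ((N - 1) choose m)\<close>, whose sign is that of the last term.\<close>

lemma alternating_choose_sum:
  fixes N :: nat
  shows "even m \<Longrightarrow> (if N = 0 then 1 else 0) \<le> (\<Sum>k\<le>m. (- 1) ^ k * real (N choose k))"
    and "odd m \<Longrightarrow> (\<Sum>k\<le>m. (- 1) ^ k * real (N choose k)) \<le> (if N = 0 then 1 else 0)"
proof -
  have *: "(\<Sum>k\<le>m. (- 1) ^ k * real (N choose k)) = (if N = 0 then 1 else (- 1) ^ m * real ((N - 1) choose m))"
  proof (cases "N = 0")
    case True
    have "(\<Sum>k\<le>m. (- 1) ^ k * real (0 choose k)) = (\<Sum>k\<le>m. if k = 0 then 1 else 0)"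
      by (intro sum.cong) auto
    then show ?thesis using True by simp
  next
    case False
    have "(\<Sum>k\<le>m. (- 1) ^ k * real (N choose k)) = (\<Sum>k\<le>m. (real N gchoose k) * (- 1) ^ k)"
      by (intro sum.cong refl) (simp only: binomial_gbinomial mult.commute)
    also have "\<dots> = (- 1) ^ m * (real N - 1 gchoose m)"
      by (rule gbinomial_sum_lower_neg)
    also have "real N - 1 = real (N - 1)" using False by (simp add: of_nat_diff)
    also have "real (N - 1) gchoose m = real ((N - 1) choose m)" by (rule binomial_gbinomial[symmetric])
    finally show ?thesis using False by simp
  qed
  show "even m \<Longrightarrow> (if N = 0 then 1 else 0) \<le> (\<Sum>k\<le>m. (- 1) ^ k * real (N choose k))"
    and "odd m \<Longrightarrow> (\<Sum>k\<le>m. (- 1) ^ k * real (N choose k)) \<le> (if N = 0 then 1 else 0)"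
    unfolding * by auto
qed

context prob_space
begin

text \<open>The \<open>k\<close>-th binomial moment of the number of indices satisfying
  \<open>P\<close>, that is its factorial moment divided by \<open>fact k\<close>.\<close>

definition joint_sum :: "nat \<Rightarrow> (nat \<Rightarrow> 'a \<Rightarrow> bool) \<Rightarrow> nat \<Rightarrow> real" where
  "joint_sum n P k = (\<Sum>K\<in>{K. K \<subseteq> {..<n} \<and> card K = k}. prob {\<omega> \<in> space M. \<forall>i\<in>K. P i \<omega>})"

text \<open>The alternating inequality holds pointwise for the number \<open>N\<close> of indices
  satisfying \<open>P\<close>; integrating it turns \<open>N choose k\<close> into
  \<open>joint_sum n P k\<close>.\<close>

lemma bonferroni:
  assumes P: "\<And>i. i < n \<Longrightarrow> {\<omega> \<in> space M. P i \<omega>} \<in> events"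
  shows "even m \<Longrightarrow> prob {\<omega> \<in> space M. \<forall>i<n. \<not> P i \<omega>} \<le> (\<Sum>k\<le>m. (- 1) ^ k * joint_sum n P k)"
    and "odd m \<Longrightarrow> (\<Sum>k\<le>m. (- 1) ^ k * joint_sum n P k) \<le> prob {\<omega> \<in> space M. \<forall>i<n. \<not> P i \<omega>}"
proof -
  let ?sub = "\<lambda>k. {K. K \<subseteq> {..<n} \<and> card K = k}"
  let ?A = "\<lambda>K. {\<omega> \<in> space M. \<forall>i\<in>K. P i \<omega>}"
  define N where "N \<omega> = card {i. i < n \<and> P i \<omega>}" for \<omega>
  have fin: "finite (?sub k)" for k by (rule finite_subset[of _ "Pow {..<n}"]) auto
  have A: "?A K \<in> events" if "K \<in> ?sub k" for K k
    using that P by (intro sets.sets_Collect_finite_All) (auto intro: finite_subset)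
  have C: "real (N \<omega> choose k) = (\<Sum>K\<in>?sub k. indicator (?A K) \<omega>)" if "\<omega> \<in> space M" for \<omega> k
  proof -
    have "N \<omega> choose k = card {K. K \<subseteq> {i. i < n \<and> P i \<omega>} \<and> card K = k}"
      unfolding N_def by (rule n_subsets[symmetric]) simp
    also have "{K. K \<subseteq> {i. i < n \<and> P i \<omega>} \<and> card K = k} = ?sub k \<inter> {K. \<forall>i\<in>K. P i \<omega>}" by auto
    also have "real (card \<dots>) = (\<Sum>K\<in>?sub k. if \<forall>i\<in>K. P i \<omega> then 1 else 0)"
      using fin[of k] by (subst sum.If_cases) auto
    also have "\<dots> = (\<Sum>K\<in>?sub k. indicator (?A K) \<omega>)"
      using that by (intro sum.cong) (auto simp: indicator_def)
    finally show ?thesis .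
  qed
  have int: "integrable M (\<lambda>\<omega>. \<Sum>K\<in>?sub k. indicator (?A K) \<omega> :: real)" for k
    using A by (intro Bochner_Integration.integrable_sum) (auto simp: emeasure_eq_measure)
  have EC: "(\<integral>\<omega>. (\<Sum>K\<in>?sub k. indicator (?A K) \<omega>) \<partial>M) = joint_sum n P k" for k
    unfolding joint_sum_def using A
    by (subst Bochner_Integration.integral_sum) (auto simp: emeasure_eq_measure)
  define F where "F \<omega> = (\<Sum>k\<le>m. (- 1) ^ k * (\<Sum>K\<in>?sub k. indicator (?A K) \<omega>) :: real)" for \<omega>
  have Fint: "integrable M F"
    unfolding F_def by (rule Bochner_Integration.integrable_sum, rule integrable_mult_right, rule int)
  have EF: "(\<integral>\<omega>. F \<omega> \<partial>M) = (\<Sum>k\<le>m. (- 1) ^ k * joint_sum n P k)"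
  proof -
    have "(\<integral>\<omega>. F \<omega> \<partial>M) = (\<Sum>k\<le>m. \<integral>\<omega>. (- 1) ^ k * (\<Sum>K\<in>?sub k. indicator (?A K) \<omega>) \<partial>M)"
      unfolding F_def by (rule Bochner_Integration.integral_sum, rule integrable_mult_right, rule int)
    then show ?thesis by (simp only: integral_mult_right_zero EC)
  qed
  let ?Z = "{\<omega> \<in> space M. \<forall>i<n. \<not> P i \<omega>}"
  have "?Z = space M - (\<Union>i<n. {\<omega> \<in> space M. P i \<omega>})" by auto
  also have "\<dots> \<in> events" using P by (intro sets.Diff sets.finite_UN) auto
  finally have Z: "?Z \<in> events" .
  have Zint: "integrable M (indicator ?Z :: 'a \<Rightarrow> real)" 
    by (rule integrable_real_indicator[OF Z]) (simp add: less_top[symmetric])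
  have EZ: "(\<integral>\<omega>. indicator ?Z \<omega> \<partial>M) = prob ?Z"
    using Bochner_Integration.integral_indicator[of M ?Z] sets.sets_into_space[OF Z]
    by (simp add: Int_absorb2)
  have ZN: "indicator ?Z \<omega> = (if N \<omega> = 0 then 1 else 0 :: real)" if "\<omega> \<in> space M" for \<omega>
  proof -
    have "N \<omega> = 0 \<longleftrightarrow> (\<forall>i<n. \<not> P i \<omega>)" by (auto simp: N_def)
    then show ?thesis using that by (simp add: indicator_def)
  qed
  have FN: "F \<omega> = (\<Sum>k\<le>m. (- 1) ^ k * real (N \<omega> choose k))" if "\<omega> \<in> space M" for \<omega>
    unfolding F_def C[OF that] by (rule refl)
  show "prob ?Z \<le> (\<Sum>k\<le>m. (- 1) ^ k * joint_sum n P k)" if "even m"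
  proof -
    have "indicator ?Z \<omega> \<le> F \<omega>" if "\<omega> \<in> space M" for \<omega>
      unfolding ZN[OF that] FN[OF that] by (rule alternating_choose_sum(1)[OF \<open>even m\<close>])
    then show ?thesis
      unfolding EF[symmetric] EZ[symmetric] by (rule integral_mono[OF Zint Fint])
  qed
  show "(\<Sum>k\<le>m. (- 1) ^ k * joint_sum n P k) \<le> prob ?Z" if "odd m"
  proof -
    have "F \<omega> \<le> indicator ?Z \<omega>" if "\<omega> \<in> space M" for \<omega>
      unfolding ZN[OF that] FN[OF that] by (rule alternating_choose_sum(2)[OF \<open>odd m\<close>])
    then show ?thesis
      unfolding EF[symmetric] EZ[symmetric] by (rule integral_mono[OF Fint Zint])
  qed
qed

end

text \<open>The truncation order stays fixed while \<open>n\<close> grows, which gives bounds by the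
  partial sums of the series of \<open>exp (- L)\<close>. Only then is the order chosen large, odd
  for the lower and even for the upper bound.\<close>

lemma poisson_limit_bonferroni:
  fixes p :: "nat \<Rightarrow> real" and S :: "nat \<Rightarrow> nat \<Rightarrow> real"
  assumes up: "\<And>m. even m \<Longrightarrow> \<forall>\<^sub>F n in sequentially. p n \<le> (\<Sum>k\<le>m. (- 1) ^ k * S n k)"
    and lo: "\<And>m. odd m \<Longrightarrow> \<forall>\<^sub>F n in sequentially. (\<Sum>k\<le>m. (- 1) ^ k * S n k) \<le> p n"
    and S: "\<And>k. (\<lambda>n. S n k) \<longlonglongrightarrow> L ^ k / fact k"
  shows "p \<longlonglongrightarrow> exp (- L)"
proof -
  define E where "E m = (\<Sum>k\<le>m. (- 1) ^ k * (L ^ k / fact k))" for m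
  have SE: "(\<lambda>n. \<Sum>k\<le>m. (- 1) ^ k * S n k) \<longlonglongrightarrow> E m" for m
    unfolding E_def by (intro tendsto_intros S)
  have "(\<lambda>k. (- L) ^ k /\<^sub>R fact k) sums exp (- L)" by (rule exp_converges)
  then have "(\<lambda>m. \<Sum>k\<le>m. (- L) ^ k /\<^sub>R fact k) \<longlonglongrightarrow> exp (- L)" by (simp add: sums_def_le)
  moreover have "(- L) ^ k /\<^sub>R fact k = (- 1) ^ k * (L ^ k / fact k)" for k
    by (subst power_minus) (simp add: field_simps)
  ultimately have E: "E \<longlonglongrightarrow> exp (- L)" unfolding E_def by simp
  show ?thesis
  proof (rule order_tendstoI)
    fix a assume "a < exp (- L)"
    moreover have "(\<lambda>j. E (2 * j + 1)) \<longlonglongrightarrow> exp (- L)"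
      using LIMSEQ_subseq_LIMSEQ[OF E, of "\<lambda>j. 2 * j + 1"] by (simp add: strict_mono_def comp_def)
    ultimately have "\<forall>\<^sub>F j in sequentially. a < E (2 * j + 1)" by (rule order_tendstoD(1)[rotated])
    then obtain j where "a < E (2 * j + 1)" by (meson eventually_sequentially order_refl)
    then have "\<forall>\<^sub>F n in sequentially. a < (\<Sum>k\<le>2 * j + 1. (- 1) ^ k * S n k)"
      by (rule order_tendstoD(1)[OF SE])
    moreover have "\<forall>\<^sub>F n in sequentially. (\<Sum>k\<le>2 * j + 1. (- 1) ^ k * S n k) \<le> p n"
      by (rule lo) simp
    ultimately show "\<forall>\<^sub>F n in sequentially. a < p n"
      by eventually_elim (rule less_le_trans)
  next
    fix a assume "exp (- L) < a"
    moreover have "(\<lambda>j. E (2 * j)) \<longlonglongrightarrow> exp (- L)"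
      using LIMSEQ_subseq_LIMSEQ[OF E, of "\<lambda>j. 2 * j"] by (simp add: strict_mono_def comp_def)
    ultimately have "\<forall>\<^sub>F j in sequentially. E (2 * j) < a" by (rule order_tendstoD(2)[rotated])
    then obtain j where "E (2 * j) < a" by (meson eventually_sequentially order_refl)
    then have "\<forall>\<^sub>F n in sequentially. (\<Sum>k\<le>2 * j. (- 1) ^ k * S n k) < a"
      by (rule order_tendstoD(2)[OF SE])
    moreover have "\<forall>\<^sub>F n in sequentially. p n \<le> (\<Sum>k\<le>2 * j. (- 1) ^ k * S n k)"
      by (rule up) simp
    ultimately show "\<forall>\<^sub>F n in sequentially. p n < a"
      by eventually_elim (rule le_less_trans)
  qed
qed

section \<open>Asymptotics of the standard normal tail\<close>

definition normal_tail_prob :: "real \<Rightarrow> real" where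
  "normal_tail_prob y = measure (density lborel (\<lambda>x. ennreal (std_normal_density x))) {y..}"

lemma (in prob_space) normal_tail_prob_eq:
  assumes Y: "distributed M lborel Y (normal_density 0 s)" and s: "s > 0"
  shows "prob {\<omega> \<in> space M. Y \<omega> \<ge> u} = normal_tail_prob (u / s)"
proof -
  have X: "distributed M lborel (\<lambda>\<omega>. (Y \<omega> - 0) / s) std_normal_density"
    using Y normal_standard_normal_convert[OF s, of Y 0] by simp
  have m: "(\<lambda>\<omega>. (Y \<omega> - 0) / s) \<in> borel_measurable M" using distributed_measurable[OF X] by simp
  have "normal_tail_prob (u / s) = measure (distr M lborel (\<lambda>\<omega>. (Y \<omega> - 0) / s)) {u / s..}"
    unfolding normal_tail_prob_def distributed_distr_eq_density[OF X] ..
  also have "\<dots> = prob ((\<lambda>\<omega>. (Y \<omega> - 0) / s) -` {u / s..} \<inter> space M)"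
    using m by (intro measure_distr) auto
  also have "(\<lambda>\<omega>. (Y \<omega> - 0) / s) -` {u / s..} \<inter> space M = {\<omega> \<in> space M. Y \<omega> \<ge> u}"
    using s by (auto simp: divide_le_cancel)
  finally show ?thesis by simp
qed

text \<open>The antiderivative of \<open>x \<mapsto> \<phi>(x) (1 + 1/x\<^sup>2)\<close> is \<open>- \<phi>(x) / x\<close>.\<close>

lemma mills_ratio:
  assumes y: "y > 0"
  shows "normal_tail_prob y \<le> std_normal_density y / y"
    and "std_normal_density y / y \<le> (1 + 1 / y\<^sup>2) * normal_tail_prob y"
proof -
  let ?\<phi> = std_normal_density
  interpret N: prob_space "density lborel (\<lambda>x. ennreal (?\<phi> x))"
    by (rule prob_space_normal_density) simp
  have e: "ennreal (normal_tail_prob y) = (\<integral>\<^sup>+x. ennreal (?\<phi> x) * indicator {y..} x \<partial>lborel)"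
    unfolding normal_tail_prob_def N.emeasure_eq_measure[symmetric]
    by (subst emeasure_density) auto
  have "(\<integral>\<^sup>+x. ennreal (?\<phi> x * (1 + 1 / x\<^sup>2)) * indicator {y..} x \<partial>lborel) = ennreal (0 - (- (?\<phi> y / y)))"
  proof (rule nn_integral_FTC_atLeast)
    show "DERIV (\<lambda>x. - (?\<phi> x / x)) x :> ?\<phi> x * (1 + 1 / x\<^sup>2)" if "y \<le> x" for x
    proof -
      have x: "x > 0" using that y by simp
      define K where "K = 1 / sqrt (2 * pi)"
      have "DERIV (\<lambda>x. - (K * exp (- x\<^sup>2 / 2) / x)) x :> K * exp (- x\<^sup>2 / 2) * (1 + 1 / x\<^sup>2)"
        using x by (auto intro!: derivative_eq_intros simp: field_simps power2_eq_square)
      then show ?thesis by (simp add: std_normal_density_def K_def)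
    qed
    show "((\<lambda>x. - (?\<phi> x / x)) \<longlongrightarrow> 0) at_top"
      unfolding std_normal_density_def by real_asymp
  qed auto
  then have I: "(\<integral>\<^sup>+x. ennreal (?\<phi> x * (1 + 1 / x\<^sup>2)) * indicator {y..} x \<partial>lborel) = ennreal (?\<phi> y / y)" by simp
  have q: "normal_tail_prob y \<ge> 0" by (simp add: normal_tail_prob_def)
  have "ennreal (normal_tail_prob y) \<le> (\<integral>\<^sup>+x. ennreal (?\<phi> x * (1 + 1 / x\<^sup>2)) * indicator {y..} x \<partial>lborel)"
  proof -
    have "?\<phi> x \<le> ?\<phi> x * (1 + 1 / x\<^sup>2)" for x
      using mult_left_mono[of 1 "1 + 1 / x\<^sup>2" "?\<phi> x"] by simp
    then show ?thesis
      unfolding e by (intro nn_integral_mono) (auto simp: indicator_def intro!: ennreal_leI)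
  qed
  then show "normal_tail_prob y \<le> ?\<phi> y / y" unfolding I using y by simp
  have "ennreal (?\<phi> y / y) \<le> (\<integral>\<^sup>+x. ennreal (1 + 1 / y\<^sup>2) * (ennreal (?\<phi> x) * indicator {y..} x) \<partial>lborel)"
    unfolding I[symmetric]
  proof (intro nn_integral_mono)
    fix x
    show "ennreal (?\<phi> x * (1 + 1 / x\<^sup>2)) * indicator {y..} x \<le> ennreal (1 + 1 / y\<^sup>2) * (ennreal (?\<phi> x) * indicator {y..} x)"
    proof (cases "y \<le> x")
      case True
      then have "y\<^sup>2 \<le> x\<^sup>2" using y by (intro power_mono) auto
      moreover have "0 < x\<^sup>2 * y\<^sup>2" using True y by simp
      ultimately have "1 / x\<^sup>2 \<le> 1 / y\<^sup>2" by (intro divide_left_mono) auto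
      then have "?\<phi> x * (1 + 1 / x\<^sup>2) \<le> (1 + 1 / y\<^sup>2) * ?\<phi> x"
        by (subst mult.commute) (intro mult_right_mono, auto)
      then have "ennreal (?\<phi> x * (1 + 1 / x\<^sup>2)) \<le> ennreal ((1 + 1 / y\<^sup>2) * ?\<phi> x)" by (rule ennreal_leI)
      also have "\<dots> = ennreal (1 + 1 / y\<^sup>2) * ennreal (?\<phi> x)" by (rule ennreal_mult) auto
      finally show ?thesis using True by (simp del: ennreal_plus)
    qed simp
  qed
  also have "\<dots> = ennreal (1 + 1 / y\<^sup>2) * ennreal (normal_tail_prob y)"
    unfolding e by (rule nn_integral_cmult) simp
  also have "\<dots> = ennreal ((1 + 1 / y\<^sup>2) * normal_tail_prob y)"
    using q by (simp add: ennreal_mult')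
  finally show "?\<phi> y / y \<le> (1 + 1 / y\<^sup>2) * normal_tail_prob y"
    using q by (subst (asm) ennreal_le_iff) auto
qed

text \<open>Writing \<open>y = a + r / a\<close> with \<open>r = t - c / 2\<close>, the identity \<open>exp (c / 2) = sqrt (2 pi) a\<close> turns
  \<open>n \<phi>(y) / y\<close> into \<open>exp (- t - (r / a)\<^sup>2 / 2) / (1 + r / a\<^sup>2)\<close>.\<close>

lemma normal_tail_asymptotics:
  fixes y t :: "nat \<Rightarrow> real"
  defines "a \<equiv> \<lambda>n. sqrt (2 * ln (real n))" and "c \<equiv> \<lambda>n. ln (ln (real n)) + ln (4 * pi)"
  assumes t: "t \<longlonglongrightarrow> l" and y: "\<forall>\<^sub>F n in sequentially. y n = a n - c n / (2 * a n) + t n / a n"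
  shows "(\<lambda>n. real n * normal_tail_prob (y n)) \<longlonglongrightarrow> exp (- l)"
proof -
  define r where "r n = t n - c n / 2" for n
  have a_top: "filterlim a at_top sequentially" unfolding a_def by real_asymp
  have ca: "(\<lambda>n. c n / a n) \<longlonglongrightarrow> 0" unfolding a_def c_def by real_asymp
  have ta: "(\<lambda>n. t n / a n) \<longlonglongrightarrow> 0"
    by (rule real_tendsto_divide_at_top[OF t a_top])
  have "(\<lambda>n. t n / a n - c n / a n / 2) \<longlonglongrightarrow> 0 - 0 / 2" by (intro tendsto_intros ta ca) simp
  then have ra: "(\<lambda>n. r n / a n) \<longlonglongrightarrow> 0" by (simp add: r_def diff_divide_distrib mult.commute)
  have ra2: "(\<lambda>n. r n / a n / a n) \<longlonglongrightarrow> 0" by (rule real_tendsto_divide_at_top[OF ra a_top])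
  have evy: "\<forall>\<^sub>F n in sequentially. y n = a n * (1 + r n / a n / a n) \<and> a n > 1 \<and> real n > 0 \<and> ln (real n) > 0"
  proof -
    have "\<forall>\<^sub>F n in sequentially. a n > 1" using a_top by (simp add: filterlim_at_top_dense)
    moreover have "\<forall>\<^sub>F n in sequentially. real n > 0 \<and> ln (real n) > 0" by (intro eventually_conj; real_asymp)
    ultimately show ?thesis using y
    proof eventually_elim
      case (elim n)
      have 1: "a n * (1 + r n / a n / a n) = a n + r n / a n" using elim by (simp add: distrib_left)
      have 2: "r n / a n = t n / a n - c n / (2 * a n)" by (simp add: r_def diff_divide_distrib)
      show ?case unfolding 1 using elim 2 by simp
    qed
  qed
  have "filterlim (\<lambda>n. (1 + r n / a n / a n) * a n) at_top sequentially"
    by (rule filterlim_tendsto_pos_mult_at_top[OF _ _ a_top, of _ "1 + 0"]) (intro tendsto_intros ra2, simp)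
  then have ytop: "filterlim y at_top sequentially"
    by (rule filterlim_cong[THEN iffD1, rotated -1]) (use evy in \<open>auto elim!: eventually_mono simp: mult.commute\<close>)
  define g where "g n = exp (- t n - (r n / a n)\<^sup>2 / 2) / (1 + r n / a n / a n)" for n
  have g: "g \<longlonglongrightarrow> exp (- l)"
  proof -
    have "g \<longlonglongrightarrow> exp (- l - 0\<^sup>2 / 2) / (1 + 0)" unfolding g_def by (intro tendsto_intros t ra ra2) auto
    then show ?thesis by simp
  qed
  have ypos: "\<forall>\<^sub>F n in sequentially. y n > 0" using ytop by (simp add: filterlim_at_top_dense)
  have gphi: "\<forall>\<^sub>F n in sequentially. real n * (std_normal_density (y n) / y n) = g n"
    using evy ypos
  proof eventually_elim
    case (elim n)
    define q where "q = 1 + r n / a n / a n"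
    have q: "q > 0" using elim by (simp add: q_def zero_less_mult_iff)
    have a2: "(a n)\<^sup>2 = 2 * ln (real n)" using elim by (simp add: a_def)
    have "y n = a n + r n / a n" using elim by (simp add: field_simps)
    then have "(y n)\<^sup>2 = (a n)\<^sup>2 + 2 * r n + (r n / a n)\<^sup>2" using elim by (simp add: power2_sum)
    then have y2: "- (y n)\<^sup>2 / 2 = - ln (real n) - r n - (r n / a n)\<^sup>2 / 2" by (simp add: a2)
    have "exp (c n / 2) = sqrt (ln (real n)) * sqrt (4 * pi)"
    proof -
      have "exp (c n / 2) = exp (ln (ln (real n)) / 2) * exp (ln (4 * pi) / 2)"
        by (simp add: c_def exp_add[symmetric] add_divide_distrib)
      also have "exp (ln (ln (real n)) / 2) = sqrt (ln (real n))" using elim by (simp add: ln_sqrt[symmetric])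
      also have "exp (ln (4 * pi) / 2) = sqrt (4 * pi)" by (subst ln_sqrt[symmetric]) auto
      finally show ?thesis .
    qed
    also have "\<dots> = sqrt (2 * pi) * a n" by (simp add: a_def real_sqrt_mult[symmetric])
    finally have ec: "exp (c n / 2) = sqrt (2 * pi) * a n" .
    have "exp (- (y n)\<^sup>2 / 2) = exp (- ln (real n)) * exp (c n / 2) * exp (- t n - (r n / a n)\<^sup>2 / 2)"
      unfolding y2 exp_add[symmetric] by (simp add: r_def)
    also have "\<dots> = 1 / real n * (sqrt (2 * pi) * a n) * exp (- t n - (r n / a n)\<^sup>2 / 2)"
      using elim by (simp add: ec exp_minus inverse_eq_divide)
    finally have "real n * std_normal_density (y n) = a n * exp (- t n - (r n / a n)\<^sup>2 / 2)"
      using elim by (simp add: std_normal_density_def)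
    then have "real n * (std_normal_density (y n) / y n) = a n * exp (- t n - (r n / a n)\<^sup>2 / 2) / (a n * q)"
      using elim by (simp add: q_def)
    moreover have "g n = exp (- t n - (r n / a n)\<^sup>2 / 2) / q" by (simp add: g_def q_def)
    ultimately show ?case using elim q by simp
  qed
  have low: "(\<lambda>n. g n / (1 + 1 / (y n)\<^sup>2)) \<longlonglongrightarrow> exp (- l)"
  proof -
    have "(\<lambda>n. inverse (y n)) \<longlonglongrightarrow> 0" by (rule tendsto_inverse_0_at_top[OF ytop])
    then have "(\<lambda>n. g n / (1 + (inverse (y n))\<^sup>2)) \<longlonglongrightarrow> exp (- l) / (1 + 0\<^sup>2)"
      by (intro tendsto_intros g) auto
    then show ?thesis by (simp add: power_divide inverse_eq_divide)
  qed
  show ?thesis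
  proof (rule tendsto_sandwich[OF _ _ low g])
    show "\<forall>\<^sub>F n in sequentially. g n / (1 + 1 / (y n)\<^sup>2) \<le> real n * normal_tail_prob (y n)"
      using gphi ypos
    proof eventually_elim
      case (elim n)
      have p: "1 + 1 / (y n)\<^sup>2 > 0" by (intro add_pos_nonneg) auto
      have "g n \<le> real n * ((1 + 1 / (y n)\<^sup>2) * normal_tail_prob (y n))"
        unfolding elim(1)[symmetric] using elim by (intro mult_left_mono mills_ratio) auto
      then show ?case using p by (simp add: pos_divide_le_eq mult_ac)
    qed
    show "\<forall>\<^sub>F n in sequentially. real n * normal_tail_prob (y n) \<le> g n"
      using gphi ypos
    proof eventually_elim
      case (elim n)
      then show ?case unfolding elim(1)[symmetric] by (intro mult_left_mono mills_ratio) auto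
    qed
  qed
qed

subsection \<open>The largest row sum\<close>

context gauss_mat
begin

text \<open>A row sum in \<open>K\<close> splits into \<open>U\<close>, over the columns outside
  \<open>K\<close>, and \<open>V\<close>, over those inside. The \<open>U i\<close> are independent
  of variance \<open>\<sigma>\<^sup>2\<close>, while \<open>V i\<close> has variance
  \<open>(k - 1) / n\<close>. Moving the level by \<open>h\<close> absorbs \<open>V\<close> unless
  some \<open>V i\<close> reaches \<open>h\<close> in absolute value, which is counted in
  \<open>err\<close>.\<close>

lemma joint_tail_bounds:
  assumes K: "K \<subseteq> {..<n}" "card K = k" "1 \<le> k" "k < n" and h: "h > 0"
  defines "\<sigma> \<equiv> sqrt ((real n - real k) / real n)"
    and "err \<equiv> real k * (2 * exp (- real n * h\<^sup>2 / (2 * real k)))"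
  shows "prob {\<omega> \<in> space M. \<forall>i\<in>K. d < rowsum i \<omega>} \<le> normal_tail_prob ((d - h) / \<sigma>) ^ k + err"
    and "normal_tail_prob ((d + h) / \<sigma>) ^ k - err \<le> prob {\<omega> \<in> space M. \<forall>i\<in>K. d < rowsum i \<omega>}"
proof -
  let ?T = "{..<n} - K"
  define U where "U i \<omega> = (\<Sum>j\<in>?T. 1 * W i j \<omega>)" for i \<omega>
  define V where "V i \<omega> = (\<Sum>j\<in>K - {i}. 1 * W i j \<omega>)" for i \<omega>
  have fK: "finite K" using K(1) finite_subset by blast
  have Kne: "K \<noteq> {}" using K(2,3) by auto
  have split: "rowsum i \<omega> = U i \<omega> + V i \<omega>" if "i \<in> K" for i \<omega>
    unfolding rowsum_def U_def V_def
    using sum.subset_diff[OF K(1), of "\<lambda>j. W i j \<omega>"] sum.remove[OF fK that, of "\<lambda>j. W i j \<omega>"]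
    by (simp add: diag)
  have sp: "\<sigma> > 0" using K by (simp add: \<sigma>_def)
  have cT: "(\<Sum>j\<in>?T. 1\<^sup>2) = real n - real k"
    using K fK by (simp add: card_Diff_subset of_nat_diff)
  have sig: "1 / sqrt n * sqrt (real n - real k) = \<sigma>" by (simp add: \<sigma>_def real_sqrt_divide)
  have Un: "distributed M lborel (U i) (normal_density 0 \<sigma>)" if "i \<in> K" for i
    using row_normal[of i ?T "\<lambda>_. 1"] K that unfolding U_def cT sig by auto
  have Uind: "indep_vars (\<lambda>_. borel) U K"
    unfolding U_def using K by (intro indep_rows) auto
  have Um: "U i \<in> borel_measurable M" if "i \<in> K" for i using distributed_measurable[OF Un[OF that]] by simp
  have PU: "prob {\<omega> \<in> space M. \<forall>i\<in>K. u \<le> U i \<omega>} = normal_tail_prob (u / \<sigma>) ^ k" for u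
  proof -
    have "{\<omega> \<in> space M. \<forall>i\<in>K. u \<le> U i \<omega>} = (\<Inter>i\<in>K. U i -` {u..} \<inter> space M)" using Kne by auto
    also have "prob \<dots> = (\<Prod>i\<in>K. prob (U i -` {u..} \<inter> space M))"
      by (rule indep_varsD[OF Uind Kne fK]) auto
    also have "\<dots> = (\<Prod>i\<in>K. normal_tail_prob (u / \<sigma>))"
    proof (intro prod.cong refl)
      fix i assume i: "i \<in> K"
      have "U i -` {u..} \<inter> space M = {\<omega> \<in> space M. u \<le> U i \<omega>}" by auto
      then show "prob (U i -` {u..} \<inter> space M) = normal_tail_prob (u / \<sigma>)"
        using normal_tail_prob_eq[OF Un[OF i] sp] by simp
    qed
    finally show ?thesis by (simp add: K(2))
  qed
  have Vm: "V i \<in> borel_measurable M" if "i \<in> K" for i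
    unfolding V_def using K that
    by (intro borel_measurable_sum borel_measurable_times borel_measurable_const W_measurable) auto
  have Rm: "rowsum i \<in> borel_measurable M" if "i \<in> K" for i
    using K that by (intro rowsum_measurable) auto
  let ?B = "\<Union>i\<in>K. {\<omega> \<in> space M. \<bar>V i \<omega>\<bar> \<ge> h}"
  have Bev: "?B \<in> events"
  proof (rule sets.finite_UN[OF fK])
    fix i assume "i \<in> K"
    note [measurable] = Vm[OF this]
    show "{\<omega> \<in> space M. \<bar>V i \<omega>\<bar> \<ge> h} \<in> events" by measurable
  qed
  have Vt: "prob {\<omega> \<in> space M. \<bar>V i \<omega>\<bar> \<ge> h} \<le> 2 * exp (- real n * h\<^sup>2 / (2 * real k))" if i: "i \<in> K" for i
  \<comment> \<open>For a single row nothing is shared: \<open>V i\<close> is identically zero and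
    has no density.\<close>
  proof (cases "k = 1")
    case True
    then have "K - {i} = {}" using K(2) i by (auto simp: card_1_singleton_iff)
    then have "V i \<omega> = 0" for \<omega> unfolding V_def by (simp only: sum.empty)
    then show ?thesis using h by simp
  next
    case False
    let ?s = "1 / sqrt n * sqrt (real k - 1)"
    have cK: "(\<Sum>j\<in>K - {i}. 1\<^sup>2) = real k - 1" using K i fK by (simp add: of_nat_diff)
    have k: "real k - 1 > 0" using False K(3) by simp
    have "distributed M lborel (V i) (normal_density 0 ?s)"
      using row_normal[of i "K - {i}" "\<lambda>_. 1"] K(1) i k unfolding V_def cK by auto
    then have "prob {\<omega> \<in> space M. \<bar>V i \<omega>\<bar> \<ge> h} \<le> 2 * exp (- h\<^sup>2 / (2 * ?s\<^sup>2))"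
      using n k h by (intro normal_tail_abs) auto
    also have "?s\<^sup>2 = (real k - 1) / real n" using k by (simp add: power_mult_distrib power_divide)
    also have "2 * exp (- h\<^sup>2 / (2 * ((real k - 1) / real n))) \<le> 2 * exp (- real n * h\<^sup>2 / (2 * real k))"
    proof -
      have "real n * h\<^sup>2 / (2 * real k) \<le> real n * h\<^sup>2 / (2 * (real k - 1))"
        using k by (intro divide_left_mono) auto
      then show ?thesis using n by (simp add: mult.commute)
    qed
    finally show ?thesis .
  qed
  have "prob ?B \<le> (\<Sum>i\<in>K. prob {\<omega> \<in> space M. \<bar>V i \<omega>\<bar> \<ge> h})"
    using Vm by (intro finite_measure_subadditive_finite fK) auto
  also have "\<dots> \<le> (\<Sum>i\<in>K. 2 * exp (- real n * h\<^sup>2 / (2 * real k)))" by (intro sum_mono Vt)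
  finally have PB: "prob ?B \<le> err" by (simp add: err_def K(2))
  have Uev: "{\<omega> \<in> space M. \<forall>i\<in>K. u \<le> U i \<omega>} \<in> events" for u
    using Um by (intro sets.sets_Collect_finite_All fK) auto
  have Rev: "{\<omega> \<in> space M. \<forall>i\<in>K. d < rowsum i \<omega>} \<in> events"
    using Rm by (intro sets.sets_Collect_finite_All fK) auto
  have "prob {\<omega> \<in> space M. \<forall>i\<in>K. d < rowsum i \<omega>} \<le> prob ({\<omega> \<in> space M. \<forall>i\<in>K. d - h \<le> U i \<omega>} \<union> ?B)"
  proof (rule finite_measure_mono)
    show "{\<omega> \<in> space M. \<forall>i\<in>K. d < rowsum i \<omega>} \<subseteq> {\<omega> \<in> space M. \<forall>i\<in>K. d - h \<le> U i \<omega>} \<union> ?B"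
      using split by (auto simp: not_le abs_le_iff) (smt (verit))
  qed (use Uev Bev in auto)
  also have "\<dots> \<le> prob {\<omega> \<in> space M. \<forall>i\<in>K. d - h \<le> U i \<omega>} + prob ?B"
    by (rule measure_Un_le[OF Uev Bev])
  finally show "prob {\<omega> \<in> space M. \<forall>i\<in>K. d < rowsum i \<omega>} \<le> normal_tail_prob ((d - h) / \<sigma>) ^ k + err"
    using PB by (simp add: PU)
  have "prob {\<omega> \<in> space M. \<forall>i\<in>K. d + h \<le> U i \<omega>} \<le> prob ({\<omega> \<in> space M. \<forall>i\<in>K. d < rowsum i \<omega>} \<union> ?B)"
  proof (rule finite_measure_mono)
    show "{\<omega> \<in> space M. \<forall>i\<in>K. d + h \<le> U i \<omega>} \<subseteq> {\<omega> \<in> space M. \<forall>i\<in>K. d < rowsum i \<omega>} \<union> ?B"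
      using split by (auto simp: not_le abs_le_iff) (smt (verit))
  qed (use Rev Bev in auto)
  also have "\<dots> \<le> prob {\<omega> \<in> space M. \<forall>i\<in>K. d < rowsum i \<omega>} + prob ?B"
    by (rule measure_Un_le[OF Rev Bev])
  finally show "normal_tail_prob ((d + h) / \<sigma>) ^ k - err \<le> prob {\<omega> \<in> space M. \<forall>i\<in>K. d < rowsum i \<omega>}"
    using PB by (simp add: PU)
qed

text \<open>Normalised so that each factor has a finite limit: \<open>C\<close> tends to
  \<open>1 / fact k\<close>, and \<open>n\<close> times the tail probability to
  \<open>exp (- t)\<close> at the level used later.\<close>

lemma joint_sum_bounds:
  assumes k: "1 \<le> k" "k < n" and h: "h > 0"
  defines "\<sigma> \<equiv> sqrt ((real n - real k) / real n)"
    and "err \<equiv> real k * (2 * exp (- real n * h\<^sup>2 / (2 * real k)))"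
    and "C \<equiv> real (n choose k) / real n ^ k"
  shows "joint_sum n (\<lambda>i \<omega>. d < rowsum i \<omega>) k \<le> C * (real n * normal_tail_prob ((d - h) / \<sigma>)) ^ k + real n ^ k * err"
    and "C * (real n * normal_tail_prob ((d + h) / \<sigma>)) ^ k - real n ^ k * err \<le> joint_sum n (\<lambda>i \<omega>. d < rowsum i \<omega>) k"
proof -
  let ?sub = "{K. K \<subseteq> {..<n} \<and> card K = k}"
  have card: "real (card ?sub) = real (n choose k)" using n_subsets[of "{..<n}" k] by simp
  have n0: "real n ^ k > 0" using n by simp
  have le: "real (n choose k) * err \<le> real n ^ k * err"
  proof (rule mult_right_mono)
    show "real (n choose k) \<le> real n ^ k"
      using binomial_le_pow[of k n] k by (metis less_imp_le of_nat_le_iff of_nat_power)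
    show "0 \<le> err" by (simp add: err_def)
  qed
  have C: "C * (real n * q) ^ k = real (n choose k) * q ^ k" for q
    using n0 by (simp add: C_def power_mult_distrib)
  have "joint_sum n (\<lambda>i \<omega>. d < rowsum i \<omega>) k \<le> (\<Sum>K\<in>?sub. normal_tail_prob ((d - h) / \<sigma>) ^ k + err)"
    unfolding joint_sum_def \<sigma>_def err_def using k h by (intro sum_mono joint_tail_bounds) auto
  also have "\<dots> = real (n choose k) * normal_tail_prob ((d - h) / \<sigma>) ^ k + real (n choose k) * err"
    by (simp add: card distrib_left)
  finally show "joint_sum n (\<lambda>i \<omega>. d < rowsum i \<omega>) k \<le> C * (real n * normal_tail_prob ((d - h) / \<sigma>)) ^ k + real n ^ k * err"
    using le by (simp add: C)
  have "real (n choose k) * normal_tail_prob ((d + h) / \<sigma>) ^ k - real (n choose k) * err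
      = (\<Sum>K\<in>?sub. normal_tail_prob ((d + h) / \<sigma>) ^ k - err)"
    by (simp add: card right_diff_distrib)
  also have "\<dots> \<le> joint_sum n (\<lambda>i \<omega>. d < rowsum i \<omega>) k"
    unfolding joint_sum_def \<sigma>_def err_def using k h by (intro sum_mono joint_tail_bounds) auto
  finally show "C * (real n * normal_tail_prob ((d + h) / \<sigma>)) ^ k - real n ^ k * err \<le> joint_sum n (\<lambda>i \<omega>. d < rowsum i \<omega>) k"
    using le by (simp add: C)
qed

end

lemma choose_asymptotics: "(\<lambda>n. real (n choose k) / real n ^ k) \<longlonglongrightarrow> 1 / fact k"
proof -
  have "(\<lambda>n. (\<Prod>i<k. (real n - real i) / real n) / fact k) \<longlonglongrightarrow> (\<Prod>i<k. 1) / fact k"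
  proof (intro tendsto_intros)
    show "(\<lambda>n. (real n - real i) / real n) \<longlonglongrightarrow> 1" for i by real_asymp
  qed simp
  moreover have "real (n choose k) / real n ^ k = (\<Prod>i<k. (real n - real i) / real n) / fact k" for n
    by (simp add: binomial_gbinomial gbinomial_prod_rev prod_dividef atLeast0LessThan mult.commute)
  ultimately show ?thesis by simp
qed

text \<open>The classical level for the maximum of \<open>n\<close> independent standard normal
  variables. The point \<open>x\<close> of the theorem corresponds to \<open>t = x + 1\<close>, the
  shift by 1 being the 2 in \<open>centering_b\<close>.\<close>

definition threshold :: "nat \<Rightarrow> real \<Rightarrow> real" where
  "threshold n t = sqrt (2 * ln (real n)) - (ln (ln (real n)) + ln (4 * pi)) / (2 * sqrt (2 * ln (real n)))
     + t / sqrt (2 * ln (real n))"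

text \<open>Moving the level by \<open>n powr (- 1/4)\<close> or dividing it by a standard deviation
  \<open>1 + O(1 / n)\<close> changes it by less than the order of \<open>1 / a\<close>, hence
  leaves the limit unchanged.\<close>

lemma perturbed_tail_asymptotics:
  assumes k: "(k::nat) \<ge> 1"
  shows "(\<lambda>n. real n * normal_tail_prob ((threshold n t + s * real n powr (- 1/4)) / sqrt ((real n - real k) / real n)))
    \<longlonglongrightarrow> exp (- t)"
proof -
  define a where "a n = sqrt (2 * ln (real n))" for n
  define c where "c n = ln (ln (real n)) + ln (4 * pi)" for n
  define \<sigma> where "\<sigma> n = sqrt ((real n - real k) / real n)" for n
  \<comment> \<open>The parameter that the perturbed level would have as an unperturbed one; the
    first summand is \<open>a\<close> times the main part of the level, multiplied by
    \<open>1 / \<sigma> n - 1\<close>.\<close>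
  define u where "u n = (2 * ln (real n) - c n / 2) * (1 / \<sigma> n - 1) + t / \<sigma> n + s * (a n * real n powr (- 1/4) / \<sigma> n)" for n
  show ?thesis
  proof (rule normal_tail_asymptotics)
    have "(\<lambda>n. (2 * ln (real n) - c n / 2) * (1 / \<sigma> n - 1)) \<longlonglongrightarrow> 0"
      unfolding c_def \<sigma>_def using k by real_asymp
    moreover have "\<sigma> \<longlonglongrightarrow> 1" unfolding \<sigma>_def by real_asymp
    moreover have "(\<lambda>n. a n * real n powr (- 1/4) / \<sigma> n) \<longlonglongrightarrow> 0"
      unfolding a_def \<sigma>_def by real_asymp
    ultimately have "u \<longlonglongrightarrow> 0 + t / 1 + s * 0"
      unfolding u_def by (intro tendsto_intros) auto
    then show "u \<longlonglongrightarrow> t" by simp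
    have "\<forall>\<^sub>F n in sequentially. ln (real n) > 0" by real_asymp
    then show "\<forall>\<^sub>F n in sequentially. (threshold n t + s * real n powr (- 1/4)) / sqrt ((real n - real k) / real n)
      = sqrt (2 * ln (real n)) - (ln (ln (real n)) + ln (4 * pi)) / (2 * sqrt (2 * ln (real n))) + u n / sqrt (2 * ln (real n))"
    proof eventually_elim
      case (elim n)
      have a: "a n > 0" "a n * a n = 2 * ln (real n)" using elim by (simp_all add: a_def)
      define b where "b = a n - c n / (2 * a n)"
      have ab: "2 * ln (real n) - c n / 2 = a n * b" using a by (simp add: b_def right_diff_distrib)
      have "u n / a n = b / \<sigma> n - b + t / a n / \<sigma> n + s * real n powr (- 1/4) / \<sigma> n"
        unfolding u_def ab using a by (simp add: add_divide_distrib right_diff_distrib diff_divide_distrib)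
      then have "(b + t / a n + s * real n powr (- 1/4)) / \<sigma> n = b + u n / a n"
        by (simp add: add_divide_distrib)
      then show ?case by (simp add: threshold_def b_def a_def c_def \<sigma>_def)
    qed
  qed
qed

lemma max_rowsum_limit:
  assumes G: "\<And>n. n \<ge> 2 \<Longrightarrow> gauss_mat (M n) n (W n)"
  shows "(\<lambda>n. measure (M n) {\<omega> \<in> space (M n). \<forall>i<n. gauss_mat.rowsum n (W n) i \<omega> \<le> threshold n t})
    \<longlonglongrightarrow> exp (- exp (- t))"
proof (rule poisson_limit_bonferroni)
  define P where "P n i \<omega> \<longleftrightarrow> threshold n t < gauss_mat.rowsum n (W n) i \<omega>" for n i \<omega>
  define S where "S n k = prob_space.joint_sum (M n) n (P n) k" for n k
  have ev2: "\<forall>\<^sub>F n in sequentially. n \<ge> (2::nat)" by (rule eventually_ge_at_top)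
  have bon: "(even m \<longrightarrow> measure (M n) {\<omega> \<in> space (M n). \<forall>i<n. gauss_mat.rowsum n (W n) i \<omega> \<le> threshold n t} \<le> (\<Sum>k\<le>m. (- 1) ^ k * S n k))
    \<and> (odd m \<longrightarrow> (\<Sum>k\<le>m. (- 1) ^ k * S n k) \<le> measure (M n) {\<omega> \<in> space (M n). \<forall>i<n. gauss_mat.rowsum n (W n) i \<omega> \<le> threshold n t})"
    if "n \<ge> 2" for n m
  proof -
    interpret gauss_mat "M n" n "W n" using G[OF that] .
    have ev: "{\<omega> \<in> space (M n). P n i \<omega>} \<in> events" if "i < n" for i
      unfolding P_def using rowsum_measurable[OF that] by measurable
    show ?thesis
      using bonferroni[of n "P n" m, OF ev] by (simp add: S_def P_def not_less)
  qed
  show "\<forall>\<^sub>F n in sequentially. measure (M n) {\<omega> \<in> space (M n). \<forall>i<n. gauss_mat.rowsum n (W n) i \<omega> \<le> threshold n t} \<le> (\<Sum>k\<le>m. (- 1) ^ k * S n k)"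
    if "even m" for m using ev2 by eventually_elim (use bon that in blast)
  show "\<forall>\<^sub>F n in sequentially. (\<Sum>k\<le>m. (- 1) ^ k * S n k) \<le> measure (M n) {\<omega> \<in> space (M n). \<forall>i<n. gauss_mat.rowsum n (W n) i \<omega> \<le> threshold n t}"
    if "odd m" for m using ev2 by eventually_elim (use bon that in blast)
  show "(\<lambda>n. S n k) \<longlonglongrightarrow> exp (- t) ^ k / fact k" for k
  proof (cases "k = 0")
    case True
    \<comment> \<open>The empty index set contributes probability 1; the joint bounds start at
      \<open>k = 1\<close>, because independence is applied to a nonempty family.\<close>
    have S0: "S n 0 = 1" if "n \<ge> 2" for n
    proof -
      interpret gauss_mat "M n" n "W n" using G[OF that] .
      have "{K. K \<subseteq> {..<n} \<and> card K = 0} = {{}}" by (auto dest: finite_subset)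
      then show ?thesis by (simp add: S_def joint_sum_def prob_space)
    qed
    have "\<forall>\<^sub>F n in sequentially. S n k = 1" using ev2 by eventually_elim (simp add: True S0)
    then show ?thesis using True by (simp add: tendsto_eventually)
  next
    case False
    then have k: "k \<ge> 1" by simp
    define \<sigma> where "\<sigma> n = sqrt ((real n - real k) / real n)" for n
    \<comment> \<open>Small compared with \<open>1 / a\<close>, so the level is not felt to move,
      yet \<open>n * h\<^sup>2 = sqrt n\<close>, so the error beats the \<open>n ^ k\<close> index
      sets.\<close>
    define h where "h n = real n powr (- 1/4)" for n
    define err where "err n = real k * (2 * exp (- real n * (h n)\<^sup>2 / (2 * real k)))" for n
    define C where "C n = real (n choose k) / real n ^ k" for n
    have "(\<lambda>n. real n ^ k * exp (- real n * (h n)\<^sup>2 / (2 * real k))) \<longlonglongrightarrow> 0"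
      unfolding h_def using k by real_asymp
    then have "(\<lambda>n. 2 * real k * (real n ^ k * exp (- real n * (h n)\<^sup>2 / (2 * real k)))) \<longlonglongrightarrow> 2 * real k * 0"
      by (intro tendsto_intros)
    then have err: "(\<lambda>n. real n ^ k * err n) \<longlonglongrightarrow> 0" by (simp add: err_def mult_ac)
    have C: "C \<longlonglongrightarrow> 1 / fact k" unfolding C_def by (rule choose_asymptotics)
    have Q: "(\<lambda>n. real n * normal_tail_prob ((threshold n t + s * h n) / \<sigma> n)) \<longlonglongrightarrow> exp (- t)" for s
      unfolding h_def \<sigma>_def by (rule perturbed_tail_asymptotics[OF k])
    have ev: "\<forall>\<^sub>F n in sequentially. n \<ge> 2 \<and> n > k"
      by (intro eventually_conj ev2 eventually_gt_at_top)
    show ?thesis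
    proof (rule tendsto_sandwich)
      show "\<forall>\<^sub>F n in sequentially. C n * (real n * normal_tail_prob ((threshold n t + 1 * h n) / \<sigma> n)) ^ k - real n ^ k * err n \<le> S n k"
        using ev
      proof eventually_elim
        case (elim n)
        interpret gauss_mat "M n" n "W n" using G elim by simp
        show ?case
          using joint_sum_bounds(2)[of k "h n" "threshold n t"] elim k
          unfolding S_def P_def \<sigma>_def err_def C_def by (simp add: h_def)
      qed
      show "\<forall>\<^sub>F n in sequentially. S n k \<le> C n * (real n * normal_tail_prob ((threshold n t + (- 1) * h n) / \<sigma> n)) ^ k + real n ^ k * err n"
        using ev
      proof eventually_elim
        case (elim n)
        interpret gauss_mat "M n" n "W n" using G elim by simp
        show ?case
          using joint_sum_bounds(1)[of k "h n" "threshold n t"] elim k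
          unfolding S_def P_def \<sigma>_def err_def C_def by (simp add: h_def)
      qed
      have "(\<lambda>n. C n * (real n * normal_tail_prob ((threshold n t + 1 * h n) / \<sigma> n)) ^ k - real n ^ k * err n)
          \<longlonglongrightarrow> 1 / fact k * exp (- t) ^ k - 0"
        by (intro tendsto_diff tendsto_mult tendsto_power C Q err)
      then show "(\<lambda>n. C n * (real n * normal_tail_prob ((threshold n t + 1 * h n) / \<sigma> n)) ^ k - real n ^ k * err n)
          \<longlonglongrightarrow> exp (- t) ^ k / fact k" by simp
      have "(\<lambda>n. C n * (real n * normal_tail_prob ((threshold n t + (- 1) * h n) / \<sigma> n)) ^ k + real n ^ k * err n)
          \<longlonglongrightarrow> 1 / fact k * exp (- t) ^ k + 0"
        by (intro tendsto_add tendsto_mult tendsto_power C Q err)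
      then show "(\<lambda>n. C n * (real n * normal_tail_prob ((threshold n t + (- 1) * h n) / \<sigma> n)) ^ k + real n ^ k * err n)
          \<longlonglongrightarrow> exp (- t) ^ k / fact k" by simp
    qed
  qed
qed

subsection \<open>Comparison of the largest eigenvalue with the largest row sum\<close>

context gauss_mat
begin

definition lap :: "nat \<Rightarrow> nat \<Rightarrow> 'w \<Rightarrow> real" where
  "lap i j \<omega> = (if i = j then rowsum i \<omega> else 0) - W i j \<omega>"

lemma bilin_lap:
  "bilin n (\<lambda>i j. lap i j \<omega>) v v = (\<Sum>i<n. rowsum i \<omega> * (v i)\<^sup>2) - bilin n (\<lambda>i j. W i j \<omega>) v v"
proof -
  have "(\<Sum>j<n. v i * (if i = j then rowsum i \<omega> else 0) * v j) = rowsum i \<omega> * (v i)\<^sup>2" if "i < n" for i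
  proof -
    have "(\<Sum>j<n. v i * (if i = j then rowsum i \<omega> else 0) * v j) = (\<Sum>j<n. if i = j then rowsum i \<omega> * (v i)\<^sup>2 else 0)"
      by (intro sum.cong refl) (auto simp: power2_eq_square)
    then show ?thesis using that by simp
  qed
  then show ?thesis
    by (simp add: bilin_def lap_def left_diff_distrib right_diff_distrib sum_subtractf)
qed

text \<open>The event that the largest eigenvalue is at most \<open>y\<close>, phrased by quadratic
  forms so that its measurability can be shown directly.\<close>

definition lap_le :: "real \<Rightarrow> 'w set" where
  "lap_le y = {\<omega> \<in> space M. \<forall>v. bilin n (\<lambda>i j. lap i j \<omega>) v v \<le> y * sqn n v}"

text \<open>The uncountable intersection over real vectors reduces to the countable one over
  extensional integer vectors.\<close>

lemma lap_le_event: "lap_le y \<in> events"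
proof -
  have m: "(\<lambda>\<omega>. bilin n (\<lambda>i j. lap i j \<omega>) v v) \<in> borel_measurable M" for v
    unfolding bilin_lap
    by (intro borel_measurable_diff borel_measurable_sum borel_measurable_times borel_measurable_const
        rowsum_measurable bilin_measurable) auto
  have "lap_le y = {\<omega> \<in> space M. \<forall>z \<in> PiE {..<n} (\<lambda>_. UNIV :: int set).
      bilin n (\<lambda>i j. lap i j \<omega>) (rv z) (rv z) \<le> y * sqn n (rv z)}"
    unfolding lap_le_def quadratic_le_iff_int ..
  also have "\<dots> \<in> events"
  proof (rule sets.sets_Collect_countable_All')
    show "{\<omega> \<in> space M. bilin n (\<lambda>i j. lap i j \<omega>) (rv z) (rv z) \<le> y * sqn n (rv z)} \<in> events" for z
      using m[of "rv z"] by measurable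
  qed (auto intro: countable_PiE)
  finally show ?thesis .
qed

lemma max_rowsum_event: "{\<omega> \<in> space M. \<forall>i<n. rowsum i \<omega> \<le> d} \<in> events"
proof -
  have "{\<omega> \<in> space M. \<forall>i\<in>{..<n}. rowsum i \<omega> \<le> d} \<in> events"
    using rowsum_measurable by (intro sets.sets_Collect_finite_All) auto
  then show ?thesis unfolding Ball_def lessThan_iff .
qed

lemma prob_lap_le_lower:
  assumes s: "s > 0" and k: "k > 0" and e: "0 < e" "e \<le> 1" and t: "t \<ge> 0"
    and d: "d + k - t - 30 > 0" and y: "d + k + (1 + e) ^ 3 / (d + k - t - 30) \<le> y"
  shows "prob {\<omega> \<in> space M. \<forall>i<n. rowsum i \<omega> \<le> d} - bad_bound n s k e t \<le> prob (lap_le y)"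
proof -
  obtain B where B: "B \<in> events" "prob B \<le> bad_bound n s k e t"
    "\<And>\<omega>. \<omega> \<in> space M - B \<Longrightarrow> rayleigh_upper_ok k e t \<omega>"
    "\<And>\<omega>. \<omega> \<in> space M - B \<Longrightarrow> rayleigh_lower_ok k e t \<omega>"
    using good_event[OF s k e t] by blast
  have "{\<omega> \<in> space M. \<forall>i<n. rowsum i \<omega> \<le> d} \<subseteq> lap_le y \<union> B"
  proof
    fix \<omega> assume w: "\<omega> \<in> {\<omega> \<in> space M. \<forall>i<n. rowsum i \<omega> \<le> d}"
    show "\<omega> \<in> lap_le y \<union> B"
    proof (cases "\<omega> \<in> B")
      case False
      then have ok: "rayleigh_upper_ok k e t \<omega>" using w B(3) by simp
      have "bilin n (\<lambda>i j. lap i j \<omega>) v v \<le> y * sqn n v" for v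
      proof -
        have "bilin n (\<lambda>i j. lap i j \<omega>) v v \<le> (d + k + (1 + e) ^ 3 / (d + k - t - 30)) * sqn n v"
          unfolding bilin_lap
          by (rule ok[unfolded rayleigh_upper_ok_def, rule_format]) (use w d in auto)
        also have "\<dots> \<le> y * sqn n v" using y by (rule mult_right_mono) simp
        finally show ?thesis .
      qed
      then show ?thesis using w by (simp add: lap_le_def)
    qed simp
  qed
  then have "prob {\<omega> \<in> space M. \<forall>i<n. rowsum i \<omega> \<le> d} \<le> prob (lap_le y \<union> B)"
    by (rule finite_measure_mono) (rule sets.Un[OF lap_le_event B(1)])
  also have "\<dots> \<le> prob (lap_le y) + prob B" by (rule measure_Un_le[OF lap_le_event B(1)])
  finally show ?thesis using B(2) by simp
qed

lemma prob_lap_le_upper: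
  assumes s: "s > 0" and k: "k > 0" and e: "0 < e" "e \<le> 1" and t: "t \<ge> 0"
    and d: "d > 0" and mu: "\<mu> \<ge> 0" "\<mu> * (1 + (30 / d)\<^sup>2) \<le> (1 - e - k\<^sup>2) * (1 / d - (t + 30) / d\<^sup>2)"
      "0 \<le> 1 / d - (t + 30) / d\<^sup>2" and y: "y < d + \<mu>"
  shows "prob (lap_le y) \<le> prob {\<omega> \<in> space M. \<forall>i<n. rowsum i \<omega> \<le> d} + bad_bound n s k e t"
proof -
  obtain B where B: "B \<in> events" "prob B \<le> bad_bound n s k e t"
    "\<And>\<omega>. \<omega> \<in> space M - B \<Longrightarrow> rayleigh_upper_ok k e t \<omega>"
    "\<And>\<omega>. \<omega> \<in> space M - B \<Longrightarrow> rayleigh_lower_ok k e t \<omega>"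
    using good_event[OF s k e t] by blast
  let ?R = "{\<omega> \<in> space M. \<forall>i<n. rowsum i \<omega> \<le> d}"
  have "lap_le y \<subseteq> ?R \<union> B"
  proof
    fix \<omega> assume w: "\<omega> \<in> lap_le y"
    show "\<omega> \<in> ?R \<union> B"
    proof (rule ccontr)
      assume c: "\<omega> \<notin> ?R \<union> B"
      then obtain i where i: "i < n" "d \<le> rowsum i \<omega>" using w by (auto simp: lap_le_def not_le)
      have "\<omega> \<in> space M - B" using c w by (auto simp: lap_le_def)
      then have ok: "rayleigh_lower_ok k e t \<omega>" by (rule B(4))
      have "\<exists>v. sqn n v > 0 \<and> (d + \<mu>) * sqn n v \<le> bilin n (\<lambda>i j. lap i j \<omega>) v v"
        unfolding bilin_lap
        by (rule ok[unfolded rayleigh_lower_ok_def, rule_format]) (use i d mu in auto)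
      then obtain v where v: "sqn n v > 0" "(d + \<mu>) * sqn n v \<le> bilin n (\<lambda>i j. lap i j \<omega>) v v"
        by (elim exE conjE)
      moreover have "bilin n (\<lambda>i j. lap i j \<omega>) v v \<le> y * sqn n v" using w by (simp add: lap_le_def)
      ultimately have "(d + \<mu>) * sqn n v \<le> y * sqn n v" by linarith
      then show False using v(1) y by simp
    qed
  qed
  then have "prob (lap_le y) \<le> prob (?R \<union> B)"
    by (rule finite_measure_mono) (rule sets.Un[OF max_rowsum_event B(1)])
  also have "\<dots> \<le> prob ?R + prob B" by (rule measure_Un_le[OF max_rowsum_event B(1)])
  finally show ?thesis using B(2) by simp
qed

end

text \<open>The level equals \<open>threshold n (x + 1)\<close>, and the extra \<open>1 / a\<close>
  is what the eigenvalue gains over the largest row sum. Comparing with row sums at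
  \<open>threshold n (x - \<epsilon>)\<close> and \<open>threshold n (x + \<epsilon>)\<close> leaves
  slack of order \<open>\<epsilon> / a\<close>, which absorbs all errors for large
  \<open>n\<close>.\<close>

lemma prob_lap_le_limit:
  assumes G: "\<And>n. n \<ge> 2 \<Longrightarrow> gauss_mat (M n) n (W n)"
  shows "(\<lambda>n. measure (M n) (gauss_mat.lap_le (M n) n (W n) (centering_b n + x / scaling_a n)))
    \<longlonglongrightarrow> exp (- exp (- x))"
proof -
  define p where "p n = measure (M n) (gauss_mat.lap_le (M n) n (W n) (centering_b n + x / scaling_a n))" for n
  define q where "q n t = measure (M n) {\<omega> \<in> space (M n). \<forall>i<n. gauss_mat.rowsum n (W n) i \<omega> \<le> threshold n t}" for n t
  define bb where "bb e n = bad_bound n (sparsity n) (1 / ln (real n)) e (ln (real n) powr (1/4))" for e n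
  have q: "(\<lambda>n. q n t) \<longlonglongrightarrow> exp (- exp (- t))" for t
    unfolding q_def by (rule max_rowsum_limit[OF G])
  have bb: "bb e \<longlonglongrightarrow> 0" if "e > 0" for e
    unfolding bb_def by (rule bad_bound_tendsto_0[OF that])
  have y: "centering_b n + x / scaling_a n = threshold n (x + 1)" if "ln (real n) > 0" for n
    by (simp add: centering_b_def scaling_a_def threshold_def add_divide_distrib diff_divide_distrib)
  have ev: "\<forall>\<^sub>F n in sequentially. n \<ge> 2 \<and> ln (real n) > 0 \<and> sparsity n > 0"
  proof -
    have "\<forall>\<^sub>F n in sequentially. real n / (ln (real n)) ^ 4 > 1" by real_asymp
    moreover have "\<forall>\<^sub>F n in sequentially. ln (real n) > 0" by real_asymp
    ultimately show ?thesis using eventually_ge_at_top[of "2::nat"]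
      by eventually_elim (auto simp: sparsity_def)
  qed
  have lower: "\<forall>\<^sub>F n in sequentially. q n (x - \<epsilon>) - bb (\<epsilon> / 8) n \<le> p n" if eps: "0 < \<epsilon>" "\<epsilon> < 1" for \<epsilon>
  proof -
    \<comment> \<open>Small enough for \<open>(1 + e) ^ 3 < 1 + \<epsilon>\<close>, as the excess
      over 1 is at most \<open>7 * e\<close>.\<close>
    define e where "e = \<epsilon> / 8"
    have e: "0 < e" "e \<le> 1" using eps by (simp_all add: e_def)
    have "(1 + e) ^ 3 = 1 + 3 * e + 3 * e\<^sup>2 + e ^ 3" by (simp add: power3_eq_cube power2_eq_square algebra_simps)
    moreover have "e\<^sup>2 \<le> e" "e ^ 3 \<le> e" using e by (auto intro: power_le_one_iff simp: power2_eq_square power3_eq_cube mult_le_one mult_left_le)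
    ultimately have e3: "(1 + e) ^ 3 < 1 + \<epsilon>" using e unfolding e_def by linarith
    define D where "D n = threshold n (x - \<epsilon>) + 1 / ln (real n) - ln (real n) powr (1/4) - 30" for n
    have "\<forall>\<^sub>F n in sequentially. D n > 0" unfolding D_def threshold_def by real_asymp
    moreover have "\<forall>\<^sub>F n in sequentially. 1 / ln (real n) + (1 + e) ^ 3 / D n \<le> (1 + \<epsilon>) / sqrt (2 * ln (real n))"
      unfolding D_def threshold_def using e(1) e3 by real_asymp
    ultimately show ?thesis using ev
    proof eventually_elim
      case (elim n)
      interpret gauss_mat "M n" n "W n" using G elim by simp
      have "threshold n (x - \<epsilon>) + 1 / ln (real n) + (1 + e) ^ 3 / D n \<le> threshold n (x + 1)"
        using elim by (simp add: threshold_def add_divide_distrib diff_divide_distrib)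
      then show ?case
        unfolding p_def q_def bb_def e_def[symmetric] using elim e
        by (intro prob_lap_le_lower) (auto simp: y D_def)
    qed
  qed
  have upper: "\<forall>\<^sub>F n in sequentially. p n \<le> q n (x + \<epsilon>) + bb (\<epsilon> / 4) n" if eps: "0 < \<epsilon>" "\<epsilon> < 1" for \<epsilon>
  proof -
    define e where "e = \<epsilon> / 4"
    have e: "0 < e" "e \<le> 1" "1 - \<epsilon> / 2 < 1 - e" "1 - \<epsilon> / 2 > 0" using eps by (simp_all add: e_def)
    define d where "d n = threshold n (x + \<epsilon>)" for n
    \<comment> \<open>Below \<open>(1 - e) / a\<close>, so the trial vector attains it, yet with the
      shift \<open>\<epsilon> / a\<close> of the level it still exceeds
      \<open>1 / a\<close>.\<close>
    define \<mu> where "\<mu> n = (1 - \<epsilon> / 2) / sqrt (2 * ln (real n))" for n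
    have "\<forall>\<^sub>F n in sequentially. d n > 0" unfolding d_def threshold_def by real_asymp
    moreover have "\<forall>\<^sub>F n in sequentially. 0 \<le> 1 / d n - (ln (real n) powr (1/4) + 30) / (d n)\<^sup>2"
      unfolding d_def threshold_def by real_asymp
    moreover have "\<forall>\<^sub>F n in sequentially. \<mu> n * (1 + (30 / d n)\<^sup>2)
        \<le> (1 - e - (1 / ln (real n))\<^sup>2) * (1 / d n - (ln (real n) powr (1/4) + 30) / (d n)\<^sup>2)"
    proof -
      define g where "g = 1 - \<epsilon> / 2"
      define f where "f = 1 - e"
      have "0 < g" "g < f" using e by (simp_all add: g_def f_def)
      then show ?thesis unfolding d_def threshold_def \<mu>_def g_def[symmetric] f_def[symmetric] by real_asymp
    qed
    ultimately show ?thesis using ev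
    proof eventually_elim
      case (elim n)
      interpret gauss_mat "M n" n "W n" using G elim by simp
      have "1 < \<epsilon> + (1 - \<epsilon> / 2)" using eps by simp
      then have "(x + 1) / sqrt (2 * ln (real n)) < (x + \<epsilon>) / sqrt (2 * ln (real n)) + \<mu> n"
        unfolding \<mu>_def add_divide_distrib[symmetric] using elim by (intro divide_strict_right_mono) auto
      then have "threshold n (x + 1) < d n + \<mu> n"
        by (simp add: d_def threshold_def)
      moreover have "\<mu> n \<ge> 0" using e elim by (simp add: \<mu>_def)
      ultimately show ?case
        unfolding p_def q_def bb_def e_def[symmetric] d_def[symmetric] using elim e
        by (intro prob_lap_le_upper[where \<mu>="\<mu> n"]) (auto simp: y)
    qed
  qed
  \<comment> \<open>Continuity of the Gumbel distribution function closes the gap between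
    \<open>x - \<epsilon>\<close> and \<open>x + \<epsilon>\<close>.\<close>
  have cr: "((\<lambda>\<epsilon>. exp (- exp (- (x + s * \<epsilon>)))) \<longlongrightarrow> exp (- exp (- (x + s * 0)))) (at_right 0)" for s
    by (intro tendsto_intros)
  have small: "\<forall>\<^sub>F \<epsilon> in at_right (0::real). 0 < \<epsilon> \<and> \<epsilon> < 1"
    using eventually_at_right_real[of 0 1] by (auto elim!: eventually_mono)
  have "p \<longlonglongrightarrow> exp (- exp (- x))"
  proof (rule order_tendstoI)
    fix a assume "a < exp (- exp (- x))"
    then have "\<forall>\<^sub>F \<epsilon> in at_right 0. a < exp (- exp (- (x + (- 1) * \<epsilon>)))"
      using order_tendstoD(1)[OF cr[of "- 1"]] by simp
    with small have "\<forall>\<^sub>F \<epsilon> in at_right 0. (0 < \<epsilon> \<and> \<epsilon> < 1) \<and> a < exp (- exp (- (x - \<epsilon>)))"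
      by eventually_elim simp
    then obtain \<epsilon> where eps: "0 < \<epsilon>" "\<epsilon> < 1" "a < exp (- exp (- (x - \<epsilon>)))"
      using eventually_happens'[OF trivial_limit_at_right_real] by blast
    have "(\<lambda>n. q n (x - \<epsilon>) - bb (\<epsilon> / 8) n) \<longlonglongrightarrow> exp (- exp (- (x - \<epsilon>))) - 0"
      using eps by (intro tendsto_diff q bb) auto
    then have "\<forall>\<^sub>F n in sequentially. a < q n (x - \<epsilon>) - bb (\<epsilon> / 8) n"
      using eps(3) by (intro order_tendstoD(1)) auto
    with lower[OF eps(1,2)] show "\<forall>\<^sub>F n in sequentially. a < p n"
      by eventually_elim simp
  next
    fix a assume "exp (- exp (- x)) < a"
    then have "\<forall>\<^sub>F \<epsilon> in at_right 0. exp (- exp (- (x + 1 * \<epsilon>))) < a"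
      using order_tendstoD(2)[OF cr[of 1]] by simp
    with small have "\<forall>\<^sub>F \<epsilon> in at_right 0. (0 < \<epsilon> \<and> \<epsilon> < 1) \<and> exp (- exp (- (x + \<epsilon>))) < a"
      by eventually_elim simp
    then obtain \<epsilon> where eps: "0 < \<epsilon>" "\<epsilon> < 1" "exp (- exp (- (x + \<epsilon>))) < a"
      using eventually_happens'[OF trivial_limit_at_right_real] by blast
    have "(\<lambda>n. q n (x + \<epsilon>) + bb (\<epsilon> / 4) n) \<longlonglongrightarrow> exp (- exp (- (x + \<epsilon>))) + 0"
      using eps by (intro tendsto_add q bb) auto
    then have "\<forall>\<^sub>F n in sequentially. q n (x + \<epsilon>) + bb (\<epsilon> / 4) n < a"
      using eps(3) by (intro order_tendstoD(2)) auto
    with upper[OF eps(1,2)] show "\<forall>\<^sub>F n in sequentially. p n < a"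
      by eventually_elim simp
  qed
  then show ?thesis unfolding p_def .
qed

section \<open>From the GOE to the locale, and the limit theorem\<close>

text \<open>Only entries above the diagonal are read, so symmetry holds for every outcome and index
  pair, whereas \<open>GOE\<close> grants it only on the sample space and inside the matrix.\<close>

definition offdiag :: "('w \<Rightarrow> real mat) \<Rightarrow> nat \<Rightarrow> nat \<Rightarrow> 'w \<Rightarrow> real" where
  "offdiag A i j \<omega> = (if i < j then A \<omega> $$ (i, j) else if j < i then A \<omega> $$ (j, i) else 0)"

lemma gauss_mat_offdiag:
  assumes "GOE M n A" and n: "n \<ge> 2"
  shows "gauss_mat M n (offdiag A)"
proof -
  have G: "prob_space M"
    "prob_space.indep_vars M (\<lambda>_. borel) (\<lambda>(i, j) \<omega>. A \<omega> $$ (i, j)) {(i, j). i \<le> j \<and> j < n}"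
    "\<And>i j. i \<le> j \<Longrightarrow> j < n \<Longrightarrow> distributed M lborel (\<lambda>\<omega>. A \<omega> $$ (i, j))
          (normal_density 0 (sqrt ((1 + of_bool (i = j)) / real n)))"
    using assms(1) unfolding GOE_def by auto
  interpret prob_space M by (rule G(1))
  have eq: "offdiag A i j = (\<lambda>\<omega>. A \<omega> $$ (i, j))" if "i < j" for i j
    using that by (auto simp: offdiag_def)
  show ?thesis
  proof
    show "offdiag A i j = offdiag A j i" for i j by (auto simp: offdiag_def)
    show "offdiag A i i \<omega> = 0" for i \<omega> by (simp add: offdiag_def)
    have "indep_vars (\<lambda>_. borel) (\<lambda>(i, j) \<omega>. A \<omega> $$ (i, j)) (upper_pairs n)"
      by (rule indep_vars_subset[OF G(2)]) (auto simp: upper_pairs_def)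
    then show "indep_vars (\<lambda>_. borel) (\<lambda>(i, j). offdiag A i j) (upper_pairs n)"
      by (rule indep_vars_cong[THEN iffD1, rotated -1]) (auto simp: upper_pairs_def eq)
    show "distributed M lborel (offdiag A i j) (normal_density 0 (1 / sqrt n))" if "i < j" "j < n" for i j
      using G(3)[of i j] that by (simp add: eq real_sqrt_divide)
  qed (rule n)
qed

lemma largest_eigenvalue_laplacian_le:
  assumes G: "GOE M n A" and n: "n \<ge> 2" and w: "\<omega> \<in> space M"
  shows "largest_eigenvalue (laplacian (A \<omega>)) \<le> y \<longleftrightarrow> \<omega> \<in> gauss_mat.lap_le M n (offdiag A) y"
proof -
  interpret gauss_mat M n "offdiag A" by (rule gauss_mat_offdiag[OF G n])
  have A: "A \<omega> \<in> carrier_mat n n" and T: "transpose_mat (A \<omega>) = A \<omega>"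
    using G w by (auto simp: GOE_def)
  have A_sym: "A \<omega> $$ (i, j) = A \<omega> $$ (j, i)" if "i < n" "j < n" for i j
    using A T that by (metis carrier_matD index_transpose_mat(1))
  have off: "offdiag A i j \<omega> = (if i = j then 0 else A \<omega> $$ (i, j))" if "i < n" "j < n" for i j
    using A_sym[OF that] by (auto simp: offdiag_def)
  have L: "laplacian (A \<omega>) \<in> carrier_mat n n" using A by (auto simp: laplacian_def mat_diag_def)
  have entry: "laplacian (A \<omega>) $$ (i, j) = lap i j \<omega>" if ij: "i < n" "j < n" for i j
  proof -
    have "(\<Sum>j<n. A \<omega> $$ (i, j)) - A \<omega> $$ (i, i) = (\<Sum>j\<in>{..<n} - {i}. A \<omega> $$ (i, j))"
      using sum.remove[of "{..<n}" i "\<lambda>j. A \<omega> $$ (i, j)"] ij by simp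
    also have "\<dots> = rowsum i \<omega>"
      unfolding rowsum_def by (rule sum.mono_neutral_cong_left) (use ij off in auto)
    finally have "(\<Sum>j<n. A \<omega> $$ (i, j)) - A \<omega> $$ (i, i) = rowsum i \<omega>" .
    then show ?thesis
      using A ij by (auto simp: laplacian_def mat_diag_def lap_def off)
  qed
  have "largest_eigenvalue (laplacian (A \<omega>)) \<le> y \<longleftrightarrow>
      (\<forall>x. bilin n (\<lambda>i j. laplacian (A \<omega>) $$ (i, j)) x x \<le> y * sqn n x)"
    using n by (intro largest_eigenvalue_rayleigh[OF L]) (auto simp: entry lap_def sym)
  also have "\<dots> \<longleftrightarrow> (\<forall>x. bilin n (\<lambda>i j. lap i j \<omega>) x x \<le> y * sqn n x)"
    by (simp add: bilin_def entry)
  finally show ?thesis using w by (simp add: lap_le_def)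
qed

theorem theorem1p2:
  fixes M :: "nat \<Rightarrow> 'w measure" and A :: "nat \<Rightarrow> 'w \<Rightarrow> real mat"
  assumes "\<And>n. n \<ge> 1 \<Longrightarrow> GOE (M n) n (A n)"
  shows "weak_conv_m
    (\<lambda>n. distr (M n) borel
       (\<lambda>\<omega>. scaling_a n * (largest_eigenvalue (laplacian (A n \<omega>)) - centering_b n)))
    gumbel"
proof -
  define W where "W n = offdiag (A n)" for n
  define X where "X n \<omega> = scaling_a n * (largest_eigenvalue (laplacian (A n \<omega>)) - centering_b n)" for n \<omega>
  have G: "gauss_mat (M n) n (W n)" if "n \<ge> 2" for n
    unfolding W_def using assms[of n] that by (intro gauss_mat_offdiag) auto
  have cdf: "cdf (distr (M n) borel (X n)) x
      = measure (M n) (gauss_mat.lap_le (M n) n (W n) (centering_b n + x / scaling_a n))"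
    if n: "n \<ge> 2" for n x
  proof -
    interpret gauss_mat "M n" n "W n" by (rule G[OF n])
    have a: "scaling_a n > 0" using n by (simp add: scaling_a_def)
    have le: "X n \<omega> \<le> x \<longleftrightarrow> \<omega> \<in> lap_le (centering_b n + x / scaling_a n)" if "\<omega> \<in> space (M n)" for \<omega> x
    proof -
      have "X n \<omega> \<le> x \<longleftrightarrow> largest_eigenvalue (laplacian (A n \<omega>)) \<le> centering_b n + x / scaling_a n"
        using a by (simp add: X_def field_simps)
      then show ?thesis
        using largest_eigenvalue_laplacian_le[OF assms n that] n unfolding W_def by simp
    qed
    have sets: "{\<omega> \<in> space (M n). X n \<omega> \<le> x} = lap_le (centering_b n + x / scaling_a n)" for x
      using le by (auto simp: lap_le_def)
    \<comment> \<open>Measurability of the rescaled eigenvalue is read off from its sublevel sets,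
      which have just been identified with events.\<close>
    have m: "X n \<in> borel_measurable (M n)"
      unfolding borel_measurable_iff_le by (simp add: sets lap_le_event)
    have "X n -` {..x} \<inter> space (M n) = {\<omega> \<in> space (M n). X n \<omega> \<le> x}" by auto
    then show ?thesis
      unfolding cdf_def using m by (simp add: measure_distr sets)
  qed
  have "(\<lambda>n. cdf (distr (M n) borel (X n)) x) \<longlonglongrightarrow> exp (- exp (- x))" for x
  proof (rule Lim_transform_eventually[OF prob_lap_le_limit[OF G]])
    show "\<forall>\<^sub>F n in sequentially. measure (M n) (gauss_mat.lap_le (M n) n (W n) (centering_b n + x / scaling_a n))
        = cdf (distr (M n) borel (X n)) x"
      using eventually_ge_at_top[of "2::nat"] by eventually_elim (simp add: cdf)
  qed
  then have "weak_conv_m (\<lambda>n. distr (M n) borel (X n)) gumbel"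
    unfolding weak_conv_m_def weak_conv_def cdf_gumbel by simp
  then show ?thesis unfolding X_def .
qed

end
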